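(* Let $(M,g)$ be a continuous spacetime. The following are equivalent: (i) for each $p\in M$ and each cylindrical chart $U$ centred at $p$, $\mathcal{B}^\pm_{\mathrm{ext}}(p,U)=\emptyset$; (ii) for each $p\in M$ and each cylindrical chart $U$ centred at $p$, $\partial I^\pm(p,U)=\partial J^\pm(p,U)$; (iii) $(M,g)$ possesses the push-up property.
   Context: A continuous spacetime $(M,g)$ consists of a smooth, connected, second countable Hausdorff manifold $M$ with a continuous, time-oriented Lorentzian metric $g$. Curves: an absolutely continuous curve $\gamma$ is timelike if $g(\dot\gamma,\dot\gamma)<0$ almost everywhere. It is causal if $g(\dot\gamma,\dot\gamma)\le0$ and $\dot\gamma\ne0$ almost everywhere. It is future/past directed if $\dot\gamma$ lies in the future/past cone almost everywhere. Relative futures and pasts: for $U\subseteq M$ open and $p\in U$, $I^\pm(p,U)$ is the set of points reachable from $p$ by a future/past directed timelike locally Lipschitz curve lying in $U$. $J^\pm(p,U)$ is the set of points reachable from $p$ by such causal curves in $U$, together with $p$ itself. Topological notions (closure, boundary, interior) within a chart domain $U$ refer to the relative topology of $U$. Cylindrical charts: for $C>0$ let $\eta_C=-C\,dt^2+\sum_i(dx^i)^2$. Write $g_1\prec g_2$ if every nonzero $X$ with $g_1(X,X)\le0$ satisfies $g_2(X,X)<0$. A chart $(\varphi=(t,x^1,\dots,x^n),U)$ centred at $p$ is cylindrical if: - $U$ is relatively compact; - $\varphi(U)=L\times V$, where $L\ni0$ is an interval and $0\in V\subseteq\mathbb{R}^n$ is open; - $(\varphi_*g)(0)=\eta_1$;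 - $\eta_{C^{-1}}\prec\varphi_*g\prec\eta_C$ on $L\times V$ for some $C>1$. Exterior bubble sets: $\mathcal{B}^+_{\mathrm{ext}}(p,U):=J^+(p,U)\setminus\overline{I^+(p,U)}$, and analogously $\mathcal{B}^-_{\mathrm{ext}}(p,U):=J^-(p,U)\setminus\overline{I^-(p,U)}$. Push-up property: $(M,g)$ has the push-up property if the following holds. Whenever $\gamma\colon[a,b]\to M$ is an absolutely continuous future (past) directed causal curve from $p=\gamma(a)$ to $q=\gamma(b)$ such that $\{t\in[a,b]:\dot\gamma(t)\text{ exists and is future (past) directed timelike}\}$ has nonzero Lebesgue measure, then in any neighbourhood of $\gamma([a,b])$ there is a future (past) directed timelike Lipschitz curve from $p$ to $q$. *)

theory Defs
  imports "HOL-Analysis.Analysis"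
begin

text \<open>Smooth manifold structure on a (Hausdorff, second countable) topological type 'm,
  modelled on the Euclidean space real \<times> 'v (time coordinate t = fst, space coordinates x = snd).
  A chart is a pair (phi, U) of a map and its (open) domain.\<close>

type_synonym ('m, 'v) chart = "('m \<Rightarrow> real \<times> 'v) \<times> 'm set"

primrec iter_dderiv :: "'a::real_normed_vector list \<Rightarrow> ('a \<Rightarrow> 'b::real_normed_vector) \<Rightarrow> 'a \<Rightarrow> 'b" where
  "iter_dderiv [] f = f"
| "iter_dderiv (v # vs) f = (\<lambda>x. frechet_derivative (iter_dderiv vs f) (at x) v)"

definition Cinf_on :: "'a::euclidean_space set \<Rightarrow> ('a \<Rightarrow> 'b::real_normed_vector) \<Rightarrow> bool" where
  "Cinf_on S f \<longleftrightarrow> open S \<and> (\<forall>vs. \<forall>x\<in>S. iter_dderiv vs f differentiable (at x))"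

definition is_chart :: "('m::topological_space, 'v::euclidean_space) chart \<Rightarrow> bool" where
  "is_chart c \<longleftrightarrow> open (snd c) \<and> open (fst c ` snd c) \<and>
     (\<exists>g. homeomorphism (snd c) (fst c ` snd c) (fst c) g)"

definition transition :: "('m, 'v::euclidean_space) chart \<Rightarrow> ('m, 'v) chart \<Rightarrow> real \<times> 'v \<Rightarrow> real \<times> 'v" where
  "transition c d = fst d \<circ> inv_into (snd c) (fst c)"

definition smoothly_compatible :: "('m::topological_space, 'v::euclidean_space) chart \<Rightarrow> ('m, 'v) chart \<Rightarrow> bool" where
  "smoothly_compatible c d \<longleftrightarrow>
     Cinf_on (fst c ` (snd c \<inter> snd d)) (transition c d) \<and>
     Cinf_on (fst d ` (snd c \<inter> snd d)) (transition d c)"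

definition smooth_atlas :: "('m::topological_space, 'v::euclidean_space) chart set \<Rightarrow> bool" where
  "smooth_atlas A \<longleftrightarrow> (\<forall>c\<in>A. is_chart c) \<and> \<Union>(snd ` A) = UNIV \<and>
     (\<forall>c\<in>A. \<forall>d\<in>A. smoothly_compatible c d) \<and>
     (\<forall>c. is_chart c \<and> (\<forall>d\<in>A. smoothly_compatible c d) \<longrightarrow> c \<in> A)"

definition eta :: "real \<Rightarrow> real \<times> 'v::euclidean_space \<Rightarrow> real \<times> 'v \<Rightarrow> real" where
  "eta C u w = - C * fst u * fst w + snd u \<bullet> snd w"

definition lorentzian_form :: "(real \<times> 'v::euclidean_space \<Rightarrow> real \<times> 'v \<Rightarrow> real) \<Rightarrow> bool" where
  "lorentzian_form B \<longleftrightarrow> (\<exists>L :: real \<times> 'v \<Rightarrow> real \<times> 'v. linear L \<and> bij L \<and> (\<forall>u w. B (L u) (L w) = eta 1 u w))"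

definition cone_prec :: "('e::zero \<Rightarrow> 'e \<Rightarrow> real) \<Rightarrow> ('e \<Rightarrow> 'e \<Rightarrow> real) \<Rightarrow> bool" where
  "cone_prec g1 g2 \<longleftrightarrow> (\<forall>X. X \<noteq> 0 \<and> g1 X X \<le> 0 \<longrightarrow> g2 X X < 0)"

text \<open>Continuous Lorentzian metric, given by its coordinate expressions G c y
  (c a chart, y = phi(m) a coordinate point) with the tensorial transformation law.\<close>
definition continuous_lorentzian_metric ::
  "('m::topological_space, 'v::euclidean_space) chart set \<Rightarrow>
   (('m, 'v) chart \<Rightarrow> real \<times> 'v \<Rightarrow> real \<times> 'v \<Rightarrow> real \<times> 'v \<Rightarrow> real) \<Rightarrow> bool" where
  "continuous_lorentzian_metric A G \<longleftrightarrow>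
     (\<forall>c\<in>A. \<forall>y\<in>fst c ` snd c. lorentzian_form (G c y)) \<and>
     (\<forall>c\<in>A. \<forall>u w. continuous_on (fst c ` snd c) (\<lambda>y. G c y u w)) \<and>
     (\<forall>c\<in>A. \<forall>d\<in>A. \<forall>m\<in>snd c \<inter> snd d. \<forall>u w.
        G c (fst c m) u w =
        G d (fst d m) (frechet_derivative (transition c d) (at (fst c m)) u)
                      (frechet_derivative (transition c d) (at (fst c m)) w))"

text \<open>Time orientation: a continuous timelike vector field T (coordinate expressions T c y),
  declared future directed.\<close>
definition time_orientation ::
  "('m::topological_space, 'v::euclidean_space) chart set \<Rightarrow>
   (('m, 'v) chart \<Rightarrow> real \<times> 'v \<Rightarrow> real \<times> 'v \<Rightarrow> real \<times> 'v \<Rightarrow> real) \<Rightarrow>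
   (('m, 'v) chart \<Rightarrow> real \<times> 'v \<Rightarrow> real \<times> 'v) \<Rightarrow> bool" where
  "time_orientation A G T \<longleftrightarrow>
     (\<forall>c\<in>A. continuous_on (fst c ` snd c) (T c)) \<and>
     (\<forall>c\<in>A. \<forall>y\<in>fst c ` snd c. G c y (T c y) (T c y) < 0) \<and>
     (\<forall>c\<in>A. \<forall>d\<in>A. \<forall>m\<in>snd c \<inter> snd d.
        T d (fst d m) = frechet_derivative (transition c d) (at (fst c m)) (T c (fst c m)))"

definition continuous_spacetime ::
  "('m::{t2_space, second_countable_topology}, 'v::euclidean_space) chart set \<Rightarrow>
   (('m, 'v) chart \<Rightarrow> real \<times> 'v \<Rightarrow> real \<times> 'v \<Rightarrow> real \<times> 'v \<Rightarrow> real) \<Rightarrow>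
   (('m, 'v) chart \<Rightarrow> real \<times> 'v \<Rightarrow> real \<times> 'v) \<Rightarrow> bool" where
  "continuous_spacetime A G T \<longleftrightarrow> connected (UNIV :: 'm set) \<and> smooth_atlas A \<and>
     continuous_lorentzian_metric A G \<and> time_orientation A G T"

text \<open>Causal character of a coordinate tangent vector v at coordinate point y of chart c;
  fut = True: future directed, fut = False: past directed.\<close>
definition directed where
  "directed G T fut c y v \<longleftrightarrow> (if fut then G c y v (T c y) < 0 else G c y v (T c y) > 0)"

definition timelike_vec where
  "timelike_vec G T fut c y v \<longleftrightarrow> G c y v v < 0 \<and> directed G T fut c y v"

definition causal_vec where
  "causal_vec G T fut c y v \<longleftrightarrow> G c y v v \<le> 0 \<and> v \<noteq> 0 \<and> directed G T fut c y v"

definition velocity_sat ::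
  "('m, 'v::euclidean_space) chart set \<Rightarrow> (('m, 'v) chart \<Rightarrow> real \<times> 'v \<Rightarrow> real \<times> 'v \<Rightarrow> bool) \<Rightarrow>
   (real \<Rightarrow> 'm) \<Rightarrow> real \<Rightarrow> real \<Rightarrow> real \<Rightarrow> bool" where
  "velocity_sat A P \<gamma> a b t \<longleftrightarrow> (\<exists>c\<in>A. \<gamma> t \<in> snd c \<and>
     (\<exists>v. ((fst c \<circ> \<gamma>) has_vector_derivative v) (at t within {a..b}) \<and> P c (fst c (\<gamma> t)) v))"

definition abs_cont_on :: "real set \<Rightarrow> (real \<Rightarrow> 'b::real_normed_vector) \<Rightarrow> bool" where
  "abs_cont_on S f \<longleftrightarrow> (\<forall>\<epsilon>>0. \<exists>\<delta>>0. \<forall>D. finite D \<and>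
      (\<forall>(s,t)\<in>D. s \<le> t \<and> {s..t} \<subseteq> S) \<and>
      (\<forall>(s,t)\<in>D. \<forall>(s',t')\<in>D. (s,t) \<noteq> (s',t') \<longrightarrow> {s<..<t} \<inter> {s'<..<t'} = {}) \<and>
      (\<Sum>(s,t)\<in>D. t - s) < \<delta> \<longrightarrow> (\<Sum>(s,t)\<in>D. norm (f t - f s)) < \<epsilon>)"

definition ac_curve :: "('m::topological_space, 'v::euclidean_space) chart set \<Rightarrow> (real \<Rightarrow> 'm) \<Rightarrow> real \<Rightarrow> real \<Rightarrow> bool" where
  "ac_curve A \<gamma> a b \<longleftrightarrow> a < b \<and> continuous_on {a..b} \<gamma> \<and>
     (\<forall>t\<in>{a..b}. \<exists>c\<in>A. \<exists>\<delta>>0. \<gamma> ` ({a..b} \<inter> cball t \<delta>) \<subseteq> snd c \<and>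
        abs_cont_on ({a..b} \<inter> cball t \<delta>) (fst c \<circ> \<gamma>))"

definition loclip_curve :: "('m::topological_space, 'v::euclidean_space) chart set \<Rightarrow> (real \<Rightarrow> 'm) \<Rightarrow> real \<Rightarrow> real \<Rightarrow> bool" where
  "loclip_curve A \<gamma> a b \<longleftrightarrow> a < b \<and> continuous_on {a..b} \<gamma> \<and>
     (\<forall>t\<in>{a..b}. \<exists>c\<in>A. \<exists>\<delta>>0. \<gamma> ` ({a..b} \<inter> cball t \<delta>) \<subseteq> snd c \<and>
        (\<exists>K. K-lipschitz_on ({a..b} \<inter> cball t \<delta>) (fst c \<circ> \<gamma>)))"

definition timelike_curve where
  "timelike_curve A G T fut \<gamma> a b \<longleftrightarrow>
     (AE t in lebesgue. t \<in> {a..b} \<longrightarrow> velocity_sat A (timelike_vec G T fut) \<gamma> a b t)"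

definition causal_curve where
  "causal_curve A G T fut \<gamma> a b \<longleftrightarrow>
     (AE t in lebesgue. t \<in> {a..b} \<longrightarrow> velocity_sat A (causal_vec G T fut) \<gamma> a b t)"

definition rel_I where
  "rel_I A G T fut p U = {q. \<exists>\<gamma> a b. loclip_curve A \<gamma> a b \<and> timelike_curve A G T fut \<gamma> a b \<and>
      \<gamma> a = p \<and> \<gamma> b = q \<and> \<gamma> ` {a..b} \<subseteq> U}"

definition rel_J where
  "rel_J A G T fut p U = {p} \<union> {q. \<exists>\<gamma> a b. loclip_curve A \<gamma> a b \<and> causal_curve A G T fut \<gamma> a b \<and>
      \<gamma> a = p \<and> \<gamma> b = q \<and> \<gamma> ` {a..b} \<subseteq> U}"

definition bubble_ext where
  "bubble_ext A G T fut p U = rel_J A G T fut p U - (top_of_set U closure_of rel_I A G T fut p U)"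

definition cylindrical_chart where
  "cylindrical_chart A G c p \<longleftrightarrow> c \<in> A \<and> p \<in> snd c \<and> fst c p = 0 \<and>
     compact (closure (snd c)) \<and>
     (\<exists>L V. fst c ` snd c = L \<times> V \<and> is_interval L \<and> (0::real) \<in> L \<and> open V \<and> 0 \<in> V) \<and>
     G c 0 = eta 1 \<and>
     (\<exists>C>1. \<forall>y\<in>fst c ` snd c. cone_prec (eta (1 / C)) (G c y) \<and> cone_prec (G c y) (eta C))"

definition push_up_property where
  "push_up_property A G T \<longleftrightarrow>
     (\<forall>fut \<gamma> a b. ac_curve A \<gamma> a b \<and> causal_curve A G T fut \<gamma> a b \<and>
        {t \<in> {a..b}. velocity_sat A (timelike_vec G T fut) \<gamma> a b t} \<notin> null_sets lebesgue \<longrightarrow>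
        (\<forall>N. open N \<and> \<gamma> ` {a..b} \<subseteq> N \<longrightarrow>
           (\<exists>\<sigma> a' b'. loclip_curve A \<sigma> a' b' \<and> timelike_curve A G T fut \<sigma> a' b' \<and>
              \<sigma> a' = \<gamma> a \<and> \<sigma> b' = \<gamma> b \<and> \<sigma> ` {a'..b'} \<subseteq> N)))"

end

theory Submission
  imports Defs
begin

text \<open>
  The futures \<open>I\<close> and \<open>J\<close> of a point in an open set contain an open cone above each point
  of their closure, because being timelike is an open condition on tangent vectors. Hence they have
  the same interior as their closure, and \<open>J \<subseteq> closure I\<close> gives equality of the boundaries. Conversely,
  going down vertically from a point of \<open>J\<close> in a cylindrical chart one has to leave \<open>J\<close>, since the time
  coordinate is nonnegative on it; the exit point lies in \<open>closure I\<close>, and so does everything above.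

  Push-up gives \<open>J \<subseteq> closure I\<close> by prolonging a causal curve by a short timelike segment. For the
  converse, let \<open>\<gamma>\<close> be causal with \<open>\<gamma>'(t0)\<close> timelike. The points \<open>\<gamma>(s)\<close> with \<open>s > t0\<close> close to \<open>t0\<close> are in the
  timelike future of \<open>\<gamma>(t0)\<close>, and this propagates along \<open>\<gamma>\<close>: if a timelike curve \<open>\<sigma>\<close> ends at \<open>\<gamma>(u)\<close> and
  \<open>v > u\<close> is close to \<open>u\<close>, then some late point of \<open>\<sigma>\<close> lies in the causal past of \<open>\<gamma>(v)\<close>, hence in the closure
  of its timelike past, and a slightly earlier point of \<open>\<sigma>\<close> has a whole neighbourhood of it in its future.
  This uses cylindrical charts centred at \<open>\<gamma>(v)\<close>, so their size must be locally uniform. The part of \<open>\<gamma>\<close>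
  before \<open>t0\<close> is treated by time reversal.
\<close>

section \<open>Absolutely continuous functions\<close>

text \<open>Push-up starts from an absolutely continuous curve, whereas \<open>rel_J\<close> admits
  only locally Lipschitz ones. Before (i) can be applied, the curve has to be replaced by a
  Lipschitz causal curve with the same end points. In a cylindrical chart the outer cone
  \<open>eta C\<close> bounds space increments by time increments; deriving this from a condition on
  almost every velocity takes a monotonicity criterion for absolutely continuous functions, hence
  the real analysis at the start. A second obstacle: (i) speaks only of the centre of a chart, while
  the point whose past is needed moves along the curve. The charts are therefore constructed, as
  affine modifications of one fixed chart that belong to \<open>A\<close> by maximality. At the
  centre the metric must equal \<open>eta 1\<close> exactly; the frames achieving this form an orbit
  of the noncompact Lorentz group, so a bounded one has to be selected. Finally, the time coordinate
  of a chart may run against the time orientation. Future and past are therefore compared with it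
  through a sign, which is constant on connected sets.\<close>

definition fine_segments :: "real set \<Rightarrow> real \<Rightarrow> (real \<times> real) set \<Rightarrow> bool" where
  "fine_segments S d D \<longleftrightarrow> finite D \<and> (\<forall>(s,t)\<in>D. s \<le> t \<and> {s..t} \<subseteq> S) \<and>
     (\<forall>(s,t)\<in>D. \<forall>(s',t')\<in>D. (s,t) \<noteq> (s',t') \<longrightarrow> {s<..<t} \<inter> {s'<..<t'} = {}) \<and> (\<Sum>(s,t)\<in>D. t - s) < d"

lemma abs_cont_on_iff:
  "abs_cont_on S f \<longleftrightarrow>
    (\<forall>e>0. \<exists>d>0. \<forall>D. fine_segments S d D \<longrightarrow> (\<Sum>(s,t)\<in>D. norm (f t - f s)) < e)"
  unfolding abs_cont_on_def fine_segments_def ..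

lemma fine_segments_mem: "fine_segments S d D \<Longrightarrow> (s, t) \<in> D \<Longrightarrow> s \<le> t \<and> s \<in> S \<and> t \<in> S"
  unfolding fine_segments_def by fastforce

lemma fine_segments_mono: "fine_segments S' d D \<Longrightarrow> S' \<subseteq> S \<Longrightarrow> fine_segments S d D"
  unfolding fine_segments_def by blast

lemma abs_cont_on_subset: "abs_cont_on S f \<Longrightarrow> S' \<subseteq> S \<Longrightarrow> abs_cont_on S' f"
  unfolding abs_cont_on_iff by (meson fine_segments_mono)

lemma abs_cont_on_dominated:
  assumes f: "abs_cont_on S f"
    and le: "\<And>s t. s \<in> S \<Longrightarrow> t \<in> S \<Longrightarrow> norm (g t - g s) \<le> K * norm (f t - f s)"
  shows "abs_cont_on S g"
  unfolding abs_cont_on_iff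
proof (intro allI impI)
  fix e :: real assume "e > 0"
  \<comment> \<open>\<open>K\<close> carries no sign, so the positive constant
    \<open>\<bar>K\<bar> + 1\<close> takes its place.\<close>
  then have "e / (\<bar>K\<bar> + 1) > 0" by (simp add: add_nonneg_pos)
  then obtain d where d: "d > 0"
    and *: "\<And>D. fine_segments S d D \<Longrightarrow> (\<Sum>(s,t)\<in>D. norm (f t - f s)) < e / (\<bar>K\<bar> + 1)"
    using f unfolding abs_cont_on_iff by meson
  have "(\<Sum>(s,t)\<in>D. norm (g t - g s)) < e" if D: "fine_segments S d D" for D
  proof -
    have "(\<Sum>(s,t)\<in>D. norm (g t - g s)) \<le> (\<Sum>(s,t)\<in>D. (\<bar>K\<bar> + 1) * norm (f t - f s))"
    proof (rule sum_mono, clarify)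
      fix s t assume "(s, t) \<in> D"
      then have "norm (g t - g s) \<le> K * norm (f t - f s)" using le fine_segments_mem[OF D] by blast
      also have "\<dots> \<le> (\<bar>K\<bar> + 1) * norm (f t - f s)" by (rule mult_right_mono) auto
      finally show "norm (g t - g s) \<le> (\<bar>K\<bar> + 1) * norm (f t - f s)" .
    qed
    also have "\<dots> = (\<bar>K\<bar> + 1) * (\<Sum>(s,t)\<in>D. norm (f t - f s))"
      by (simp add: sum_distrib_left case_prod_unfold)
    also have "\<dots> < e" using *[OF D] by (simp add: field_simps)
    finally show ?thesis .
  qed
  then show "\<exists>d>0. \<forall>D. fine_segments S d D \<longrightarrow> (\<Sum>(s,t)\<in>D. norm (g t - g s)) < e" using d by blast
qed

lemma abs_cont_on_cong:
  assumes f: "abs_cont_on S f" and g: "\<And>x. x \<in> S \<Longrightarrow> f x = g x"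
  shows "abs_cont_on S g"
  by (rule abs_cont_on_dominated[OF f, of _ 1]) (simp add: g[symmetric])

lemma lipschitz_compose_abs_cont_on:
  assumes f: "abs_cont_on S f" and g: "K-lipschitz_on (f ` S) g"
  shows "abs_cont_on S (g \<circ> f)"
  by (rule abs_cont_on_dominated[OF f, of _ K]) (use lipschitz_onD[OF g] in \<open>simp add: dist_norm\<close>)

lemma abs_cont_on_ident: "abs_cont_on S (\<lambda>x. x)"
  unfolding abs_cont_on_iff
proof (intro allI impI exI conjI)
  fix e :: real and D assume D: "fine_segments S e D"
  have "(\<Sum>(s,t)\<in>D. norm (t - s)) = (\<Sum>(s,t)\<in>D. t - s)"
    using fine_segments_mem[OF D] by (intro sum.cong) auto
  then show "(\<Sum>(s,t)\<in>D. norm (t - s)) < e" using D by (simp add: fine_segments_def)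
qed

lemma lipschitz_on_imp_abs_cont_on: "K-lipschitz_on S f \<Longrightarrow> abs_cont_on S f"
  using lipschitz_compose_abs_cont_on[OF abs_cont_on_ident, of K S f] by (simp add: comp_def)

lemma abs_cont_on_compose_uminus:
  assumes f: "abs_cont_on S f"
  shows "abs_cont_on (uminus ` S) (\<lambda>t. f (- t))"
  unfolding abs_cont_on_iff
proof (intro allI impI)
  fix e :: real assume "e > 0"
  then obtain d where d: "d > 0"
    and *: "\<And>D. fine_segments S d D \<Longrightarrow> (\<Sum>(s,t)\<in>D. norm (f t - f s)) < e"
    using f unfolding abs_cont_on_iff by meson
  have "(\<Sum>(s,t)\<in>D. norm (f (- t) - f (- s))) < e" if D: "fine_segments (uminus ` S) d D" for D
  proof -
    let ?r = "\<lambda>x. (- snd x, - fst x) :: real \<times> real"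
    have inj: "inj_on ?r D" by (auto simp: inj_on_def prod_eq_iff)
    have 1: "- t \<le> - s \<and> {- t..- s} \<subseteq> S" if "(s, t) \<in> D" for s t
    proof -
      have st: "s \<le> t" "{s..t} \<subseteq> uminus ` S" using D that by (auto simp: fine_segments_def)
      have "uminus ` {s..t} \<subseteq> uminus ` uminus ` S" using st(2) by (rule image_mono)
      then show ?thesis using st(1) by (simp add: image_image)
    qed
    have 2: "{- t<..<- s} \<inter> {- t'<..<- s'} = {}"
      if "(s, t) \<in> D" "(s', t') \<in> D" "(- t, - s) \<noteq> (- t', - s')" for s t s' t'
    proof -
      have "{s<..<t} \<inter> {s'<..<t'} = {}" using D that unfolding fine_segments_def by fastforce
      then have "uminus ` ({s<..<t} \<inter> {s'<..<t'}) = {}" by simp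
      then show ?thesis by (subst (asm) image_Int) auto
    qed
    have "fine_segments S d (?r ` D)"
      unfolding fine_segments_def
    proof (intro conjI)
      show "finite (?r ` D)" "(\<Sum>(s, t)\<in>?r ` D. t - s) < d"
        using D by (simp_all add: fine_segments_def sum.reindex[OF inj] case_prod_unfold)
    qed (use 1 2 in fastforce)+
    from *[OF this] show ?thesis
      by (simp add: sum.reindex[OF inj] case_prod_unfold norm_minus_commute)
  qed
  then show "\<exists>d>0. \<forall>D. fine_segments (uminus ` S) d D \<longrightarrow> (\<Sum>(s,t)\<in>D. norm (f (- t) - f (- s))) < e"
    using d by blast
qed

text \<open>By outer regularity a null set has an open neighbourhood \<open>W\<close> of measure
  below the \<open>\<delta>\<close> of absolute continuity, and nonoverlapping intervals inside
  \<open>W\<close> have total length at most the measure of \<open>W\<close>. Families of sets with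
  disjoint interiors are used because tagged divisions and the covering lemma deliver their
  intervals in this form; \<open>Inf K\<close> and \<open>Sup K\<close> are the end points.\<close>

lemma abs_cont_on_small_near_negligible:
  fixes f :: "real \<Rightarrow> 'b::real_normed_vector"
  assumes f: "abs_cont_on S f" and Z: "negligible Z" and e: "e > 0"
  shows "\<exists>W. open W \<and> Z \<subseteq> W \<and>
    (\<forall>\<D>. finite \<D> \<longrightarrow> (\<forall>K\<in>\<D>. K \<subseteq> W \<inter> S \<and> (\<exists>u v. u \<le> v \<and> K = {u..v})) \<longrightarrow>
       pairwise (\<lambda>A B. interior A \<inter> interior B = {}) \<D> \<longrightarrow>
       (\<Sum>K\<in>\<D>. norm (f (Sup K) - f (Inf K))) < e)"
proof -
  obtain d where d: "d > 0"
    and *: "\<And>D. fine_segments S d D \<Longrightarrow> (\<Sum>(s,t)\<in>D. norm (f t - f s)) < e"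
    using f e unfolding abs_cont_on_iff by meson
  have Zn: "Z \<in> null_sets lebesgue" using Z by (simp add: negligible_iff_null_sets)
  obtain W where W: "open W" "Z \<subseteq> W" "W - Z \<in> lmeasurable" "emeasure lebesgue (W - Z) < ennreal d"
    using sets_lebesgue_outer_open[of Z d] Zn d by (metis null_setsD2)
  have Wem: "emeasure lebesgue W < ennreal d"
    using W Zn by (metis (no_types) emeasure_Diff_null_set borel_open sets_completionI_sets sets_lborel)
  then have Wm: "W \<in> lmeasurable"
    using W(1) by (intro fmeasurableI) (auto intro: less_le_trans order_less_trans)
  then have Wd: "measure lebesgue W < d"
    using Wem d by (simp add: emeasure_eq_measure2 ennreal_less_iff)
  have "(\<Sum>K\<in>\<D>. norm (f (Sup K) - f (Inf K))) < e"
    if fin: "finite \<D>" and K: "\<forall>K\<in>\<D>. K \<subseteq> W \<inter> S \<and> (\<exists>u v. u \<le> v \<and> K = {u..v})"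
      and pw: "pairwise (\<lambda>A B. interior A \<inter> interior B = {}) \<D>" for \<D>
  proof -
    obtain l r where lr: "\<And>K. K \<in> \<D> \<Longrightarrow> l K \<le> r K" "\<And>K. K \<in> \<D> \<Longrightarrow> K = {l K..r K}"
      using K by metis
    have sub: "\<And>K. K \<in> \<D> \<Longrightarrow> {l K..r K} \<subseteq> W \<inter> S" using K lr(2) by metis
    have IS: "Inf K = l K" "Sup K = r K" if KD: "K \<in> \<D>" for K
    proof -
      obtain u v where uv: "K = {u..v}" "l K = u" "r K = v" "u \<le> v"
        using lr[OF KD] by blast
      show "Inf K = l K" "Sup K = r K" using uv by simp_all
    qed
    let ?r = "\<lambda>K. (l K, r K)"
    have inj: "inj_on ?r \<D>"
    proof (rule inj_onI)
      fix A B assume A: "A \<in> \<D>" and B: "B \<in> \<D>" and eq: "?r A = ?r B"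
      have "A = {l A..r A}" by (rule lr(2)[OF A])
      also have "\<dots> = {l B..r B}" using eq by simp
      also have "\<dots> = B" by (rule lr(2)[OF B, symmetric])
      finally show "A = B" .
    qed
    have meas: "measure lebesgue K = r K - l K" "K \<in> lmeasurable" "convex K" "interior K = {l K<..<r K}" if KD: "K \<in> \<D>" for K
    proof -
      obtain u v where uv: "K = {u..v}" "l K = u" "r K = v" "u \<le> v"
        using lr[OF KD] by blast
      show "measure lebesgue K = r K - l K" using uv by simp
      show "K \<in> lmeasurable" "convex K" "interior K = {l K<..<r K}" using uv by simp_all
    qed
    have "(\<Sum>(s,t)\<in>?r ` \<D>. norm (f t - f s)) < e"
    proof (rule *, unfold fine_segments_def, intro conjI)
      show "finite (?r ` \<D>)" using fin by simp
      show "\<forall>(s, t)\<in>?r ` \<D>. s \<le> t \<and> {s..t} \<subseteq> S"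
        using lr(1) sub by auto
      have "{l A<..<r A} \<inter> {l B<..<r B} = {}" if AB: "A \<in> \<D>" "B \<in> \<D>" "(l A, r A) \<noteq> (l B, r B)" for A B
      proof -
        have "A \<noteq> B" using AB(3) by auto
        then have "interior A \<inter> interior B = {}" using pairwiseD[OF pw AB(1,2)] by simp
        then show ?thesis using meas(4) AB by simp
      qed
      then show "\<forall>(s, t)\<in>?r ` \<D>. \<forall>(s', t')\<in>?r ` \<D>. (s, t) \<noteq> (s', t') \<longrightarrow> {s<..<t} \<inter> {s'<..<t'} = {}"
        by auto
      have "(\<Sum>(s, t)\<in>?r ` \<D>. t - s) = (\<Sum>K\<in>\<D>. r K - l K)"
        by (simp add: sum.reindex[OF inj])
      also have "\<dots> = (\<Sum>K\<in>\<D>. measure lebesgue K)"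
        using meas(1) by (intro sum.cong) auto
      also have "\<dots> = measure lebesgue (\<Union>\<D>)"
      proof (rule measure_negligible_finite_Union[symmetric, OF fin])
        show "S \<in> lmeasurable" if "S \<in> \<D>" for S
          by (rule meas(2)[OF that])
        show "pairwise (\<lambda>S T. negligible (S \<inter> T)) \<D>"
        proof (rule pairwiseI)
          fix A B assume AB: "A \<in> \<D>" "B \<in> \<D>" "A \<noteq> B"
          then have 0: "interior (A \<inter> B) = {}" using pw by (auto simp: pairwise_def interior_Int)
          have "convex (A \<inter> B)" using meas(3) AB by (intro convex_Int) auto
          with 0 show "negligible (A \<inter> B)" using negligible_convex_interior by blast
        qed
      qed
      also have "\<dots> \<le> measure lebesgue W"
      proof (rule measure_mono_fmeasurable[OF _ _ Wm])
        show "\<Union>\<D> \<subseteq> W" using K by auto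
        show "\<Union>\<D> \<in> sets lebesgue"
          using meas(2) by (intro sets.finite_Union fin) blast
      qed
      also have "\<dots> < d" by (rule Wd)
      finally show "(\<Sum>(s, t)\<in>?r ` \<D>. t - s) < d" .
    qed
    then show ?thesis
      using IS by (simp add: sum.reindex[OF inj])
  qed
  then show ?thesis using W(1,2) by blast
qed

text \<open>Take a tagged division that is fine for a gauge which, at the exceptional points, is an open
  set carrying little variation, and elsewhere controls the difference quotient.\<close>

lemma abs_cont_on_deriv_nonneg_imp_mono:
  fixes h :: "real \<Rightarrow> real"
  assumes h: "abs_cont_on {a..b} h" and ab: "a \<le> b" and Z: "negligible Z"
    and der: "\<And>t. a < t \<Longrightarrow> t < b \<Longrightarrow> t \<notin> Z \<Longrightarrow> \<exists>d\<ge>0. (h has_real_derivative d) (at t)"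
  shows "h a \<le> h b"
proof (rule field_le_epsilon)
  fix e :: real assume e: "e > 0"
  \<comment> \<open>The good intervals of the division lose at most \<open>e1 * (b - a)\<close> and
    the exceptional ones at most \<open>e1\<close>, which together stay below
    \<open>e\<close>.\<close>
  define e1 where "e1 = e / (b - a + 2)"
  have e1: "e1 > 0" using e ab by (simp add: e1_def)
  \<comment> \<open>The derivative is known only in the open interval, so both end points are
    treated as exceptional tags.\<close>
  define N where "N = Z \<union> {a, b}"
  have N: "negligible N" using Z by (simp add: N_def)
  obtain W where W: "open W" "N \<subseteq> W"
    "\<And>\<D>. finite \<D> \<Longrightarrow> \<forall>K\<in>\<D>. K \<subseteq> W \<inter> {a..b} \<and> (\<exists>u v. u \<le> v \<and> K = {u..v}) \<Longrightarrow>
       pairwise (\<lambda>A B. interior A \<inter> interior B = {}) \<D> \<Longrightarrow>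
       (\<Sum>K\<in>\<D>. norm (h (Sup K) - h (Inf K))) < e1"
    using abs_cont_on_small_near_negligible[OF h N e1] by blast
  have "\<exists>r>0. \<forall>y. \<bar>y - x\<bar> < r \<longrightarrow> (y \<ge> x \<longrightarrow> h y - h x \<ge> - e1 * (y - x)) \<and> (y \<le> x \<longrightarrow> h x - h y \<ge> - e1 * (x - y))"
    if x: "x \<in> {a..b} - N" for x
  proof -
    have "a < x" "x < b" "x \<notin> Z" using x by (auto simp: N_def less_eq_real_def)
    then obtain d where d: "d \<ge> 0" "(h has_real_derivative d) (at x)" using der by blast
    then have "(h has_derivative (*) d) (at x)" by (simp add: has_field_derivative_def)
    then obtain r where r: "r > 0" "\<And>y. norm (y - x) < r \<Longrightarrow> norm (h y - h x - d * (y - x)) \<le> e1 * norm (y - x)"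
      using e1 unfolding has_derivative_at_alt by meson
    have "(y \<ge> x \<longrightarrow> h y - h x \<ge> - e1 * (y - x)) \<and> (y \<le> x \<longrightarrow> h x - h y \<ge> - e1 * (x - y))"
      if y: "\<bar>y - x\<bar> < r" for y
    proof -
      have 1: "\<bar>h y - h x - d * (y - x)\<bar> \<le> e1 * \<bar>y - x\<bar>" using r(2)[of y] y by simp
      show ?thesis
      proof (cases "y \<ge> x")
        case True
        then have "d * (y - x) \<ge> 0" using d(1) by simp
        then show ?thesis using 1 True by (auto simp: abs_le_iff)
      next
        case False
        then have "d * (y - x) \<le> 0" using d(1) by (simp add: mult_nonneg_nonpos)
        then show ?thesis using 1 False by (auto simp: abs_le_iff algebra_simps)
      qed
    qed
    then show ?thesis using r(1) by blast
  qed
  then obtain r where r: "\<And>x. x \<in> {a..b} - N \<Longrightarrow> r x > 0"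
    "\<And>x y. x \<in> {a..b} - N \<Longrightarrow> \<bar>y - x\<bar> < r x \<Longrightarrow> (y \<ge> x \<longrightarrow> h y - h x \<ge> - e1 * (y - x)) \<and> (y \<le> x \<longrightarrow> h x - h y \<ge> - e1 * (x - y))"
    by metis
  define g where "g x = (if x \<in> N then W else if x \<in> {a..b} then ball x (r x) else UNIV)" for x
  have "gauge g" unfolding gauge_def g_def using W r(1) by auto
  then obtain p where p: "p tagged_division_of {a..b}" "g fine p"
    by (rule fine_division_exists_real)
  note pD = tagged_division_ofD[OF p(1)]
  have pK: "\<exists>u v. u \<le> v \<and> K = {u..v}" if xK: "(x, K) \<in> p" for x K
  proof -
    obtain u v where "K = {u..v}" using pD(4)[OF xK] by auto
    moreover have "x \<in> K" by (rule pD(2)[OF xK])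
    ultimately show ?thesis by (intro exI[of _ u] exI[of _ v]) simp
  qed
  have subg: "K \<subseteq> g x" if "(x, K) \<in> p" for x K using p(2) that by (auto simp: fine_def)
  let ?B = "{xK \<in> p. fst xK \<in> N}"
  have "- e1 * (b - a) - e1 \<le> (\<Sum>(x,K)\<in>p. h (Sup K) - h (Inf K))"
  proof -
    have good: "- e1 * (Sup K - Inf K) \<le> h (Sup K) - h (Inf K)" if "(x, K) \<in> p - ?B" for x K
    proof -
      have xK: "(x, K) \<in> p" "x \<notin> N" using that by auto
      obtain u v where uv: "u \<le> v" "K = {u..v}" using pK[OF xK(1)] by blast
      have x: "x \<in> {u..v}" "x \<in> {a..b} - N" using pD(2)[OF xK(1)] pD(3)[OF xK(1)] xK(2) uv by auto
      have "K \<subseteq> ball x (r x)" using subg[OF xK(1)] x by (auto simp: g_def)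
      then have "\<bar>u - x\<bar> < r x" "\<bar>v - x\<bar> < r x" using uv by (auto simp: dist_real_def abs_minus_commute subset_iff)
      then have "h v - h x \<ge> - e1 * (v - x)" "h x - h u \<ge> - e1 * (x - u)"
        using r(2)[OF x(2)] x(1) by auto
      then have "h v - h u \<ge> - e1 * (v - u)" by (simp add: algebra_simps)
      then show ?thesis using uv by simp
    qed
    have "(\<Sum>(x,K)\<in>p. Sup K - Inf K) = b - a"
      using additive_tagged_division_1[OF ab p(1), of "\<lambda>x. x"] .
    moreover have "0 \<le> (\<Sum>(x,K)\<in>?B. Sup K - Inf K)"
      using pK by (intro sum_nonneg) fastforce
    ultimately have len: "(\<Sum>(x,K)\<in>p - ?B. Sup K - Inf K) \<le> b - a"
      using sum_diff[of p ?B "\<lambda>(x,K). Sup K - Inf K"] pD(1) by auto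
    have "- e1 * (b - a) \<le> - e1 * (\<Sum>(x,K)\<in>p - ?B. Sup K - Inf K)"
      using len e1 by simp
    also have "\<dots> = (\<Sum>(x,K)\<in>p - ?B. - e1 * (Sup K - Inf K))"
      unfolding sum_distrib_left by (rule sum.cong) auto
    also have "\<dots> \<le> (\<Sum>(x,K)\<in>p - ?B. h (Sup K) - h (Inf K))"
      using good by (intro sum_mono) fastforce
    finally have 1: "- e1 * (b - a) \<le> (\<Sum>(x,K)\<in>p - ?B. h (Sup K) - h (Inf K))" .
    \<comment> \<open>The smallness of \<open>W\<close> concerns sets of intervals, while the
      division consists of tagged intervals. Two tags can share an interval only if it is
      degenerate, and then its term is zero.\<close>
    have "(\<Sum>(x,K)\<in>?B. \<bar>h (Sup K) - h (Inf K)\<bar>) = (\<Sum>K\<in>snd ` ?B. \<bar>h (Sup K) - h (Inf K)\<bar>)"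
    proof -
      have "(\<Sum>K\<in>snd ` ?B. \<bar>h (Sup K) - h (Inf K)\<bar>) = sum ((\<lambda>K. \<bar>h (Sup K) - h (Inf K)\<bar>) \<circ> snd) ?B"
      proof (rule sum.reindex_nontrivial)
        show "finite ?B" using pD(1) by simp
        fix A B assume AB: "A \<in> ?B" "B \<in> ?B" "A \<noteq> B" "snd A = snd B"
        obtain x K where A: "A = (x, K)" by (rule prod.exhaust)
        have B: "B = (fst B, K)" using AB(4) A by (simp add: prod_eq_iff)
        have "interior K \<inter> interior K = {}" using pD(5)[of x K "fst B" K] AB A B by (simp add: prod_eq_iff)
        moreover have "(x, K) \<in> p" using AB(1) A by simp
        then obtain u v where uv: "u \<le> v" "K = {u..v}" using pK by blast
        ultimately have "interior {u..v} = {}" by (simp only: Int_absorb)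
        then have "Sup K = Inf K" using uv by simp
        then show "\<bar>h (Sup (snd A)) - h (Inf (snd A))\<bar> = 0" using A by simp
      qed
      then show ?thesis unfolding comp_def case_prod_beta by (rule sym)
    qed
    also have "\<dots> < e1"
      unfolding real_norm_def[symmetric]
    proof (rule W(3))
      show "finite (snd ` ?B)" using pD(1) by simp
      have "K \<subseteq> W \<inter> {a..b} \<and> (\<exists>u v. u \<le> v \<and> K = {u..v})" if "(x, K) \<in> ?B" for x K
        using that pK[of x K] pD(3)[of x K] subg[of x K] by (auto simp: g_def)
      then show "\<forall>K\<in>snd ` ?B. K \<subseteq> W \<inter> {a..b} \<and> (\<exists>u v. u \<le> v \<and> K = {u..v})"
        by fastforce
      show "pairwise (\<lambda>A B. interior A \<inter> interior B = {}) (snd ` ?B)"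
        unfolding pairwise_def using pD(5) by fastforce
    qed
    finally have "(\<Sum>(x,K)\<in>?B. \<bar>h (Sup K) - h (Inf K)\<bar>) < e1" .
    moreover have "- (\<Sum>(x,K)\<in>?B. \<bar>h (Sup K) - h (Inf K)\<bar>) \<le> (\<Sum>(x,K)\<in>?B. h (Sup K) - h (Inf K))"
      unfolding sum_negf[symmetric] by (rule sum_mono) auto
    ultimately have 2: "- e1 \<le> (\<Sum>(x,K)\<in>?B. h (Sup K) - h (Inf K))" by simp
    have "(\<Sum>(x,K)\<in>p. h (Sup K) - h (Inf K)) =
      (\<Sum>(x,K)\<in>p - ?B. h (Sup K) - h (Inf K)) + (\<Sum>(x,K)\<in>?B. h (Sup K) - h (Inf K))"
      using pD(1) by (intro sum.subset_diff) auto
    then show ?thesis using 1 2 by simp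
  qed
  also have "\<dots> = h b - h a"
    by (rule additive_tagged_division_1[OF ab p(1)])
  finally have "h a \<le> h b + e1 * (b - a + 1)" by (simp add: algebra_simps)
  also have "e1 * (b - a + 1) \<le> e"
    using e ab by (simp add: e1_def field_simps)
  finally show "h a \<le> h b + e" by simp
qed

text \<open>Lusin's property (N). Monotonicity puts the image of an interval into the interval
  between the values at its ends, so the measure of the image of a cover is bounded by the variation
  of \<open>h\<close> on the cover, which is small near \<open>Z\<close>.\<close>

lemma negligible_mono_abs_cont_image:
  fixes h :: "real \<Rightarrow> real"
  assumes h: "abs_cont_on {a..b} h" and m: "mono_on {a..b} h" and Z: "negligible Z" "Z \<subseteq> {a..b}"
  shows "negligible (h ` Z)"
proof (cases "a < b")
  case False
  then have "finite Z" using Z(2) by (cases "a = b") (auto intro: finite_subset)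
  then show ?thesis by (simp add: negligible_finite)
next
  case True
  show ?thesis
    unfolding negligible_outer_le
  proof (intro allI impI)
    fix e :: real assume e: "e > 0"
    obtain W where W: "open W" "Z \<subseteq> W"
      "\<And>\<D>. finite \<D> \<Longrightarrow> \<forall>K\<in>\<D>. K \<subseteq> W \<inter> {a..b} \<and> (\<exists>u v. u \<le> v \<and> K = {u..v}) \<Longrightarrow>
       pairwise (\<lambda>A B. interior A \<inter> interior B = {}) \<D> \<Longrightarrow>
       (\<Sum>K\<in>\<D>. norm (h (Sup K) - h (Inf K))) < e"
      using abs_cont_on_small_near_negligible[OF h Z(1) e] by blast
    \<comment> \<open>With this gauge the covering lemma yields nonoverlapping intervals that all
      lie in \<open>W\<close>, since each is subordinate to a tag in \<open>Z\<close>.\<close>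
    define g where "g x = (if x \<in> W then W else UNIV)" for x
    have g: "gauge g" using W(1) by (auto simp: gauge_def g_def)
    have Zab: "Z \<subseteq> cbox a b" "box a b \<noteq> {}" using Z(2) True by auto
    obtain \<D> where D: "countable \<D>"  "\<Union>\<D> \<subseteq> cbox a b"
      "\<And>K. K \<in> \<D> \<Longrightarrow> interior K \<noteq> {} \<and> (\<exists>c d. K = cbox c d)"
      "pairwise (\<lambda>A B. interior A \<inter> interior B = {}) \<D>"
      "\<And>K. K \<in> \<D> \<Longrightarrow> \<exists>x \<in> Z \<inter> K. K \<subseteq> g x"
      "Z \<subseteq> \<Union>\<D>"
      by (rule covering_lemma[OF Zab g]) (rule that, assumption+)
    have K: "K \<subseteq> W \<inter> {a..b} \<and> (\<exists>u v. u \<le> v \<and> K = {u..v})" if KD: "K \<in> \<D>" for K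
    proof -
      obtain x where "x \<in> Z" "K \<subseteq> g x" using D(5)[OF KD] by blast
      moreover have "g x = W" using W(2) \<open>x \<in> Z\<close> by (simp add: g_def subset_iff)
      ultimately have KW: "K \<subseteq> W" by simp
      obtain c d where "K = cbox c d" "interior K \<noteq> {}" using D(3)[OF KD] by blast
      then have cd: "K = {c..d}" "c \<le> d" by auto
      have "K \<subseteq> {a..b}" using D(2) KD by (metis Sup_le_iff box_real(2))
      with cd KW show ?thesis by blast
    qed
    define J where "J K = {h (Inf K)..h (Sup K)}" for K
    have J: "h ` K \<subseteq> J K" "measure lebesgue (J K) = norm (h (Sup K) - h (Inf K))" if KD: "K \<in> \<D>" for K
    proof -
      obtain u v where uv: "u \<le> v" "K = {u..v}" using K[OF KD] by blast
      then have "u \<in> {a..b}" "v \<in> {a..b}" using K[OF KD] by auto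
      then have le: "h u \<le> h v" using m uv(1) by (simp add: mono_on_def)
      show "measure lebesgue (J K) = norm (h (Sup K) - h (Inf K))" using uv le by (simp add: J_def)
      show "h ` K \<subseteq> J K"
      proof (rule image_subsetI)
        fix t assume t: "t \<in> K"
        have "h u \<le> h t" "h t \<le> h v"
          using m uv t K[OF KD] by (auto simp: mono_on_def)
        then show "h t \<in> J K" using uv by (simp add: J_def)
      qed
    qed
    have sumle: "(\<Sum>K\<in>F. measure lebesgue (J K)) \<le> e" if F: "F \<subseteq> \<D>" "finite F" for F
    proof -
      have "(\<Sum>K\<in>F. measure lebesgue (J K)) = (\<Sum>K\<in>F. norm (h (Sup K) - h (Inf K)))"
        using J(2) F(1) by (intro sum.cong refl) blast
      also have "\<dots> < e"
      proof (rule W(3)[OF F(2)])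
        show "\<forall>K\<in>F. K \<subseteq> W \<inter> {a..b} \<and> (\<exists>u v. u \<le> v \<and> K = {u..v})" using K F(1) by blast
        show "pairwise (\<lambda>A B. interior A \<inter> interior B = {}) F" using D(4) F(1) by (rule pairwise_subset)
      qed
      finally show ?thesis by simp
    qed
    \<comment> \<open>The cover is countable, but the variation is controlled only on finite
      families; the bound passes to the union because it is uniform over finite subfamilies.\<close>
    have "(\<Union>K\<in>\<D>. J K) \<in> lmeasurable \<and> measure lebesgue (\<Union>K\<in>\<D>. J K) \<le> e"
    proof -
      have cJ: "countable (J ` \<D>)" using D(1) by simp
      have mJ: "\<And>S. S \<in> J ` \<D> \<Longrightarrow> S \<in> lmeasurable" by (auto simp: J_def)
      have "measure lebesgue (\<Union>F) \<le> e" if F: "F \<subseteq> J ` \<D>" "finite F" for F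
      proof -
        obtain F' where F': "F' \<subseteq> \<D>" "finite F'" "F = J ` F'"
          using F by (meson finite_subset_image)
        have "measure lebesgue (\<Union>F) \<le> (\<Sum>S\<in>F'. measure lebesgue (J S))"
          unfolding F'(3) by (rule measure_UNION_le) (auto simp: F' J_def)
        also have "\<dots> \<le> e" by (rule sumle[OF F'(1,2)])
        finally show ?thesis .
      qed
      then show ?thesis
        using fmeasurable_Union_bound[OF cJ mJ] measure_Union_bound[OF cJ mJ] by blast
    qed
    moreover have "h ` Z \<subseteq> (\<Union>K\<in>\<D>. J K)" using D(6) J(1) by blast
    ultimately show "\<exists>T. h ` Z \<subseteq> T \<and> T \<in> lmeasurable \<and> measure lebesgue T \<le> e" by blast
  qed
qed

section \<open>Smooth maps in coordinates\<close>

text \<open>\<open>frechet_derivative\<close> is a choice from the maps satisfying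
  \<open>has_derivative\<close>, and that predicate sees only the germ of the function. Equality
  therefore holds at every point of \<open>S\<close>, which lets the inductions on
  \<open>iter_dderiv\<close> rewrite under the derivative.\<close>

lemma frechet_derivative_cong_open:
  assumes "open S" "x \<in> S" "\<And>y. y \<in> S \<Longrightarrow> f y = g y"
  shows "frechet_derivative f (at x) = frechet_derivative g (at x)"
proof -
  have "(f has_derivative f') (at x) \<longleftrightarrow> (g has_derivative f') (at x)" for f'
    using assms has_derivative_transform_within_open[of f f' x UNIV S g]
      has_derivative_transform_within_open[of g f' x UNIV S f] by metis
  then show ?thesis by (simp add: frechet_derivative_def)
qed

lemma differentiable_cong_open:
  assumes "open S" "x \<in> S" "\<And>y. y \<in> S \<Longrightarrow> f y = g y" "f differentiable (at x)"
  shows "g differentiable (at x)"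
  using assms has_derivative_transform_within_open[of f _ x UNIV S g]
  unfolding differentiable_def by metis

lemma iter_dderiv_cong_open:
  assumes "open S" "\<And>y. y \<in> S \<Longrightarrow> f y = g y" "x \<in> S"
  shows "iter_dderiv vs f x = iter_dderiv vs g x"
  using assms(3)
proof (induction vs arbitrary: x)
  case (Cons v vs)
  then show ?case
    using frechet_derivative_cong_open[OF assms(1) Cons.prems, of "iter_dderiv vs f" "iter_dderiv vs g"] by simp
qed (use assms in auto)

lemma Cinf_on_cong:
  assumes "Cinf_on S f" "\<And>y. y \<in> S \<Longrightarrow> f y = g y"
  shows "Cinf_on S g"
proof -
  have S: "open S" using assms(1) by (simp add: Cinf_on_def)
  have "iter_dderiv vs g differentiable (at x)" if x: "x \<in> S" for vs x
  proof (rule differentiable_cong_open[OF S x, of "iter_dderiv vs f"])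
    show "iter_dderiv vs f y = iter_dderiv vs g y" if "y \<in> S" for y
      using iter_dderiv_cong_open[OF S assms(2) that] .
    show "iter_dderiv vs f differentiable (at x)" using assms(1) x by (simp add: Cinf_on_def)
  qed
  then show ?thesis using S by (simp add: Cinf_on_def)
qed

lemma Cinf_on_subset: "Cinf_on S f \<Longrightarrow> open S' \<Longrightarrow> S' \<subseteq> S \<Longrightarrow> Cinf_on S' f"
  unfolding Cinf_on_def by blast

lemma Cinf_on_imp_differentiable: "Cinf_on S f \<Longrightarrow> x \<in> S \<Longrightarrow> f differentiable (at x)"
  unfolding Cinf_on_def by (metis iter_dderiv.simps(1))

lemma frechet_derivative_at_compose_affine:
  assumes "f differentiable (at (b + L x))" "bounded_linear L"
  shows "((\<lambda>y. f (b + L y)) has_derivative (\<lambda>v. frechet_derivative f (at (b + L x)) (L v))) (at x)"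
proof -
  have 1: "((\<lambda>y. b + L y) has_derivative L) (at x)"
    using assms(2) by (auto intro!: derivative_eq_intros bounded_linear_imp_has_derivative)
  have 2: "(f has_derivative frechet_derivative f (at (b + L x))) (at (b + L x))"
    using assms(1) frechet_derivative_works by blast
  show ?thesis using has_derivative_compose[OF 1 2] .
qed

text \<open>With an affine inner map the chain rule produces no further terms: the directions are
  merely transported by \<open>L\<close>. Together with the analogous fact for affine outer maps
  this gives smoothness of the transition maps of affinely modified charts without a higher order
  chain rule.\<close>

lemma iter_dderiv_compose_affine:
  assumes f: "Cinf_on S f" and L: "bounded_linear L" and S': "open S'" "\<And>x. x \<in> S' \<Longrightarrow> b + L x \<in> S"
    and x: "x \<in> S'"
  shows "iter_dderiv vs (\<lambda>x. f (b + L x)) x = iter_dderiv (map L vs) f (b + L x)"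
  using x
proof (induction vs arbitrary: x)
  case (Cons v vs)
  have "frechet_derivative (iter_dderiv vs (\<lambda>x. f (b + L x))) (at x)
      = frechet_derivative (\<lambda>x. iter_dderiv (map L vs) f (b + L x)) (at x)"
    using Cons by (intro frechet_derivative_cong_open[OF S'(1)]) auto
  also have "\<dots> = (\<lambda>v. frechet_derivative (iter_dderiv (map L vs) f) (at (b + L x)) (L v))"
    using f S'(2) Cons.prems L
    by (intro frechet_derivative_at[symmetric] frechet_derivative_at_compose_affine) (auto simp: Cinf_on_def)
  finally show ?case by simp
qed simp

lemma Cinf_on_compose_affine:
  assumes f: "Cinf_on S f" and L: "bounded_linear L" and S': "open S'" "\<And>x. x \<in> S' \<Longrightarrow> b + L x \<in> S"
  shows "Cinf_on S' (\<lambda>x. f (b + L x))"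
proof -
  have "iter_dderiv vs (\<lambda>x. f (b + L x)) differentiable (at x)" if x: "x \<in> S'" for vs x
  proof (rule differentiable_cong_open[OF S'(1) x])
    show "iter_dderiv (map L vs) f (b + L y) = iter_dderiv vs (\<lambda>x. f (b + L x)) y" if "y \<in> S'" for y
      using iter_dderiv_compose_affine[OF f L S' that] by simp
    have "iter_dderiv (map L vs) f differentiable (at (b + L x))"
      using f S'(2)[OF x] by (simp add: Cinf_on_def)
    then show "(\<lambda>y. iter_dderiv (map L vs) f (b + L y)) differentiable (at x)"
      using frechet_derivative_at_compose_affine[OF _ L] unfolding differentiable_def by blast
  qed
  then show ?thesis using S' by (simp add: Cinf_on_def)
qed

lemma iter_dderiv_linear_compose:
  assumes f: "Cinf_on S f" and M: "bounded_linear M" and x: "x \<in> S"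
  shows "iter_dderiv vs (\<lambda>x. M (f x) + b) x = M (iter_dderiv vs f x) + (if vs = [] then b else 0)"
  using x
proof (induction vs arbitrary: x)
  case (Cons v vs)
  let ?c = "if vs = [] then b else 0"
  have S: "open S" using f by (simp add: Cinf_on_def)
  have d: "(iter_dderiv vs f has_derivative frechet_derivative (iter_dderiv vs f) (at x)) (at x)"
    using f Cons.prems by (simp add: Cinf_on_def frechet_derivative_works)
  have "frechet_derivative (iter_dderiv vs (\<lambda>x. M (f x) + b)) (at x)
      = frechet_derivative (\<lambda>x. M (iter_dderiv vs f x) + ?c) (at x)"
    using Cons by (intro frechet_derivative_cong_open[OF S]) auto
  also have "\<dots> = (\<lambda>v. M (frechet_derivative (iter_dderiv vs f) (at x) v))"
    using has_derivative_add_const[OF bounded_linear.has_derivative[OF M d]]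
    by (intro frechet_derivative_at[symmetric]) auto
  finally show ?case by simp
qed simp

lemma Cinf_on_linear_compose:
  assumes f: "Cinf_on S f" and M: "bounded_linear M"
  shows "Cinf_on S (\<lambda>x. M (f x) + b)"
proof -
  have S: "open S" using f by (simp add: Cinf_on_def)
  have "iter_dderiv vs (\<lambda>x. M (f x) + b) differentiable (at x)" if x: "x \<in> S" for vs x
  proof (rule differentiable_cong_open[OF S x])
    show "M (iter_dderiv vs f y) + (if vs = [] then b else 0) = iter_dderiv vs (\<lambda>x. M (f x) + b) y" if "y \<in> S" for y
      using iter_dderiv_linear_compose[OF f M that] by simp
    have "iter_dderiv vs f differentiable (at x)" using f x by (simp add: Cinf_on_def)
    then obtain D where "(iter_dderiv vs f has_derivative D) (at x)" by (auto simp: differentiable_def)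
    then have "((\<lambda>y. M (iter_dderiv vs f y) + (if vs = [] then b else 0)) has_derivative (\<lambda>v. M (D v))) (at x)"
      by (intro has_derivative_add_const bounded_linear.has_derivative[OF M])
    then show "(\<lambda>y. M (iter_dderiv vs f y) + (if vs = [] then b else 0)) differentiable (at x)"
      unfolding differentiable_def by blast
  qed
  then show ?thesis using S by (simp add: Cinf_on_def)
qed

text \<open>Applied to transition maps, this makes the regularity of a curve independent of the
  chart in which it is tested.\<close>

lemma Cinf_on_locally_lipschitz:
  fixes f :: "'a::euclidean_space \<Rightarrow> 'b::real_normed_vector"
  assumes f: "Cinf_on S f" and x: "x \<in> S"
  obtains r K where "r > 0" "ball x r \<subseteq> S" "K-lipschitz_on (ball x r) f"
proof -
  have S: "open S" using f by (simp add: Cinf_on_def)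
  let ?D = "\<lambda>y. frechet_derivative f (at y)"
  have D: "(f has_derivative ?D y) (at y)" if "y \<in> S" for y
    using Cinf_on_imp_differentiable[OF f that] frechet_derivative_works by blast
  \<comment> \<open>Expanding a vector in the basis bounds the operator norm by the sum of the norms
    on basis vectors; the summand 1 is the room for moving the base point.\<close>
  define K where "K = (\<Sum>e\<in>Basis. norm (?D x e) + 1)"
  have "\<forall>\<^sub>F y in nhds x. \<forall>e\<in>Basis. norm (?D y e) < norm (?D x e) + 1"
  proof (intro eventually_ball_finite finite_Basis ballI)
    fix e :: 'a
    \<comment> \<open>Differentiability of the partial derivatives, the next order of smoothness, is
      used for their continuity.\<close>
    have "iter_dderiv [e] f differentiable (at x)" using f x unfolding Cinf_on_def by blast
    then have "isCont (\<lambda>y. ?D y e) x" by (simp add: differentiable_imp_continuous_within)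
    then have "isCont (\<lambda>y. norm (?D y e)) x" by (rule isCont_norm)
    then have "((\<lambda>y. norm (?D y e)) \<longlongrightarrow> norm (?D x e)) (nhds x)"
      using tendsto_at_iff_tendsto_nhds[of "\<lambda>y. norm (?D y e)" x] by (simp add: isCont_def)
    then show "\<forall>\<^sub>F y in nhds x. norm (?D y e) < norm (?D x e) + 1"
      by (rule order_tendstoD) simp
  qed
  moreover have "\<forall>\<^sub>F y in nhds x. y \<in> S" using S x by (rule eventually_nhds_in_open)
  ultimately have "\<forall>\<^sub>F y in nhds x. y \<in> S \<and> (\<forall>e\<in>Basis. norm (?D y e) < norm (?D x e) + 1)"
    by eventually_elim auto
  then obtain r where r: "r > 0" "\<And>y. dist y x < r \<Longrightarrow> y \<in> S \<and> (\<forall>e\<in>Basis. norm (?D y e) < norm (?D x e) + 1)"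
    unfolding eventually_nhds_metric by blast
  have bd: "norm (?D y v) \<le> K * norm v" if y: "y \<in> ball x r" for y v
  proof -
    have yS: "y \<in> S" "\<And>e. e \<in> Basis \<Longrightarrow> norm (?D y e) < norm (?D x e) + 1"
      using r(2)[of y] y by (auto simp: dist_commute)
    interpret bounded_linear "?D y" using D[OF yS(1)] by (rule has_derivative_bounded_linear)
    have "?D y v = ?D y (\<Sum>e\<in>Basis. (v \<bullet> e) *\<^sub>R e)" by (simp add: euclidean_representation)
    also have "\<dots> = (\<Sum>e\<in>Basis. (v \<bullet> e) *\<^sub>R ?D y e)" by (simp add: sum scaleR)
    finally have "norm (?D y v) \<le> (\<Sum>e\<in>Basis. norm ((v \<bullet> e) *\<^sub>R ?D y e))" by (simp only: norm_sum)
    also have "\<dots> \<le> (\<Sum>e\<in>Basis. norm v * (norm (?D x e) + 1))"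
      using yS(2) by (intro sum_mono) (simp add: Basis_le_norm less_imp_le mult_mono)
    also have "\<dots> = K * norm v" by (simp add: K_def sum_distrib_left mult.commute)
    finally show ?thesis .
  qed
  have "K-lipschitz_on (ball x r) f"
  proof (rule lipschitz_onI)
    fix y z assume yz: "y \<in> ball x r" "z \<in> ball x r"
    have "norm (f y - f z) \<le> K * norm (y - z)"
    proof (rule differentiable_bound[where S = "ball x r" and f' = ?D])
      show "(f has_derivative ?D w) (at w within ball x r)" if "w \<in> ball x r" for w
        using D[of w] r(2)[of w] that by (auto simp: dist_commute intro: has_derivative_at_withinI)
      show "onorm (?D w) \<le> K" if "w \<in> ball x r" for w
        using bd[OF that] by (intro onorm_le) (simp add: mult.commute)
    qed (use yz in auto)
    then show "dist (f y) (f z) \<le> K * dist y z" by (simp add: dist_norm)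
  next
    show "0 \<le> K" unfolding K_def by (intro sum_nonneg) (simp add: add_nonneg_nonneg)
  qed
  then show ?thesis using r that[of r K] by (auto simp: dist_commute subset_iff)
qed

section \<open>Lorentzian forms\<close>

lemma bilinear_eta: "bilinear (eta C)"
  unfolding bilinear_def linear_iff eta_def
  by (simp add: algebra_simps inner_add_left inner_add_right)

lemma eta_commute: "eta C u w = eta C w u"
  by (simp add: eta_def inner_commute)

lemmas eta_simps = bilinear_ladd[OF bilinear_eta] bilinear_radd[OF bilinear_eta]
  bilinear_lmul[OF bilinear_eta] bilinear_rmul[OF bilinear_eta]
  bilinear_lneg[OF bilinear_eta] bilinear_rneg[OF bilinear_eta]
  bilinear_lsub[OF bilinear_eta] bilinear_rsub[OF bilinear_eta]

lemma lorentzian_form_bilinear: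
  fixes B :: "real \<times> 'v::euclidean_space \<Rightarrow> real \<times> 'v \<Rightarrow> real"
  assumes "lorentzian_form B"
  shows "bilinear B"
proof -
  obtain L :: "real \<times> 'v \<Rightarrow> real \<times> 'v" where L: "linear L" "bij L" "\<And>u w. B (L u) (L w) = eta 1 u w"
    using assms unfolding lorentzian_form_def by blast
  have iL: "linear (inv L)" using inj_linear_imp_inv_linear[OF L(1) bij_is_inj[OF L(2)]] .
  have B: "B u w = eta 1 (inv L u) (inv L w)" for u w
    using L(3)[of "inv L u" "inv L w"] L(2) by (simp add: bij_is_surj surj_f_inv_f)
  show ?thesis
    unfolding bilinear_def linear_iff B
    by (simp add: linear_add[OF iL] linear_scale[OF iL] eta_simps)
qed

lemma lorentzian_form_commute:
  fixes B :: "real \<times> 'v::euclidean_space \<Rightarrow> real \<times> 'v \<Rightarrow> real"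
  assumes "lorentzian_form B"
  shows "B u w = B w u"
proof -
  obtain L :: "real \<times> 'v \<Rightarrow> real \<times> 'v" where L: "linear L" "bij L" "\<And>u w. B (L u) (L w) = eta 1 u w"
    using assms unfolding lorentzian_form_def by blast
  have B: "B u w = eta 1 (inv L u) (inv L w)" for u w
    using L(3)[of "inv L u" "inv L w"] L(2) by (simp add: bij_is_surj surj_f_inv_f)
  show ?thesis unfolding B by (rule eta_commute)
qed

lemma bilinear_expand_square:
  assumes "bilinear B" "\<And>u w. B u w = B w u"
  shows "B (a *\<^sub>R u + b *\<^sub>R w) (a *\<^sub>R u + b *\<^sub>R w) = a\<^sup>2 * B u u + 2 * a * b * B u w + b\<^sup>2 * B w w"
  using assms(2)[of w u]
  by (simp add: bilinear_ladd[OF assms(1)] bilinear_radd[OF assms(1)] bilinear_lmul[OF assms(1)]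
      bilinear_rmul[OF assms(1)] power2_eq_square algebra_simps)

lemma cone_prec_eta_fst_nonzero:
  assumes "cone_prec B (eta C)" "v \<noteq> 0" "B v v \<le> 0"
  shows "(norm (snd v))\<^sup>2 < C * (fst v)\<^sup>2"
proof -
  have "eta C v v < 0" using assms unfolding cone_prec_def by blast
  then show ?thesis by (simp add: eta_def power2_norm_eq_inner) (simp add: power2_eq_square mult.assoc)
qed

text \<open>Two causal vectors on the same side of the slice \<open>t = 0\<close> have negative product: otherwise
  the combination with vanishing time component would be causal, although its \<open>eta\<close>-square is
  nonnegative.\<close>

lemma cone_prec_eta_directed_iff:
  fixes B :: "real \<times> 'v::euclidean_space \<Rightarrow> real \<times> 'v \<Rightarrow> real"
  assumes B: "lorentzian_form B" and prec: "cone_prec B (eta C)" and v: "v \<noteq> 0" "B v v \<le> 0"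
    and T: "B T T < 0"
  shows "B v T < 0 \<longleftrightarrow> 0 < fst v * fst T" "B v T > 0 \<longleftrightarrow> fst v * fst T < 0"
proof -
  note bil = lorentzian_form_bilinear[OF B]
  have T0: "T \<noteq> 0" using T bilinear_lzero[OF bil] by (metis less_irrefl)
  have fst0: "fst w \<noteq> 0" if "w \<noteq> 0" "B w w \<le> 0" for w
    using cone_prec_eta_fst_nonzero[OF prec that] by (auto simp: not_less)
  have neg: "B w T < 0" if w: "w \<noteq> 0" "B w w \<le> 0" and pos: "0 < fst w * fst T" for w
  proof (rule ccontr)
    assume "\<not> B w T < 0"
    define x where "x = fst T *\<^sub>R w + (- fst w) *\<^sub>R T"
    have "B x x = (fst T)\<^sup>2 * B w w - 2 * (fst w * fst T) * B w T + (fst w)\<^sup>2 * B T T"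
      unfolding x_def bilinear_expand_square[OF bil lorentzian_form_commute[OF B]] by simp
    moreover have "(fst T)\<^sup>2 * B w w \<le> 0" using w(2) by (simp add: mult_nonneg_nonpos)
    moreover have "2 * (fst w * fst T) * B w T \<ge> 0"
      by (rule mult_nonneg_nonneg) (use pos \<open>\<not> B w T < 0\<close> in auto)
    moreover have "(fst w)\<^sup>2 * B T T < 0" using T fst0[OF w] by (simp add: mult_pos_neg)
    ultimately have neg: "B x x < 0" by linarith
    then have "x \<noteq> 0" using bilinear_lzero[OF bil] by (metis less_irrefl)
    then have "fst x \<noteq> 0" using neg fst0 by simp
    then show False by (simp add: x_def)
  qed
  have ne: "fst v * fst T \<noteq> 0" using fst0[OF v] fst0[OF T0] T by simp
  have pos: "B v T > 0" if "fst v * fst T < 0"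
    using neg[of "- v"] v that by (simp add: bilinear_lneg[OF bil] bilinear_rneg[OF bil])
  show "B v T < 0 \<longleftrightarrow> 0 < fst v * fst T" "B v T > 0 \<longleftrightarrow> fst v * fst T < 0"
    using neg[OF v] pos ne by (meson less_asym linorder_neqE_linordered_idom)+
qed

text \<open>\<open>R\<close> is the half-turn about the axis \<open>n = (1, 0) + e\<close>: it fixes
  \<open>n\<close> and is minus the identity on the orthogonal complement, so it is an isometric
  involution exchanging \<open>(1, 0)\<close> and \<open>e\<close>. The sign condition on
  \<open>fst e\<close> keeps \<open>n\<close> timelike, so that division by
  \<open>q = eta 1 n n\<close> is legitimate.\<close>

lemma eta_unit_timelike_isometry:
  fixes e :: "real \<times> 'v::euclidean_space"
  assumes e: "eta 1 e e = - 1" and pos: "fst e \<ge> 0"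
  obtains R :: "real \<times> 'v \<Rightarrow> real \<times> 'v" where "linear R" "bij R" "\<And>u w. eta 1 (R u) (R w) = eta 1 u w" "R (1, 0) = e"
proof -
  define n where "n = (1, 0) + e"
  define q where "q = eta 1 n n"
  have en: "eta 1 (1, 0) n = - 1 - fst e" by (simp add: n_def eta_def)
  have een: "eta 1 e n = - 1 - fst e" using e by (simp add: n_def eta_simps) (simp add: eta_def)
  have q: "q = - 2 - 2 * fst e" using en een unfolding q_def by (subst (1) n_def) (simp add: eta_simps)
  have q0: "q \<noteq> 0" using q pos by simp
  define R where "R w = (2 * eta 1 w n / q) *\<^sub>R n - w" for w
  have lin: "linear R" unfolding linear_iff R_def
    by (simp add: eta_simps add_divide_distrib scaleR_add_left algebra_simps)
  have Rn: "eta 1 (R w) n = eta 1 w n" for w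
    using q0 by (simp add: R_def eta_simps q_def)
  have RR: "R (R w) = w" for w
    by (subst R_def) (simp add: Rn, simp add: R_def)
  have iso: "eta 1 (R u) (R w) = eta 1 u w" for u w
  proof -
    have "eta 1 (R u) (R w) = (2 * eta 1 w n / q) * eta 1 (R u) n - eta 1 (R u) w"
      by (subst (2) R_def) (simp add: eta_simps)
    also have "\<dots> = (2 * eta 1 w n / q) * eta 1 u n - ((2 * eta 1 u n / q) * eta 1 n w - eta 1 u w)"
      unfolding Rn by (simp add: R_def eta_simps)
    also have "\<dots> = eta 1 u w" by (simp add: eta_commute[of 1 n w])
    finally show ?thesis .
  qed
  have "R (1, 0) = n - (1, 0)"
  proof -
    have "2 * eta 1 (1, 0) n / q = 1" using q q0 by (simp add: en)
    then show ?thesis by (simp add: R_def)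
  qed
  then have "R (1, 0) = e" by (simp add: n_def)
  moreover have "bij R" using RR by (metis bijI')
  ultimately show ?thesis using that lin iso by blast
qed

text \<open>An arbitrary frame may be strongly boosted. Composing it with a Lorentz isometry makes
  its time vector a multiple of \<open>(1, 0)\<close>, of factor at most 2. The other frame vectors
  are then \<open>B\<close>-orthogonal to \<open>(1, 0)\<close>, and on that complement
  \<open>B\<close> is comparable with the Euclidean form.\<close>

lemma lorentzian_form_near_eta_frame:
  fixes B :: "real \<times> 'v::euclidean_space \<Rightarrow> real \<times> 'v \<Rightarrow> real"
  assumes B: "lorentzian_form B" and near: "\<And>u w. \<bar>B u w - eta 1 u w\<bar> \<le> norm u * norm w / 10"
  obtains L :: "real \<times> 'v \<Rightarrow> real \<times> 'v" where "linear L" "bij L" "\<And>u w. B (L u) (L w) = eta 1 u w"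
    "\<And>u. norm (L u) \<le> 10 * norm u" "\<And>u. norm u \<le> 20 * norm (L u)"
proof -
  note bil = lorentzian_form_bilinear[OF B]
  let ?e = "(1, 0) :: real \<times> 'v"
  obtain L0 :: "real \<times> 'v \<Rightarrow> real \<times> 'v" where L0: "linear L0" "bij L0" "\<And>u w. B (L0 u) (L0 w) = eta 1 u w"
    using B unfolding lorentzian_form_def by blast
  have Be: "B ?e ?e \<le> - 9/10"
    using near[of ?e ?e] by (simp add: eta_def) argo
  define \<mu> where "\<mu> = 1 / sqrt (- B ?e ?e)"
  have \<mu>2: "\<mu>\<^sup>2 * B ?e ?e = - 1" using Be by (simp add: \<mu>_def power_divide)
  have \<mu>: "0 < \<mu>" using Be by (simp add: \<mu>_def)
  have \<mu>_le: "\<mu> \<le> 2"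
  proof (rule power2_le_imp_le)
    have "\<mu>\<^sup>2 * (9/10) \<le> \<mu>\<^sup>2 * (- B ?e ?e)" using Be by (intro mult_left_mono) auto
    then show "\<mu>\<^sup>2 \<le> 2\<^sup>2" using \<mu>2 by simp
  qed simp
  define e0 where "e0 = inv L0 (\<mu> *\<^sub>R ?e)"
  have Le0: "L0 e0 = \<mu> *\<^sub>R ?e" using L0(2) by (simp add: e0_def bij_is_surj surj_f_inv_f)
  have ee0: "eta 1 e0 e0 = - 1"
  proof -
    have "eta 1 e0 e0 = B (\<mu> *\<^sub>R ?e) (\<mu> *\<^sub>R ?e)" by (simp only: L0(3)[symmetric] Le0)
    also have "\<dots> = \<mu>\<^sup>2 * B ?e ?e"
      by (simp only: bilinear_lmul[OF bil] bilinear_rmul[OF bil]) (simp add: power2_eq_square)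
    finally show ?thesis using \<mu>2 by simp
  qed
  \<comment> \<open>The isometry taking \<open>(1, 0)\<close> to a unit timelike vector was built
    for vectors with nonnegative time component; \<open>- e0\<close> serves as well as
    \<open>e0\<close>.\<close>
  define sg :: real where "sg = (if fst e0 \<ge> 0 then 1 else - 1)"
  have sg: "sg * sg = 1" "sg = 1 \<or> sg = - 1" "\<bar>sg\<bar> = 1" by (auto simp: sg_def)
  have "eta 1 (sg *\<^sub>R e0) (sg *\<^sub>R e0) = - 1" using ee0 sg by (auto simp: eta_simps)
  moreover have "fst (sg *\<^sub>R e0) \<ge> 0" by (simp add: sg_def)
  ultimately obtain R :: "real \<times> 'v \<Rightarrow> real \<times> 'v" where R: "linear R" "bij R" "\<And>u w. eta 1 (R u) (R w) = eta 1 u w" "R ?e = sg *\<^sub>R e0"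
    using eta_unit_timelike_isometry by blast
  define L where "L = L0 \<circ> R"
  have lin: "linear L" unfolding L_def using R(1) L0(1) by (rule linear_compose)
  have bij: "bij L" unfolding L_def using R(2) L0(2) by (rule bij_comp)
  have iso: "B (L u) (L w) = eta 1 u w" for u w by (simp add: L_def L0(3) R(3))
  have Le: "L ?e = (sg * \<mu>) *\<^sub>R ?e" by (simp add: L_def R(4) linear_scale[OF L0(1)] Le0)
  \<comment> \<open>Orthogonality to \<open>(1, 0)\<close> and closeness to \<open>eta 1\<close>
    leave at most a tenth of the norm for the time component, so the value \<open>B z z\<close>,
    which is the squared norm of \<open>x\<close>, dominates a quarter of the squared norm of
    \<open>z\<close>.\<close>
  have space: "norm (L (0, x)) \<le> 2 * norm x" for x
  proof -
    define z where "z = L (0, x)"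
    have nz: "(norm z)\<^sup>2 = (fst z)\<^sup>2 + (norm (snd z))\<^sup>2"
      by (simp add: norm_prod_def)
    have "B z (L ?e) = 0" unfolding z_def iso by (simp add: eta_def)
    then have "(sg * \<mu>) * B z ?e = 0" unfolding Le by (simp only: bilinear_rmul[OF bil] real_scaleR_def)
    then have "B z ?e = 0" using \<mu> sg by auto
    moreover have "eta 1 z ?e = - fst z" by (simp add: eta_def)
    ultimately have "\<bar>fst z\<bar> \<le> norm z / 10" using near[of z ?e] by simp
    then have "\<bar>fst z\<bar>\<^sup>2 \<le> (norm z / 10)\<^sup>2" by (intro power_mono) auto
    then have 1: "(fst z)\<^sup>2 \<le> (norm z)\<^sup>2 / 100" by (simp add: power_divide)
    have "B z z = (norm x)\<^sup>2" unfolding z_def iso by (simp add: eta_def power2_norm_eq_inner)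
    moreover have "eta 1 z z = (norm (snd z))\<^sup>2 - (fst z)\<^sup>2"
      by (simp add: eta_def power2_norm_eq_inner) (simp add: power2_eq_square)
    ultimately have "(norm (snd z))\<^sup>2 - (fst z)\<^sup>2 - (norm z)\<^sup>2 / 10 \<le> (norm x)\<^sup>2"
      using near[of z z] by (simp add: power2_eq_square) argo
    then have "(norm z)\<^sup>2 \<le> 4 * (norm x)\<^sup>2" using 1 nz zero_le_power2[of "norm (snd z)"] by argo
    then have "(norm z)\<^sup>2 \<le> (2 * norm x)\<^sup>2" by (simp add: power_mult_distrib)
    then show ?thesis unfolding z_def by (rule power2_le_imp_le) simp
  qed
  have up: "norm (L u) \<le> 10 * norm u" for u
  proof -
    have "L u = L (fst u *\<^sub>R ?e + (0, snd u))" by (simp add: prod_eq_iff)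
    also have "\<dots> = fst u *\<^sub>R L ?e + L (0, snd u)" by (simp only: linear_add[OF lin] linear_scale[OF lin])
    finally have "norm (L u) \<le> norm (fst u *\<^sub>R L ?e) + norm (L (0, snd u))"
      by (metis norm_triangle_ineq)
    also have "norm (fst u *\<^sub>R L ?e) = \<bar>fst u\<bar> * \<mu>" unfolding Le using sg \<mu> by (simp add: abs_mult)
    also have "\<bar>fst u\<bar> * \<mu> \<le> norm u * 2"
      using \<mu> \<mu>_le norm_fst_le[of "fst u" "snd u"] by (intro mult_mono) auto
    also have "norm (L (0, snd u)) \<le> 2 * norm u" using space[of "snd u"] norm_snd_le[of "snd u" "fst u"] by simp
    finally show ?thesis using norm_ge_zero[of u] by linarith
  qed
  have down: "norm u \<le> 20 * norm (L u)" for u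
  proof (cases "u = 0")
    case False
    \<comment> \<open>For the time-reflected vector \<open>w\<close>, the number
      \<open>eta 1 u w\<close> is the squared Euclidean norm of \<open>u\<close>. This turns the
      upper bound on \<open>L\<close> into the lower one.\<close>
    define w where "w = (- fst u, snd u)"
    have nw: "norm w = norm u" by (simp add: w_def norm_prod_def)
    have "(norm u)\<^sup>2 = eta 1 u w"
      by (simp add: w_def eta_def norm_prod_def power2_norm_eq_inner[symmetric]) (simp add: power2_eq_square)
    also have "\<dots> = B (L u) (L w)" by (simp add: iso)
    also have "\<dots> \<le> 2 * (norm (L u) * norm (L w))"
    proof -
      have "\<bar>eta 1 a b\<bar> \<le> norm a * norm b" for a b :: "real \<times> 'v"
      proof -
        have "eta 1 a b = (- fst a, snd a) \<bullet> b" by (simp add: eta_def inner_prod_def)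
        moreover have "norm (- fst a, snd a) = norm a" by (simp add: norm_prod_def)
        ultimately show ?thesis using Cauchy_Schwarz_ineq2[of "(- fst a, snd a)" b] by simp
      qed
      from this[of "L u" "L w"] show ?thesis using near[of "L u" "L w"]
        mult_nonneg_nonneg[OF norm_ge_zero[of "L u"] norm_ge_zero[of "L w"]] by linarith
    qed
    also have "\<dots> \<le> 2 * (norm (L u) * (10 * norm u))"
      using up[of w] nw by (intro mult_left_mono) auto
    finally have "norm u * norm u \<le> (20 * norm (L u)) * norm u" by (simp add: power2_eq_square)
    then show ?thesis using False by (simp add: mult_le_cancel_right)
  qed simp
  show ?thesis using that[OF lin bij iso up down] .
qed

text \<open>Write t and x for the components of \<open>u\<close>. If |x|^2 is at most t^2 / 2, then
  \<open>B u u\<close> is at most - t^2 / 8; conversely \<open>B u u \<le> 0\<close> forces |x|^2 to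
  be at most 5/3 t^2. The tolerance 1/4 thus leaves room on both sides.\<close>

lemma cone_prec_near_eta:
  fixes B :: "real \<times> 'v::euclidean_space \<Rightarrow> real \<times> 'v \<Rightarrow> real"
  assumes near: "\<And>u. \<bar>B u u - eta 1 u u\<bar> \<le> (norm u)\<^sup>2 / 4"
  shows "cone_prec (eta (1 / 2)) B" "cone_prec B (eta 2)"
proof -
  have e: "eta C u u = (norm (snd u))\<^sup>2 - C * (fst u)\<^sup>2" for C and u :: "real \<times> 'v"
    by (simp add: eta_def power2_norm_eq_inner) (simp add: power2_eq_square)
  have n: "(norm u)\<^sup>2 = (fst u)\<^sup>2 + (norm (snd u))\<^sup>2" for u :: "real \<times> 'v"
    by (simp add: norm_prod_def)
  have z: "u = 0" if "(fst u)\<^sup>2 \<le> 0" "(norm (snd u))\<^sup>2 \<le> 0" for u :: "real \<times> 'v"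
    using that by (simp add: prod_eq_iff)
  have nonneg: "0 \<le> (fst u)\<^sup>2" "0 \<le> (norm (snd u))\<^sup>2" for u :: "real \<times> 'v" by simp_all
  show "cone_prec (eta (1 / 2)) B" unfolding cone_prec_def
  proof (intro allI impI, elim conjE)
    fix u :: "real \<times> 'v" assume u: "u \<noteq> 0" "eta (1 / 2) u u \<le> 0"
    have 1: "(norm (snd u))\<^sup>2 \<le> (fst u)\<^sup>2 / 2" using u(2) unfolding e by simp
    have 2: "0 < (fst u)\<^sup>2" using z[of u] u(1) 1 nonneg[of u] by argo
    have 3: "B u u \<le> (norm (snd u))\<^sup>2 - (fst u)\<^sup>2 + ((fst u)\<^sup>2 + (norm (snd u))\<^sup>2) / 4"
      using near[of u] unfolding e n by argo
    show "B u u < 0" using 1 2 3 by argo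
  qed
  show "cone_prec B (eta 2)" unfolding cone_prec_def
  proof (intro allI impI, elim conjE)
    fix u :: "real \<times> 'v" assume u: "u \<noteq> 0" "B u u \<le> 0"
    have 1: "(norm (snd u))\<^sup>2 - (fst u)\<^sup>2 \<le> ((fst u)\<^sup>2 + (norm (snd u))\<^sup>2) / 4"
      using near[of u] u(2) unfolding e n by argo
    have "\<not> ((fst u)\<^sup>2 \<le> 0 \<and> (norm (snd u))\<^sup>2 \<le> 0)" using z[of u] u(1) by blast
    then have "0 < (fst u)\<^sup>2" using 1 nonneg[of u] by argo
    then show "eta 2 u u < 0" using 1 unfolding e by argo
  qed
qed

section \<open>Charts and velocities\<close>

locale spacetime =
  fixes A :: "('m::{t2_space, second_countable_topology}, 'v::euclidean_space) chart set"
    and G :: "('m, 'v) chart \<Rightarrow> real \<times> 'v \<Rightarrow> real \<times> 'v \<Rightarrow> real \<times> 'v \<Rightarrow> real"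
    and T :: "('m, 'v) chart \<Rightarrow> real \<times> 'v \<Rightarrow> real \<times> 'v"
  assumes spacetime: "continuous_spacetime A G T"
begin

lemma atlas: "smooth_atlas A" and metric: "continuous_lorentzian_metric A G"
  and orientation: "time_orientation A G T"
  using spacetime by (auto simp: continuous_spacetime_def)

abbreviation coord_inv :: "('m, 'v) chart \<Rightarrow> real \<times> 'v \<Rightarrow> 'm" where
  "coord_inv c \<equiv> inv_into (snd c) (fst c)"

lemma obtain_chart: obtains c where "c \<in> A" "m \<in> snd c"
  using atlas unfolding smooth_atlas_def by blast

lemma chart: assumes "c \<in> A"
  shows chart_open: "open (snd c)" and chart_image_open: "open (fst c ` snd c)"
    and chart_inj: "inj_on (fst c) (snd c)" and chart_continuous: "continuous_on (snd c) (fst c)"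
    and coord_inv_continuous: "continuous_on (fst c ` snd c) (coord_inv c)"
proof -
  have "is_chart c" using assms atlas by (simp add: smooth_atlas_def)
  then obtain g where o: "open (snd c)" "open (fst c ` snd c)" and g: "homeomorphism (snd c) (fst c ` snd c) (fst c) g"
    unfolding is_chart_def by blast
  show "open (snd c)" "open (fst c ` snd c)" by fact+
  have gf: "\<And>x. x \<in> snd c \<Longrightarrow> g (fst c x) = x" using g by (simp add: homeomorphism_def)
  show inj: "inj_on (fst c) (snd c)" using gf by (metis inj_onI)
  show "continuous_on (snd c) (fst c)" using g by (simp add: homeomorphism_def)
  have "coord_inv c y = g y" if "y \<in> fst c ` snd c" for y
    using that inj gf by (auto simp: inv_into_f_f)
  then show "continuous_on (fst c ` snd c) (coord_inv c)"
    using g by (simp add: homeomorphism_def cong: continuous_on_cong)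
qed

lemma coord_inv_coord [simp]: "c \<in> A \<Longrightarrow> m \<in> snd c \<Longrightarrow> coord_inv c (fst c m) = m"
  by (simp add: chart_inj inv_into_f_f)

lemma coord_coord_inv [simp]: "y \<in> fst c ` snd c \<Longrightarrow> fst c (coord_inv c y) = y"
  by (rule f_inv_into_f)

lemma coord_inv_mem: "y \<in> fst c ` snd c \<Longrightarrow> coord_inv c y \<in> snd c"
  by (rule inv_into_into)

lemma coord_image_Int: "c \<in> A \<Longrightarrow> fst c ` (snd c \<inter> W) = {y \<in> fst c ` snd c. coord_inv c y \<in> W}"
  by auto

lemma open_coord_image: "c \<in> A \<Longrightarrow> open W \<Longrightarrow> open (fst c ` (snd c \<inter> W))"
  using continuous_open_preimage[OF coord_inv_continuous chart_image_open, of c W]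
  unfolding coord_image_Int by (simp add: vimage_def Int_def)

lemma open_coord_preimage: "c \<in> A \<Longrightarrow> open W \<Longrightarrow> open {m \<in> snd c. fst c m \<in> W}"
  using continuous_open_preimage[OF chart_continuous chart_open, of c W]
  by (simp add: vimage_def Int_def)

lemma transition_eq: "c \<in> A \<Longrightarrow> m \<in> snd c \<Longrightarrow> transition c d (fst c m) = fst d m"
  by (simp add: transition_def)

lemma transition_Cinf: "c \<in> A \<Longrightarrow> d \<in> A \<Longrightarrow> Cinf_on (fst c ` (snd c \<inter> snd d)) (transition c d)"
  using atlas by (simp add: smooth_atlas_def smoothly_compatible_def)

definition transition_deriv :: "('m, 'v) chart \<Rightarrow> ('m, 'v) chart \<Rightarrow> 'm \<Rightarrow> real \<times> 'v \<Rightarrow> real \<times> 'v" where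
  "transition_deriv c d m = frechet_derivative (transition c d) (at (fst c m))"

lemma transition_has_derivative:
  assumes "c \<in> A" "d \<in> A" "m \<in> snd c" "m \<in> snd d"
  shows "(transition c d has_derivative transition_deriv c d m) (at (fst c m))"
  unfolding transition_deriv_def
  using Cinf_on_imp_differentiable[OF transition_Cinf[OF assms(1,2)]] assms(3,4)
  by (simp add: frechet_derivative_works)

lemma metric_lorentzian: "c \<in> A \<Longrightarrow> y \<in> fst c ` snd c \<Longrightarrow> lorentzian_form (G c y)"
  using metric unfolding continuous_lorentzian_metric_def by blast

lemma metric_continuous: "c \<in> A \<Longrightarrow> continuous_on (fst c ` snd c) (\<lambda>y. G c y u w)"
  using metric unfolding continuous_lorentzian_metric_def by blast

lemma metric_transform:
  "c \<in> A \<Longrightarrow> d \<in> A \<Longrightarrow> m \<in> snd c \<Longrightarrow> m \<in> snd d \<Longrightarrow>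
    G c (fst c m) u w = G d (fst d m) (transition_deriv c d m u) (transition_deriv c d m w)"
  using metric unfolding continuous_lorentzian_metric_def transition_deriv_def by blast

lemma metric_bilinear: "c \<in> A \<Longrightarrow> y \<in> fst c ` snd c \<Longrightarrow> bilinear (G c y)"
  by (intro lorentzian_form_bilinear metric_lorentzian)

lemma orientation_continuous: "c \<in> A \<Longrightarrow> continuous_on (fst c ` snd c) (T c)"
  using orientation unfolding time_orientation_def by blast

lemma orientation_timelike: "c \<in> A \<Longrightarrow> y \<in> fst c ` snd c \<Longrightarrow> G c y (T c y) (T c y) < 0"
  using orientation unfolding time_orientation_def by blast

lemma orientation_transform:
  "c \<in> A \<Longrightarrow> d \<in> A \<Longrightarrow> m \<in> snd c \<Longrightarrow> m \<in> snd d \<Longrightarrow> T d (fst d m) = transition_deriv c d m (T c (fst c m))"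
  using orientation unfolding time_orientation_def transition_deriv_def by blast

text \<open>The metric is assumed continuous only for fixed vectors; expanding in a basis upgrades
  this to joint continuity in base point and vectors.\<close>

lemma continuous_on_metric:
  assumes c: "c \<in> A" and f: "continuous_on S f" "f ` S \<subseteq> fst c ` snd c"
    and u: "continuous_on S u" and w: "continuous_on S w"
  shows "continuous_on S (\<lambda>x. G c (f x) (u x) (w x))"
proof -
  have "continuous_on S (\<lambda>x. \<Sum>(i,j)\<in>Basis \<times> Basis. (u x \<bullet> i) * ((w x \<bullet> j) * G c (f x) i j))"
    unfolding case_prod_unfold
    by (intro continuous_intros u w continuous_on_compose2[OF metric_continuous[OF c] f])
  moreover have "G c (f x) (u x) (w x) = (\<Sum>(i,j)\<in>Basis \<times> Basis. (u x \<bullet> i) * ((w x \<bullet> j) * G c (f x) i j))"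
    if x: "x \<in> S" for x
  proof -
    have bil: "bilinear (G c (f x))" using f(2) x by (intro metric_bilinear[OF c]) auto
    have "G c (f x) (u x) (w x) = G c (f x) (\<Sum>i\<in>Basis. (u x \<bullet> i) *\<^sub>R i) (\<Sum>j\<in>Basis. (w x \<bullet> j) *\<^sub>R j)"
      by (simp only: euclidean_representation)
    also have "\<dots> = (\<Sum>(i,j)\<in>Basis \<times> Basis. G c (f x) ((u x \<bullet> i) *\<^sub>R i) ((w x \<bullet> j) *\<^sub>R j))"
      by (rule bilinear_sum[OF bil])
    finally show ?thesis by (simp add: bilinear_lmul[OF bil] bilinear_rmul[OF bil] mult.left_commute)
  qed
  ultimately show ?thesis by (simp cong: continuous_on_cong)
qed

text \<open>Being timelike and directed is given by two strict inequalities between jointly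
  continuous functions. A common radius for base points and vectors keeps the later cone statements
  short.\<close>

lemma open_timelike:
  assumes c: "c \<in> A" and y0: "y0 \<in> fst c ` snd c" and tl: "timelike_vec G T fut c y0 w0"
  obtains \<rho> where "\<rho> > 0" "\<And>y. y \<in> ball y0 \<rho> \<Longrightarrow> y \<in> fst c ` snd c"
    "\<And>y w. y \<in> ball y0 \<rho> \<Longrightarrow> w \<in> ball w0 \<rho> \<Longrightarrow> timelike_vec G T fut c y w"
proof -
  let ?S = "fst c ` snd c \<times> (UNIV :: (real \<times> 'v) set)"
  have S: "open ?S" using chart_image_open[OF c] by (intro open_Times) auto
  have cT: "continuous_on ?S (\<lambda>x. T c (fst x))"
    by (rule continuous_on_compose2[OF orientation_continuous[OF c]]) (auto intro!: continuous_intros)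
  have c1: "continuous_on ?S (\<lambda>x. G c (fst x) (snd x) (snd x))"
    by (rule continuous_on_metric[OF c]) (auto intro!: continuous_intros)
  have c2: "continuous_on ?S (\<lambda>x. G c (fst x) (snd x) (T c (fst x)))"
    by (rule continuous_on_metric[OF c _ _ _ cT]) (auto intro!: continuous_intros)
  let ?R = "if fut then {..<0::real} else {0<..}"
  have R: "open ?R" by simp
  define O1 where "O1 = ?S \<inter> (\<lambda>x. G c (fst x) (snd x) (snd x)) -` {..<0}"
  define O2 where "O2 = ?S \<inter> (\<lambda>x. G c (fst x) (snd x) (T c (fst x))) -` ?R"
  have "open (O1 \<inter> O2)"
    unfolding O1_def O2_def
    by (intro open_Int continuous_open_preimage[OF c1 S] continuous_open_preimage[OF c2 S] R) simp
  moreover have "(y0, w0) \<in> O1 \<inter> O2"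
    using y0 tl by (auto simp: O1_def O2_def timelike_vec_def directed_def split: if_splits)
  ultimately obtain U W where UW: "open U" "open W" "y0 \<in> U" "w0 \<in> W" "U \<times> W \<subseteq> O1 \<inter> O2"
    using open_prod_elim[of "O1 \<inter> O2" "(y0, w0)"] by (metis mem_Times_iff fst_conv snd_conv)
  obtain r1 r2 where r: "r1 > 0" "ball y0 r1 \<subseteq> U" "r2 > 0" "ball w0 r2 \<subseteq> W"
    using UW by (meson open_contains_ball)
  have in12: "(y, w) \<in> O1 \<inter> O2" if "y \<in> ball y0 (min r1 r2)" "w \<in> ball w0 (min r1 r2)" for y w
  proof -
    have "y \<in> ball y0 r1" "w \<in> ball w0 r2" using that by auto
    then show ?thesis using r UW(5) by blast
  qed
  show ?thesis
  proof (rule that[of "min r1 r2"])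
    show "0 < min r1 r2" using r by simp
    show "y \<in> fst c ` snd c" if "y \<in> ball y0 (min r1 r2)" for y
      using in12[OF that, of w0] r by (auto simp: O1_def)
    show "timelike_vec G T fut c y w" if "y \<in> ball y0 (min r1 r2)" "w \<in> ball w0 (min r1 r2)" for y w
      using in12[OF that] by (auto simp: O1_def O2_def timelike_vec_def directed_def split: if_splits)
  qed
qed

text \<open>The two-sided counterpart of \<open>velocity_sat\<close>, free of the parameter
  interval. The two differ only at the end points, which form a null set, and this version is local
  and easy to glue.\<close>

definition vel :: "(('m, 'v) chart \<Rightarrow> real \<times> 'v \<Rightarrow> real \<times> 'v \<Rightarrow> bool) \<Rightarrow> (real \<Rightarrow> 'm) \<Rightarrow> real \<Rightarrow> bool" where
  "vel P \<gamma> t \<longleftrightarrow> (\<exists>c\<in>A. \<gamma> t \<in> snd c \<and>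
     (\<exists>v. ((fst c \<circ> \<gamma>) has_vector_derivative v) (at t) \<and> P c (fst c (\<gamma> t)) v))"

lemma velocity_sat_interior:
  "a < t \<Longrightarrow> t < b \<Longrightarrow> velocity_sat A P \<gamma> a b t \<longleftrightarrow> vel P \<gamma> t"
  unfolding velocity_sat_def vel_def by (simp add: at_within_Icc_at)

lemma vel_cong:
  assumes "open S" "t \<in> S" "\<And>s. s \<in> S \<Longrightarrow> \<gamma> s = \<gamma>' s" "vel P \<gamma> t"
  shows "vel P \<gamma>' t"
proof -
  have "((fst c \<circ> \<gamma>') has_vector_derivative v) (at t)" if "((fst c \<circ> \<gamma>) has_vector_derivative v) (at t)" for c v
    by (rule has_vector_derivative_transform_within_open[OF that assms(1,2)]) (simp add: assms(3))
  then show ?thesis using assms unfolding vel_def by metis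
qed

lemma vel_affine:
  assumes "vel P \<gamma> (e * t + k)" "\<And>c y v. c \<in> A \<Longrightarrow> y \<in> fst c ` snd c \<Longrightarrow> P c y v \<Longrightarrow> Q c y (e *\<^sub>R v)"
  shows "vel Q (\<lambda>t. \<gamma> (e * t + k)) t"
proof -
  have "((fst c \<circ> (\<lambda>t. \<gamma> (e * t + k))) has_vector_derivative e *\<^sub>R v) (at t)"
    if v: "((fst c \<circ> \<gamma>) has_vector_derivative v) (at (e * t + k))" for c v
  proof -
    have "((\<lambda>t. e * t + k) has_vector_derivative e) (at t)"
      by (auto intro!: derivative_eq_intros)
    from vector_diff_chain_at[OF this v] show ?thesis by (simp add: comp_def)
  qed
  then show ?thesis using assms unfolding vel_def by blast
qed

text \<open>A velocity condition is only required in some chart around the point; for tensorial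
  conditions it can be moved to any prescribed chart.\<close>

definition tensorial :: "(('m, 'v) chart \<Rightarrow> real \<times> 'v \<Rightarrow> real \<times> 'v \<Rightarrow> bool) \<Rightarrow> bool" where
  "tensorial P \<longleftrightarrow> (\<forall>c\<in>A. \<forall>d\<in>A. \<forall>m\<in>snd c \<inter> snd d. \<forall>v.
     P c (fst c m) v \<longrightarrow> P d (fst d m) (transition_deriv c d m v))"

lemma tensorial_causal: "tensorial (causal_vec G T fut)"
  unfolding tensorial_def
proof (intro ballI allI impI)
  fix c d m v assume c: "c \<in> A" and d: "d \<in> A" and m: "m \<in> snd c \<inter> snd d" and v: "causal_vec G T fut c (fst c m) v"
  let ?D = "transition_deriv c d m"
  have m': "m \<in> snd c" "m \<in> snd d" using m by auto
  have tr: "G c (fst c m) u w = G d (fst d m) (?D u) (?D w)" for u w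
    by (rule metric_transform[OF c d m'])
  have T: "T d (fst d m) = ?D (T c (fst c m))" by (rule orientation_transform[OF c d m'])
  \<comment> \<open>Nonvanishing of the transported vector is read off from its product with
    \<open>T\<close>, which is invariant, rather than from invertibility of the derivative.\<close>
  have "G c (fst c m) v (T c (fst c m)) \<noteq> 0" using v by (auto simp: causal_vec_def directed_def split: if_splits)
  then have "G d (fst d m) (?D v) (?D (T c (fst c m))) \<noteq> 0" by (simp add: tr)
  then have "?D v \<noteq> 0"
    using bilinear_lzero[OF metric_bilinear[OF d imageI[OF m'(2)]]] by metis
  then show "causal_vec G T fut d (fst d m) (?D v)"
    using v by (simp add: causal_vec_def directed_def tr T split: if_splits)
qed

lemma vel_in_chart:
  assumes P: "tensorial P" and v: "vel P \<gamma> t" and cont: "isCont \<gamma> t" and c: "c \<in> A" and t: "\<gamma> t \<in> snd c"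
  obtains v where "((fst c \<circ> \<gamma>) has_vector_derivative v) (at t)" "P c (fst c (\<gamma> t)) v"
proof -
  obtain d v where d: "d \<in> A" "\<gamma> t \<in> snd d" and v: "((fst d \<circ> \<gamma>) has_vector_derivative v) (at t)" "P d (fst d (\<gamma> t)) v"
    using v unfolding vel_def by blast
  let ?D = "transition_deriv d c (\<gamma> t)"
  have "open (snd c \<inter> snd d)" using chart_open c d by blast
  then have "\<forall>\<^sub>F s in at t. \<gamma> s \<in> snd c \<inter> snd d"
    using cont t d by (intro topological_tendstoD[of \<gamma> "\<gamma> t"]) (auto simp: isCont_def)
  then obtain e where e: "e > 0" "\<And>s. s \<noteq> t \<Longrightarrow> dist s t < e \<Longrightarrow> \<gamma> s \<in> snd c \<inter> snd d"
    unfolding eventually_at by auto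
  have "(transition d c has_derivative ?D) (at ((fst d \<circ> \<gamma>) t) within range (fst d \<circ> \<gamma>))"
    using transition_has_derivative[OF d(1) c d(2) t] by (simp add: has_derivative_at_withinI)
  then have "((transition d c \<circ> (fst d \<circ> \<gamma>)) has_vector_derivative ?D v) (at t)"
    using vector_derivative_diff_chain_within[OF v(1)] by blast
  then have "((fst c \<circ> \<gamma>) has_vector_derivative ?D v) (at t)"
  proof (rule has_vector_derivative_transform_within_open)
    show "open (ball t e)" "t \<in> ball t e" using e by auto
    fix s assume s: "s \<in> ball t e"
    have "\<gamma> s \<in> snd c \<inter> snd d" using e(2)[of s] s t d(2) by (cases "s = t") (auto simp: dist_commute)
    then show "(transition d c \<circ> (fst d \<circ> \<gamma>)) s = (fst c \<circ> \<gamma>) s" using d(1) by (simp add: transition_eq)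
  qed
  moreover have "P c (fst c (\<gamma> t)) (?D v)" using P c d t v(2) unfolding tensorial_def by blast
  ultimately show ?thesis by (rule that)
qed

definition ae_vel :: "(('m, 'v) chart \<Rightarrow> real \<times> 'v \<Rightarrow> real \<times> 'v \<Rightarrow> bool) \<Rightarrow> (real \<Rightarrow> 'm) \<Rightarrow> real \<Rightarrow> real \<Rightarrow> bool" where
  "ae_vel P \<gamma> a b \<longleftrightarrow> negligible {t. a < t \<and> t < b \<and> \<not> vel P \<gamma> t}"

lemma AE_velocity_sat_iff: "(AE t in lebesgue. t \<in> {a..b} \<longrightarrow> velocity_sat A P \<gamma> a b t) \<longleftrightarrow> ae_vel P \<gamma> a b"
proof
  assume "AE t in lebesgue. t \<in> {a..b} \<longrightarrow> velocity_sat A P \<gamma> a b t"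
  then obtain N where "negligible N" "{t. \<not> (t \<in> {a..b} \<longrightarrow> velocity_sat A P \<gamma> a b t)} \<subseteq> N"
    unfolding eventually_ae_filter negligible_iff_null_sets by auto
  then show "ae_vel P \<gamma> a b"
    unfolding ae_vel_def by (elim negligible_subset) (auto simp: velocity_sat_interior)
next
  assume "ae_vel P \<gamma> a b"
  then have "negligible ({t. a < t \<and> t < b \<and> \<not> vel P \<gamma> t} \<union> {a, b})"
    by (simp add: ae_vel_def)
  moreover have "{t. \<not> (t \<in> {a..b} \<longrightarrow> velocity_sat A P \<gamma> a b t)} \<subseteq> {t. a < t \<and> t < b \<and> \<not> vel P \<gamma> t} \<union> {a, b}"
    by (auto simp: velocity_sat_interior)
  ultimately show "AE t in lebesgue. t \<in> {a..b} \<longrightarrow> velocity_sat A P \<gamma> a b t"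
    unfolding eventually_ae_filter negligible_iff_null_sets by auto
qed

lemma timelike_curve_iff: "timelike_curve A G T fut \<gamma> a b \<longleftrightarrow> ae_vel (timelike_vec G T fut) \<gamma> a b"
  and causal_curve_iff: "causal_curve A G T fut \<gamma> a b \<longleftrightarrow> ae_vel (causal_vec G T fut) \<gamma> a b"
  unfolding timelike_curve_def causal_curve_def by (rule AE_velocity_sat_iff)+

lemma timelike_imp_causal:
  assumes "c \<in> A" "y \<in> fst c ` snd c" "timelike_vec G T fut c y v"
  shows "causal_vec G T fut c y v"
proof -
  have "v \<noteq> 0"
    using assms(3) bilinear_lzero[OF metric_bilinear[OF assms(1,2)], of v] by (auto simp: timelike_vec_def)
  then show ?thesis using assms(3) by (simp add: timelike_vec_def causal_vec_def)
qed

lemma vel_timelike_imp_causal: "vel (timelike_vec G T fut) \<gamma> t \<Longrightarrow> vel (causal_vec G T fut) \<gamma> t"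
  unfolding vel_def using timelike_imp_causal by blast

lemma ae_vel_subinterval: "ae_vel P \<gamma> a b \<Longrightarrow> a \<le> a' \<Longrightarrow> b' \<le> b \<Longrightarrow> ae_vel P \<gamma> a' b'"
  unfolding ae_vel_def by (elim negligible_subset) auto

lemma ae_vel_mono: "ae_vel P \<gamma> a b \<Longrightarrow> (\<And>t. vel P \<gamma> t \<Longrightarrow> vel Q \<gamma> t) \<Longrightarrow> ae_vel Q \<gamma> a b"
  unfolding ae_vel_def by (elim negligible_subset) auto

lemma ae_vel_affine:
  assumes "ae_vel P \<gamma> a b" "e = 1 \<or> e = - 1" "\<And>c y v. c \<in> A \<Longrightarrow> y \<in> fst c ` snd c \<Longrightarrow> P c y v \<Longrightarrow> Q c y (e *\<^sub>R v)"
    and ab: "\<And>t. a' < t \<Longrightarrow> t < b' \<Longrightarrow> a < e * t + k \<and> e * t + k < b"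
  shows "ae_vel Q (\<lambda>t. \<gamma> (e * t + k)) a' b'"
proof -
  let ?N = "{t. a < t \<and> t < b \<and> \<not> vel P \<gamma> t}"
  have ee: "e * e = 1" using assms(2) by auto
  have "negligible ((\<lambda>s. e * (s - k)) ` ?N)"
    using assms(1) unfolding ae_vel_def
    by (intro negligible_differentiable_image_negligible) (auto intro!: derivative_intros simp: differentiable_on_def)
  moreover have "{t. a' < t \<and> t < b' \<and> \<not> vel Q (\<lambda>t. \<gamma> (e * t + k)) t} \<subseteq> (\<lambda>s. e * (s - k)) ` ?N"
  proof clarify
    fix t assume t: "a' < t" "t < b'" "\<not> vel Q (\<lambda>t. \<gamma> (e * t + k)) t"
    then have "\<not> vel P \<gamma> (e * t + k)" using vel_affine[of P \<gamma> e t k Q] assms(3) by blast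
    then have "e * t + k \<in> ?N" using ab t by auto
    moreover have "t = e * ((e * t + k) - k)" using ee by (simp add: mult.assoc[symmetric])
    ultimately show "t \<in> (\<lambda>s. e * (s - k)) ` ?N" by blast
  qed
  ultimately show ?thesis unfolding ae_vel_def by (rule negligible_subset)
qed

section \<open>Curves\<close>

text \<open>Absolutely continuous and locally Lipschitz curves are treated together: \<open>R S f\<close> expresses the
  regularity of a coordinate curve \<open>f\<close> on a parameter set \<open>S\<close>.\<close>

definition reg_curve :: "(real set \<Rightarrow> (real \<Rightarrow> real \<times> 'v) \<Rightarrow> bool) \<Rightarrow> (real \<Rightarrow> 'm) \<Rightarrow> real \<Rightarrow> real \<Rightarrow> bool" where
  "reg_curve R \<gamma> a b \<longleftrightarrow> a < b \<and> continuous_on {a..b} \<gamma> \<and>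
     (\<forall>t\<in>{a..b}. \<exists>c\<in>A. \<exists>\<delta>>0. \<gamma> ` ({a..b} \<inter> cball t \<delta>) \<subseteq> snd c \<and> R ({a..b} \<inter> cball t \<delta>) (fst c \<circ> \<gamma>))"

definition lipschitz_reg :: "real set \<Rightarrow> (real \<Rightarrow> real \<times> 'v) \<Rightarrow> bool" where
  "lipschitz_reg S f \<longleftrightarrow> (\<exists>K. K-lipschitz_on S f)"

lemma ac_curve_iff: "ac_curve A \<gamma> a b \<longleftrightarrow> reg_curve abs_cont_on \<gamma> a b"
  unfolding ac_curve_def reg_curve_def ..

lemma loclip_curve_iff: "loclip_curve A \<gamma> a b \<longleftrightarrow> reg_curve lipschitz_reg \<gamma> a b"
  unfolding loclip_curve_def reg_curve_def lipschitz_reg_def ..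

lemma reg_curveD:
  assumes "reg_curve R \<gamma> a b" "t \<in> {a..b}"
  obtains c \<delta> where "c \<in> A" "\<delta> > 0" "\<gamma> ` ({a..b} \<inter> cball t \<delta>) \<subseteq> snd c" "R ({a..b} \<inter> cball t \<delta>) (fst c \<circ> \<gamma>)"
proof -
  have "\<exists>c\<in>A. \<exists>\<delta>>0. \<gamma> ` ({a..b} \<inter> cball t \<delta>) \<subseteq> snd c \<and> R ({a..b} \<inter> cball t \<delta>) (fst c \<circ> \<gamma>)"
    using assms(1)[unfolded reg_curve_def, THEN conjunct2, THEN conjunct2] assms(2) by (rule bspec)
  then show ?thesis by (elim bexE exE conjE) (rule that)
qed

text \<open>The properties needed for localising a curve and for changing charts: restriction,
  composition with a Lipschitz map, and dependence on the values on \<open>S\<close> alone.\<close>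

definition admissible :: "(real set \<Rightarrow> (real \<Rightarrow> real \<times> 'v) \<Rightarrow> bool) \<Rightarrow> bool" where
  "admissible R \<longleftrightarrow> (\<forall>S S' f. R S f \<longrightarrow> S' \<subseteq> S \<longrightarrow> R S' f) \<and>
     (\<forall>S f g K. R S f \<longrightarrow> K-lipschitz_on (f ` S) g \<longrightarrow> R S (g \<circ> f)) \<and>
     (\<forall>S f g. R S f \<longrightarrow> (\<forall>x\<in>S. f x = g x) \<longrightarrow> R S g)"

lemma admissibleD:
  assumes "admissible R"
  shows admissible_subset: "R S f \<Longrightarrow> S' \<subseteq> S \<Longrightarrow> R S' f"
    and admissible_compose: "R S f \<Longrightarrow> K-lipschitz_on (f ` S) g \<Longrightarrow> R S (g \<circ> f)"
    and admissible_cong: "R S f \<Longrightarrow> (\<And>x. x \<in> S \<Longrightarrow> f x = g' x) \<Longrightarrow> R S g'"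
proof -
  show "R S' f" if "R S f" "S' \<subseteq> S"
    by (rule assms[unfolded admissible_def, THEN conjunct1, rule_format, OF that])
  show "R S (g \<circ> f)" if "R S f" "K-lipschitz_on (f ` S) g"
    by (rule assms[unfolded admissible_def, THEN conjunct2, THEN conjunct1, rule_format, OF that])
  show "R S g'" if "R S f" "\<And>x. x \<in> S \<Longrightarrow> f x = g' x"
    by (rule assms[unfolded admissible_def, THEN conjunct2, THEN conjunct2, rule_format, OF that])
qed

lemma admissible_abs_cont_on: "admissible abs_cont_on"
  unfolding admissible_def
  using abs_cont_on_subset lipschitz_compose_abs_cont_on abs_cont_on_cong by metis

lemma admissible_lipschitz_reg: "admissible lipschitz_reg"
  unfolding admissible_def lipschitz_reg_def
proof (intro conjI allI impI; elim exE)
  fix S and f g :: "real \<Rightarrow> real \<times> 'v" and K assume "\<forall>x\<in>S. f x = g x" "K-lipschitz_on S f"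
  then show "\<exists>K. K-lipschitz_on S g" by (metis lipschitz_on_cong)
next
  fix S S' and f :: "real \<Rightarrow> real \<times> 'v" and K assume "S' \<subseteq> S" "K-lipschitz_on S f"
  then show "\<exists>K. K-lipschitz_on S' f" by (metis lipschitz_on_subset)
next
  fix S and f :: "real \<Rightarrow> real \<times> 'v" and g :: "real \<times> 'v \<Rightarrow> real \<times> 'v" and K L assume "L-lipschitz_on (f ` S) g" "K-lipschitz_on S f"
  then show "\<exists>K. K-lipschitz_on S (g \<circ> f)" using lipschitz_on_compose by blast
qed

lemma loclip_imp_ac: "loclip_curve A \<gamma> a b \<Longrightarrow> ac_curve A \<gamma> a b"
  unfolding loclip_curve_iff ac_curve_iff reg_curve_def lipschitz_reg_def
  using lipschitz_on_imp_abs_cont_on by meson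

text \<open>Near the point the transition map is Lipschitz, and by continuity the curve stays where
  this holds. So the chart witnessing regularity can be exchanged for any chart around the
  point.\<close>

lemma reg_curve_in_chart:
  assumes R: "admissible R" and \<gamma>: "reg_curve R \<gamma> a b" and t: "t \<in> {a..b}" and c: "c \<in> A" "\<gamma> t \<in> snd c"
  obtains \<delta> where "\<delta> > 0" "\<gamma> ` ({a..b} \<inter> cball t \<delta>) \<subseteq> snd c" "R ({a..b} \<inter> cball t \<delta>) (fst c \<circ> \<gamma>)"
proof -
  obtain d \<delta>0 where d: "d \<in> A" and \<delta>0: "\<delta>0 > 0" "\<gamma> ` ({a..b} \<inter> cball t \<delta>0) \<subseteq> snd d"
    "R ({a..b} \<inter> cball t \<delta>0) (fst d \<circ> \<gamma>)"
    using reg_curveD[OF \<gamma> t] by metis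
  have td: "\<gamma> t \<in> snd d" using \<delta>0 t by auto
  have "fst d (\<gamma> t) \<in> fst d ` (snd d \<inter> snd c)" using td c(2) by blast
  then obtain r K where r: "r > 0" "K-lipschitz_on (ball (fst d (\<gamma> t)) r) (transition d c)"
    by (rule Cinf_on_locally_lipschitz[OF transition_Cinf[OF d c(1)]])
  define W where "W = {m \<in> snd d. fst d m \<in> ball (fst d (\<gamma> t)) r} \<inter> snd c"
  have "open W" unfolding W_def
    using open_coord_preimage[OF d open_ball] chart_open[OF c(1)] by blast
  moreover have "\<gamma> t \<in> W" using td c r by (simp add: W_def)
  moreover have "continuous (at t within {a..b}) \<gamma>"
    using \<gamma> t by (simp add: reg_curve_def continuous_on_eq_continuous_within)
  ultimately have "\<forall>\<^sub>F s in at t within {a..b}. \<gamma> s \<in> W"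
    using topological_tendstoD[of \<gamma> "\<gamma> t" _ W] by (simp add: continuous_within)
  then obtain e where e: "e > 0" "\<And>s. s \<in> {a..b} \<Longrightarrow> s \<noteq> t \<Longrightarrow> dist s t < e \<Longrightarrow> \<gamma> s \<in> W"
    unfolding eventually_at by auto
  define \<delta> where "\<delta> = min \<delta>0 (e / 2)"
  have \<delta>: "\<delta> > 0" using \<delta>0 e by (simp add: \<delta>_def)
  let ?S = "{a..b} \<inter> cball t \<delta>"
  have W: "\<gamma> s \<in> W" if "s \<in> ?S" for s
    using that e \<open>\<gamma> t \<in> W\<close> by (cases "s = t") (auto simp: \<delta>_def dist_commute)
  have sub: "?S \<subseteq> {a..b} \<inter> cball t \<delta>0" by (auto simp: \<delta>_def)
  have "R ?S (fst d \<circ> \<gamma>)" by (rule admissible_subset[OF R \<delta>0(3) sub])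
  moreover have "K-lipschitz_on ((fst d \<circ> \<gamma>) ` ?S) (transition d c)"
    by (rule lipschitz_on_subset[OF r(2)]) (use W in \<open>auto simp: W_def\<close>)
  ultimately have "R ?S (transition d c \<circ> (fst d \<circ> \<gamma>))" by (rule admissible_compose[OF R])
  then have "R ?S (fst c \<circ> \<gamma>)"
    by (rule admissible_cong[OF R]) (use W d in \<open>auto simp: W_def transition_eq\<close>)
  moreover have "\<gamma> ` ?S \<subseteq> snd c" using W by (auto simp: W_def)
  ultimately show ?thesis by (intro that[OF \<delta>])
qed

lemma reg_curve_affine:
  assumes R: "admissible R" and \<gamma>: "reg_curve R \<gamma> a b" and e: "e = 1 \<or> e = - 1" and ab': "a' < b'"
    and ab: "\<And>t. t \<in> {a'..b'} \<longleftrightarrow> e * t + k \<in> {a..b}"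
    and RR: "\<And>S f. R S f \<Longrightarrow> R ((\<lambda>t. e * t + k) -` S) (\<lambda>t. f (e * t + k))"
  shows "reg_curve R (\<lambda>t. \<gamma> (e * t + k)) a' b'"
  unfolding reg_curve_def
proof (intro conjI ballI ab')
  show "continuous_on {a'..b'} (\<lambda>t. \<gamma> (e * t + k))"
  proof (rule continuous_on_compose2[of "{a..b}" \<gamma>])
    show "continuous_on {a..b} \<gamma>" using \<gamma> by (simp add: reg_curve_def)
    show "(\<lambda>t. e * t + k) ` {a'..b'} \<subseteq> {a..b}" by (rule image_subsetI) (rule iffD1[OF ab])
  qed (intro continuous_intros)
  fix t assume t: "t \<in> {a'..b'}"
  then have "e * t + k \<in> {a..b}" by (rule iffD1[OF ab])
  then obtain c \<delta> where c: "c \<in> A" "\<delta> > 0" "\<gamma> ` ({a..b} \<inter> cball (e * t + k) \<delta>) \<subseteq> snd c"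
     "R ({a..b} \<inter> cball (e * t + k) \<delta>) (fst c \<circ> \<gamma>)"
    using reg_curveD[OF \<gamma>] by metis
  have eq: "(\<lambda>t. e * t + k) -` ({a..b} \<inter> cball (e * t + k) \<delta>) = {a'..b'} \<inter> cball t \<delta>"
  proof (rule set_eqI)
    fix s
    have "s \<in> {a'..b'} \<longleftrightarrow> e * s + k \<in> {a..b}" by (rule ab)
    moreover have "e * s + k \<in> cball (e * t + k) \<delta> \<longleftrightarrow> s \<in> cball t \<delta>"
      using e by (auto simp: dist_real_def abs_minus_commute)
    ultimately show "s \<in> (\<lambda>t. e * t + k) -` ({a..b} \<inter> cball (e * t + k) \<delta>) \<longleftrightarrow> s \<in> {a'..b'} \<inter> cball t \<delta>"
      by (simp only: vimage_eq Int_iff)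
  qed
  have "(\<lambda>t. \<gamma> (e * t + k)) ` ({a'..b'} \<inter> cball t \<delta>) \<subseteq> snd c"
    using c(3) unfolding eq[symmetric] by auto
  moreover have "R ({a'..b'} \<inter> cball t \<delta>) (fst c \<circ> (\<lambda>t. \<gamma> (e * t + k)))"
    using RR[OF c(4)] unfolding eq by (simp add: comp_def)
  ultimately show "\<exists>c\<in>A. \<exists>\<delta>>0. (\<lambda>t. \<gamma> (e * t + k)) ` ({a'..b'} \<inter> cball t \<delta>) \<subseteq> snd c \<and>
     R ({a'..b'} \<inter> cball t \<delta>) (fst c \<circ> (\<lambda>t. \<gamma> (e * t + k)))"
    by (intro bexI[OF _ c(1)] exI[of _ \<delta>] conjI c(2))
qed

lemma lipschitz_reg_affine:
  assumes "lipschitz_reg S f" "e = 1 \<or> e = - 1"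
  shows "lipschitz_reg ((\<lambda>t. e * t + k) -` S) (\<lambda>t. f (e * t + k))"
proof -
  obtain K where K: "K-lipschitz_on S f" using assms by (auto simp: lipschitz_reg_def)
  have "1-lipschitz_on ((\<lambda>t. e * t + k) -` S) (\<lambda>t. e * t + k)"
    using assms(2) by (auto intro!: lipschitz_onI simp: dist_real_def)
  moreover have "K-lipschitz_on ((\<lambda>t. e * t + k) ` ((\<lambda>t. e * t + k) -` S)) f"
    by (rule lipschitz_on_subset[OF K]) auto
  ultimately have "(K * 1)-lipschitz_on ((\<lambda>t. e * t + k) -` S) (\<lambda>t. f (e * t + k))"
    by (rule lipschitz_on_compose2)
  then show ?thesis unfolding lipschitz_reg_def by blast
qed

text \<open>The factor 1 here, like \<open>- 1 * t + 0\<close> for reversals, is left unsimplified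
  so that shifts and reversals are literal instances of one affine form
  \<open>e * t + k\<close>.\<close>

lemma loclip_curve_shift:
  assumes "loclip_curve A \<gamma> a b"
  shows "loclip_curve A (\<lambda>t. \<gamma> (1 * t + k)) (a - k) (b - k)"
  using assms unfolding loclip_curve_iff
  by (rule reg_curve_affine[OF admissible_lipschitz_reg])
    (use assms in \<open>auto simp: loclip_curve_def intro: lipschitz_reg_affine[of _ _ 1, simplified]\<close>)

lemma loclip_curve_reverse:
  assumes "loclip_curve A \<gamma> a b"
  shows "loclip_curve A (\<lambda>t. \<gamma> (- 1 * t + 0)) (- b) (- a)"
  using assms unfolding loclip_curve_iff
  by (rule reg_curve_affine[OF admissible_lipschitz_reg])
    (use assms in \<open>auto simp: loclip_curve_def intro: lipschitz_reg_affine[of _ _ "- 1" 0, simplified]\<close>)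

lemma ac_curve_reverse:
  assumes "ac_curve A \<gamma> a b"
  shows "ac_curve A (\<lambda>t. \<gamma> (- 1 * t + 0)) (- b) (- a)"
  using assms unfolding ac_curve_iff
proof (rule reg_curve_affine[OF admissible_abs_cont_on])
  fix S and f :: "real \<Rightarrow> real \<times> 'v" assume "abs_cont_on S f"
  moreover have "uminus ` S = (\<lambda>t. - 1 * t + 0) -` S" by force
  ultimately show "abs_cont_on ((\<lambda>t. - 1 * t + 0) -` S) (\<lambda>t. f (- 1 * t + 0))"
    using abs_cont_on_compose_uminus[of S f] by simp
qed (use assms in \<open>auto simp: ac_curve_def\<close>)

text \<open>Regularity at a parameter depends only on the curve nearby. This covers restriction to
  subintervals and all parameters of a concatenation except the junction.\<close>

lemma loclip_curve_near:
  assumes \<gamma>1: "loclip_curve A \<gamma>1 a b" and t: "t \<in> {a..b}" and e: "e > 0"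
    and sub: "S \<inter> cball t e \<subseteq> {a..b}" and eq: "\<And>s. s \<in> S \<inter> cball t e \<Longrightarrow> \<gamma>1 s = \<gamma> s"
  shows "\<exists>c\<in>A. \<exists>\<delta>>0. \<gamma> ` (S \<inter> cball t \<delta>) \<subseteq> snd c \<and> lipschitz_reg (S \<inter> cball t \<delta>) (fst c \<circ> \<gamma>)"
proof -
  obtain c \<delta> where c: "c \<in> A" "\<delta> > 0" "\<gamma>1 ` ({a..b} \<inter> cball t \<delta>) \<subseteq> snd c" "lipschitz_reg ({a..b} \<inter> cball t \<delta>) (fst c \<circ> \<gamma>1)"
    by (rule reg_curveD[OF \<gamma>1[unfolded loclip_curve_iff] t])
  let ?S = "S \<inter> cball t (min \<delta> e)"
  have S: "?S \<subseteq> {a..b} \<inter> cball t \<delta>" using sub by auto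
  have same: "\<gamma>1 s = \<gamma> s" if "s \<in> ?S" for s using that by (intro eq) auto
  have "lipschitz_reg ?S (fst c \<circ> \<gamma>1)" by (rule admissible_subset[OF admissible_lipschitz_reg c(4) S])
  then have "lipschitz_reg ?S (fst c \<circ> \<gamma>)"
    by (rule admissible_cong[OF admissible_lipschitz_reg]) (simp only: same comp_apply)
  moreover have "\<gamma> ` ?S \<subseteq> snd c"
  proof (rule image_subsetI)
    fix s assume s: "s \<in> ?S"
    then have "\<gamma>1 s \<in> snd c" using c(3) S by (meson image_subset_iff subsetD)
    then show "\<gamma> s \<in> snd c" by (simp only: same[OF s])
  qed
  moreover have "min \<delta> e > 0" using c(2) e by simp
  ultimately show ?thesis by (intro bexI[OF _ c(1)] exI[of _ "min \<delta> e"] conjI)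
qed

lemma loclip_curve_subinterval:
  assumes \<gamma>: "loclip_curve A \<gamma> a b" and xy: "a \<le> x" "x < y" "y \<le> b"
  shows "loclip_curve A \<gamma> x y"
  unfolding loclip_curve_iff reg_curve_def
proof (intro conjI ballI xy)
  have sub: "{x..y} \<subseteq> {a..b}" using xy by auto
  have "continuous_on {a..b} \<gamma>" using \<gamma> by (simp add: loclip_curve_def)
  then show "continuous_on {x..y} \<gamma>" using sub by (rule continuous_on_subset)
  fix t assume "t \<in> {x..y}"
  then have t: "t \<in> {a..b}" using sub by blast
  show "\<exists>c\<in>A. \<exists>\<delta>>0. \<gamma> ` ({x..y} \<inter> cball t \<delta>) \<subseteq> snd c \<and> lipschitz_reg ({x..y} \<inter> cball t \<delta>) (fst c \<circ> \<gamma>)"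
    by (rule loclip_curve_near[OF \<gamma> t zero_less_one]) (use sub in auto)
qed

lemma loclip_curve_join:
  assumes \<gamma>1: "loclip_curve A \<gamma>1 a b" and \<gamma>2: "loclip_curve A \<gamma>2 b c" and eq: "\<gamma>1 b = \<gamma>2 b"
  shows "loclip_curve A (\<lambda>t. if t \<le> b then \<gamma>1 t else \<gamma>2 t) a c"
proof -
  let ?\<gamma> = "\<lambda>t. if t \<le> b then \<gamma>1 t else \<gamma>2 t"
  have ab: "a < b" "b < c" and cont1: "continuous_on {a..b} \<gamma>1" and cont2: "continuous_on {b..c} \<gamma>2"
    using \<gamma>1 \<gamma>2 by (auto simp: loclip_curve_def)
  have ac: "{a..c} = {a..b} \<union> {b..c}" using ab by auto
  have "continuous_on {a..c} ?\<gamma>"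
    unfolding ac
  proof (rule continuous_on_closed_Un)
    show "continuous_on {a..b} ?\<gamma>" using cont1 by (rule continuous_on_eq) auto
    show "continuous_on {b..c} ?\<gamma>" using cont2 by (rule continuous_on_eq) (use eq in auto)
  qed auto
  moreover have "\<exists>d\<in>A. \<exists>\<delta>>0. ?\<gamma> ` ({a..c} \<inter> cball t \<delta>) \<subseteq> snd d \<and> lipschitz_reg ({a..c} \<inter> cball t \<delta>) (fst d \<circ> ?\<gamma>)"
    if t: "t \<in> {a..c}" for t
  proof -
    consider "t < b" | "t = b" | "t > b" by linarith
    then show ?thesis
    proof cases
      case 1
      show ?thesis
        by (rule loclip_curve_near[OF \<gamma>1, of _ "b - t"]) (use 1 t in \<open>auto simp: dist_real_def\<close>)
    next
      case 3
      have near: "b < x" if "x \<in> {a..c} \<inter> cball t ((t - b) / 2)" for x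
      proof -
        have "\<bar>t - x\<bar> \<le> (t - b) / 2" using that unfolding Int_iff mem_cball dist_real_def by blast
        then show ?thesis using 3 by argo
      qed
      show ?thesis
      proof (rule loclip_curve_near[OF \<gamma>2, of _ "(t - b) / 2"])
        show "{a..c} \<inter> cball t ((t - b) / 2) \<subseteq> {b..c}"
        proof
          fix x assume x: "x \<in> {a..c} \<inter> cball t ((t - b) / 2)"
          with near[OF x] show "x \<in> {b..c}" by auto
        qed
        show "\<gamma>2 s = ?\<gamma> s" if "s \<in> {a..c} \<inter> cball t ((t - b) / 2)" for s
          using near[OF that] by simp
      qed (use 3 t in auto)
    next
      case 2
      obtain d where d: "d \<in> A" "\<gamma>1 b \<in> snd d" by (rule obtain_chart)
      obtain \<delta>1 where d1: "\<delta>1 > 0" "\<gamma>1 ` ({a..b} \<inter> cball b \<delta>1) \<subseteq> snd d" "lipschitz_reg ({a..b} \<inter> cball b \<delta>1) (fst d \<circ> \<gamma>1)"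
        by (rule reg_curve_in_chart[OF admissible_lipschitz_reg \<gamma>1[unfolded loclip_curve_iff] _ d]) (use ab in auto)
      have g2: "\<gamma>2 b \<in> snd d" using d eq by simp
      obtain \<delta>2 where d2: "\<delta>2 > 0" "\<gamma>2 ` ({b..c} \<inter> cball b \<delta>2) \<subseteq> snd d" "lipschitz_reg ({b..c} \<inter> cball b \<delta>2) (fst d \<circ> \<gamma>2)"
        by (rule reg_curve_in_chart[OF admissible_lipschitz_reg \<gamma>2[unfolded loclip_curve_iff] _ d(1) g2]) (use ab in auto)
      \<comment> \<open>At the junction both pieces are viewed in the single chart \<open>d\<close>.
        The bounds \<open>b - a\<close> and \<open>c - b\<close> make the parameter neighbourhood
        the full interval \<open>{b - e..b + e}\<close>, on which two Lipschitz pieces can be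
        concatenated.\<close>
      define e where "e = min (min \<delta>1 \<delta>2) (min (b - a) (c - b))"
      have e: "e > 0" using d1 d2 ab by (simp add: e_def)
      have s1: "{b - e..b} \<subseteq> {a..b} \<inter> cball b \<delta>1" by (auto simp: e_def dist_real_def)
      have s2: "{b..b + e} \<subseteq> {b..c} \<inter> cball b \<delta>2" by (auto simp: e_def dist_real_def)
      have cb: "{a..c} \<inter> cball b e = {b - e..b + e}" by (auto simp: e_def dist_real_def abs_le_iff)
      obtain K1 K2 where K: "K1-lipschitz_on {b - e..b} (fst d \<circ> \<gamma>1)" "K2-lipschitz_on {b..b + e} (fst d \<circ> \<gamma>2)"
        using d1(3) d2(3) s1 s2 lipschitz_on_subset unfolding lipschitz_reg_def by metis
      have "(max K1 K2)-lipschitz_on {b - e..b + e} (\<lambda>x. if x \<le> b then (fst d \<circ> \<gamma>1) x else (fst d \<circ> \<gamma>2) x)"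
        by (rule lipschitz_on_concat_max[OF K]) (simp add: eq)
      moreover have "(\<lambda>x. if x \<le> b then (fst d \<circ> \<gamma>1) x else (fst d \<circ> \<gamma>2) x) = fst d \<circ> ?\<gamma>" by auto
      ultimately have "lipschitz_reg ({a..c} \<inter> cball t e) (fst d \<circ> ?\<gamma>)"
        unfolding 2 cb lipschitz_reg_def by (intro exI[of _ "max K1 K2"]) (simp only:)
      moreover have "?\<gamma> ` ({a..c} \<inter> cball t e) \<subseteq> snd d"
      proof
        fix m assume "m \<in> ?\<gamma> ` ({a..c} \<inter> cball t e)"
        then obtain s where s: "s \<in> {b - e..b + e}" "m = ?\<gamma> s" unfolding 2 cb by blast
        show "m \<in> snd d"
        proof (cases "s \<le> b")
          case True
          then have "s \<in> {a..b} \<inter> cball b \<delta>1" using s1 s by auto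
          then show ?thesis using d1(2) s True by auto
        next
          case False
          then have "s \<in> {b..b + e}" using s(1) by simp
          then have "s \<in> {b..c} \<inter> cball b \<delta>2" by (rule subsetD[OF s2])
          then show ?thesis using d2(2) s False by auto
        qed
      qed
      ultimately show ?thesis by (intro bexI[OF _ d(1)] exI[of _ e] conjI e)
    qed
  qed
  moreover have "a < c" using ab by simp
  ultimately show ?thesis unfolding loclip_curve_iff reg_curve_def by (intro conjI ballI)
qed

lemma ae_vel_join:
  assumes "ae_vel P \<gamma>1 a b" "ae_vel P \<gamma>2 b c"
  shows "ae_vel P (\<lambda>t. if t \<le> b then \<gamma>1 t else \<gamma>2 t) a c"
proof -
  let ?\<gamma> = "\<lambda>t. if t \<le> b then \<gamma>1 t else \<gamma>2 t"
  let ?N = "{t. a < t \<and> t < b \<and> \<not> vel P \<gamma>1 t} \<union> {t. b < t \<and> t < c \<and> \<not> vel P \<gamma>2 t} \<union> {b}"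
  have "negligible ?N" using assms by (simp add: ae_vel_def)
  have "vel P ?\<gamma> t" if "vel P \<gamma>1 t" "t < b" for t
    by (rule vel_cong[OF open_lessThan[of b] _ _ that(1)]) (use that in auto)
  moreover have "vel P ?\<gamma> t" if "vel P \<gamma>2 t" "b < t" for t
    by (rule vel_cong[OF open_greaterThan[of b] _ _ that(1)]) (use that in auto)
  ultimately have "{t. a < t \<and> t < c \<and> \<not> vel P ?\<gamma> t} \<subseteq> ?N" by force
  with \<open>negligible ?N\<close> show ?thesis unfolding ae_vel_def by (rule negligible_subset)
qed

text \<open>One relation for both kinds of curves, with the condition on velocities as a parameter.
  Curves have a nondegenerate parameter interval, so reflexivity is not automatic and
  \<open>rel_J\<close> inserts its base point separately.\<close>

definition reach :: "(('m, 'v) chart \<Rightarrow> real \<times> 'v \<Rightarrow> real \<times> 'v \<Rightarrow> bool) \<Rightarrow> 'm set \<Rightarrow> 'm \<Rightarrow> 'm \<Rightarrow> bool" where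
  "reach P U p q \<longleftrightarrow> (\<exists>\<gamma> a b. loclip_curve A \<gamma> a b \<and> ae_vel P \<gamma> a b \<and> \<gamma> a = p \<and> \<gamma> b = q \<and> \<gamma> ` {a..b} \<subseteq> U)"

lemma rel_I_eq: "rel_I A G T fut p U = {q. reach (timelike_vec G T fut) U p q}"
  unfolding rel_I_def reach_def timelike_curve_iff ..

lemma rel_J_eq: "rel_J A G T fut p U = insert p {q. reach (causal_vec G T fut) U p q}"
  unfolding rel_J_def reach_def causal_curve_iff by simp

lemma reach_mono: "reach P U p q \<Longrightarrow> U \<subseteq> U' \<Longrightarrow> reach P U' p q"
  unfolding reach_def by (elim exE conjE) (intro exI conjI, assumption+, rule order_trans)

lemma reach_causal: "reach (timelike_vec G T fut) U p q \<Longrightarrow> reach (causal_vec G T fut) U p q"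
  unfolding reach_def using ae_vel_mono[OF _ vel_timelike_imp_causal] by blast

lemma reach_mem: "reach P U p q \<Longrightarrow> p \<in> U \<and> q \<in> U"
  unfolding reach_def loclip_curve_def by (force simp: image_subset_iff)

text \<open>A translation of the parameter lets the curve start at any prescribed \<open>a\<close>,
  for instance where another curve ends.\<close>

lemma reachE_start:
  assumes "reach P U p q"
  obtains \<gamma> b where "loclip_curve A \<gamma> a b" "ae_vel P \<gamma> a b" "\<gamma> a = p" "\<gamma> b = q" "\<gamma> ` {a..b} \<subseteq> U"
proof -
  obtain \<gamma> a' b' where g: "loclip_curve A \<gamma> a' b'" "ae_vel P \<gamma> a' b'" "\<gamma> a' = p" "\<gamma> b' = q" "\<gamma> ` {a'..b'} \<subseteq> U"
    using assms unfolding reach_def by blast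
  define k where "k = a' - a"
  have "loclip_curve A (\<lambda>t. \<gamma> (1 * t + k)) (a' - k) (b' - k)" by (rule loclip_curve_shift[OF g(1)])
  moreover have "ae_vel P (\<lambda>t. \<gamma> (1 * t + k)) (a' - k) (b' - k)"
    by (rule ae_vel_affine[OF g(2)]) auto
  moreover have "(\<lambda>t. \<gamma> (1 * t + k)) ` {a' - k..b' - k} \<subseteq> U" using g(5) by (auto simp: image_subset_iff)
  moreover have "a' - k = a" by (simp add: k_def)
  ultimately show ?thesis using g(3,4) by (intro that[of "\<lambda>t. \<gamma> (1 * t + k)" "b' - k"]) (auto simp: k_def)
qed

lemma reach_trans:
  assumes "reach P U p q" "reach P U q r"
  shows "reach P U p r"
proof -
  obtain \<gamma>1 a b where 1: "loclip_curve A \<gamma>1 a b" "ae_vel P \<gamma>1 a b" "\<gamma>1 a = p" "\<gamma>1 b = q" "\<gamma>1 ` {a..b} \<subseteq> U"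
    using assms(1) unfolding reach_def by blast
  obtain \<gamma>2 c where 2: "loclip_curve A \<gamma>2 b c" "ae_vel P \<gamma>2 b c" "\<gamma>2 b = q" "\<gamma>2 c = r" "\<gamma>2 ` {b..c} \<subseteq> U"
    using reachE_start[OF assms(2)] by blast
  have lt: "a < b" "b < c" using 1 2 by (auto simp: loclip_curve_def)
  let ?\<gamma> = "\<lambda>t. if t \<le> b then \<gamma>1 t else \<gamma>2 t"
  have "loclip_curve A ?\<gamma> a c" using 1 2 by (intro loclip_curve_join) auto
  moreover have "ae_vel P ?\<gamma> a c" using 1 2 by (intro ae_vel_join)
  moreover have "?\<gamma> ` {a..c} \<subseteq> U" using 1(5) 2(5) by (auto simp: image_subset_iff)
  ultimately show ?thesis unfolding reach_def using 1 2 lt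
    by (intro exI[of _ ?\<gamma>] exI[of _ a] exI[of _ c]) auto
qed

section \<open>Timelike cones\<close>

lemma timelike_uminus:
  "c \<in> A \<Longrightarrow> y \<in> fst c ` snd c \<Longrightarrow> timelike_vec G T fut c y v \<Longrightarrow> timelike_vec G T (\<not> fut) c y (- 1 *\<^sub>R v)"
  by (auto simp: timelike_vec_def directed_def bilinear_lneg[OF metric_bilinear] bilinear_rneg[OF metric_bilinear])

lemma causal_uminus:
  "c \<in> A \<Longrightarrow> y \<in> fst c ` snd c \<Longrightarrow> causal_vec G T fut c y v \<Longrightarrow> causal_vec G T (\<not> fut) c y (- 1 *\<^sub>R v)"
  by (auto simp: causal_vec_def directed_def bilinear_lneg[OF metric_bilinear] bilinear_rneg[OF metric_bilinear])

lemma reach_uminus: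
  assumes "reach P U p q" and PQ: "\<And>c y v. c \<in> A \<Longrightarrow> y \<in> fst c ` snd c \<Longrightarrow> P c y v \<Longrightarrow> Q c y (- 1 *\<^sub>R v)"
  shows "reach Q U q p"
proof -
  obtain \<gamma> a b where g: "loclip_curve A \<gamma> a b" "ae_vel P \<gamma> a b" "\<gamma> a = p" "\<gamma> b = q" "\<gamma> ` {a..b} \<subseteq> U"
    using assms(1) unfolding reach_def by blast
  have "loclip_curve A (\<lambda>t. \<gamma> (- 1 * t + 0)) (- b) (- a)" by (rule loclip_curve_reverse[OF g(1)])
  moreover have "ae_vel Q (\<lambda>t. \<gamma> (- 1 * t + 0)) (- b) (- a)"
    by (rule ae_vel_affine[where e = "- 1", OF g(2)], simp, erule (2) PQ, auto)
  moreover have "(\<lambda>t. \<gamma> (- 1 * t + 0)) ` {- b..- a} \<subseteq> U" using g(5) by (auto simp: image_subset_iff)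
  ultimately show ?thesis using g(3,4) unfolding reach_def
    by (intro exI[of _ "\<lambda>t. \<gamma> (- 1 * t + 0)"] exI[of _ "- b"] exI[of _ "- a"]) auto
qed

lemma reach_reverse: "reach (timelike_vec G T fut) U p q \<Longrightarrow> reach (timelike_vec G T (\<not> fut)) U q p"
  by (erule reach_uminus) (rule timelike_uminus)

lemma reach_causal_reverse: "reach (causal_vec G T fut) U p q \<Longrightarrow> reach (causal_vec G T (\<not> fut)) U q p"
  by (erule reach_uminus) (rule causal_uminus)

lemma coordinate_curve:
  assumes c: "c \<in> A" and ab: "a < b" and f: "K-lipschitz_on {a..b} f" "f ` {a..b} \<subseteq> fst c ` snd c"
    and N: "negligible N"
    and der: "\<And>t. a < t \<Longrightarrow> t < b \<Longrightarrow> t \<notin> N \<Longrightarrow> \<exists>v. (f has_vector_derivative v) (at t) \<and> P c (f t) v"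
  shows "loclip_curve A (\<lambda>t. coord_inv c (f t)) a b" "ae_vel P (\<lambda>t. coord_inv c (f t)) a b"
proof -
  let ?g = "\<lambda>t. coord_inv c (f t)"
  have cont: "continuous_on {a..b} ?g"
    by (rule continuous_on_compose2[OF coord_inv_continuous[OF c] lipschitz_on_continuous_on[OF f(1)] f(2)])
  have eq: "fst c (?g t) = f t" if "t \<in> {a..b}" for t
    using f(2) that by (intro coord_coord_inv) auto
  have mem: "?g t \<in> snd c" if "t \<in> {a..b}" for t
    using f(2) that by (intro coord_inv_mem) auto
  show "loclip_curve A ?g a b"
    unfolding loclip_curve_def
  proof (intro conjI ballI ab cont)
    fix t assume "t \<in> {a..b}"
    have "K-lipschitz_on ({a..b} \<inter> cball t 1) f" by (rule lipschitz_on_subset[OF f(1)]) simp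
    then have "K-lipschitz_on ({a..b} \<inter> cball t 1) (fst c \<circ> ?g)"
      by (rule lipschitz_on_transform) (simp add: eq)
    moreover have "?g ` ({a..b} \<inter> cball t 1) \<subseteq> snd c"
      by (rule image_subsetI) (rule mem, simp)
    ultimately show "\<exists>d\<in>A. \<exists>\<delta>>0. ?g ` ({a..b} \<inter> cball t \<delta>) \<subseteq> snd d \<and>
        (\<exists>K. K-lipschitz_on ({a..b} \<inter> cball t \<delta>) (fst d \<circ> ?g))"
      by (intro bexI[OF _ c] exI[of _ 1] exI[of _ K] conjI) auto
  qed
  have "vel P ?g t" if t: "a < t" "t < b" "t \<notin> N" for t
  proof -
    obtain v where v: "(f has_vector_derivative v) (at t)" "P c (f t) v" using der[OF t] by blast
    have "((fst c \<circ> ?g) has_vector_derivative v) (at t)"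
      by (rule has_vector_derivative_transform_within_open[OF v(1), of "{a<..<b}"]) (use t eq in auto)
    moreover have "P c (fst c (?g t)) v" using v(2) eq[of t] t by simp
    moreover have "?g t \<in> snd c" using mem t by simp
    ultimately show ?thesis unfolding vel_def by (intro bexI[OF _ c] exI[of _ v] conjI)
  qed
  then show "ae_vel P ?g a b"
    unfolding ae_vel_def by (intro negligible_subset[OF N]) blast
qed

lemma reach_segment:
  assumes c: "c \<in> A" and sub: "\<And>t. 0 \<le> t \<Longrightarrow> t \<le> 1 \<Longrightarrow> y + t *\<^sub>R w \<in> fst c ` (snd c \<inter> U)"
    and tl: "\<And>t. 0 < t \<Longrightarrow> t < 1 \<Longrightarrow> P c (y + t *\<^sub>R w) w"
  shows "reach P U (coord_inv c y) (coord_inv c (y + w))"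
proof -
  let ?f = "\<lambda>t. y + t *\<^sub>R w"
  have 1: "(norm w)-lipschitz_on {0..1} ?f"
    by (rule lipschitz_onI) (simp_all add: dist_norm algebra_simps flip: scaleR_diff_left)
  have 2: "?f ` {0..1} \<subseteq> fst c ` snd c" using sub by fastforce
  have 3: "\<exists>v. (?f has_vector_derivative v) (at t) \<and> P c (?f t) v" if "0 < t" "t < 1" "t \<notin> {}" for t
  proof -
    have "(?f has_vector_derivative w) (at t)"
      by (auto intro!: derivative_eq_intros)
    then show ?thesis using tl that by blast
  qed
  have curve: "loclip_curve A (\<lambda>t. coord_inv c (?f t)) 0 1" "ae_vel P (\<lambda>t. coord_inv c (?f t)) 0 1"
    by (rule coordinate_curve[where P = P and f = ?f, OF c zero_less_one 1 2 negligible_empty 3]; simp)+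
  have "coord_inv c (?f t) \<in> U" if "t \<in> {0..1}" for t
    using sub[of t] that c by auto
  then show ?thesis unfolding reach_def using curve
    by (intro exI[of _ "\<lambda>t. coord_inv c (?f t)"] exI[of _ 0] exI[of _ 1]) auto
qed

text \<open>A straight coordinate segment stays in the convex ball and has constant direction, so it
  is timelike as soon as its direction is a positive multiple of a vector near \<open>w0\<close>.
  The factor \<open>r\<close> expresses this multiple.\<close>

lemma local_cone:
  assumes c: "c \<in> A" and y0: "y0 \<in> fst c ` (snd c \<inter> U)" and U: "open U"
    and tl: "timelike_vec G T fut c y0 w0"
  obtains \<rho> where "\<rho> > 0" "ball y0 \<rho> \<subseteq> fst c ` (snd c \<inter> U)"
    "\<And>y z r. y \<in> ball y0 \<rho> \<Longrightarrow> z \<in> ball y0 \<rho> \<Longrightarrow> r > 0 \<Longrightarrow> (1 / r) *\<^sub>R (z - y) \<in> ball w0 \<rho> \<Longrightarrow>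
       reach (timelike_vec G T fut) U (coord_inv c y) (coord_inv c z)"
proof -
  have "y0 \<in> fst c ` snd c" using y0 by blast
  then obtain \<rho>1 where \<rho>1: "\<rho>1 > 0" "\<And>y w. y \<in> ball y0 \<rho>1 \<Longrightarrow> w \<in> ball w0 \<rho>1 \<Longrightarrow> timelike_vec G T fut c y w"
    using open_timelike[OF c _ tl] by metis
  obtain \<rho>2 where \<rho>2: "\<rho>2 > 0" "ball y0 \<rho>2 \<subseteq> fst c ` (snd c \<inter> U)"
    using open_coord_image[OF c U] y0 open_contains_ball by metis
  define \<rho> where "\<rho> = min \<rho>1 \<rho>2"
  have sub: "ball y0 \<rho> \<subseteq> fst c ` (snd c \<inter> U)" using \<rho>2(2) by (auto simp: \<rho>_def)
  show ?thesis
  proof (rule that[OF _ sub])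
    show "\<rho> > 0" using \<rho>1 \<rho>2 by (simp add: \<rho>_def)
    fix y z :: "real \<times> 'v" and r :: real
    assume y: "y \<in> ball y0 \<rho>" and z: "z \<in> ball y0 \<rho>" and r: "r > 0" and w: "(1 / r) *\<^sub>R (z - y) \<in> ball w0 \<rho>"
    let ?w = "(1 / r) *\<^sub>R (z - y)"
    have seg: "y + t *\<^sub>R (z - y) \<in> ball y0 \<rho>" if "0 \<le> t" "t \<le> 1" for t
    proof -
      have "(1 - t) *\<^sub>R y + t *\<^sub>R z \<in> ball y0 \<rho>"
        using convexD_alt[OF convex_ball y z] that by simp
      then show ?thesis by (simp add: algebra_simps)
    qed
    have "reach (timelike_vec G T fut) U (coord_inv c y) (coord_inv c (y + (z - y)))"
    proof (rule reach_segment[OF c])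
      show "y + t *\<^sub>R (z - y) \<in> fst c ` (snd c \<inter> U)" if "0 \<le> t" "t \<le> 1" for t
        using seg[OF that] sub by blast
      fix t :: real assume t: "0 < t" "t < 1"
      have m: "y + t *\<^sub>R (z - y) \<in> ball y0 \<rho>" using seg t by simp
      then have tlw: "timelike_vec G T fut c (y + t *\<^sub>R (z - y)) ?w"
        using w by (intro \<rho>1(2)) (auto simp: \<rho>_def)
      have bil: "bilinear (G c (y + t *\<^sub>R (z - y)))" using m sub by (intro metric_bilinear[OF c]) blast
      have "z - y = r *\<^sub>R ?w" using r by simp
      moreover have "timelike_vec G T fut c (y + t *\<^sub>R (z - y)) (r *\<^sub>R ?w)"
        using tlw r unfolding timelike_vec_def directed_def bilinear_lmul[OF bil] bilinear_rmul[OF bil] real_scaleR_def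
        by (simp only: mult_less_0_iff zero_less_mult_iff) auto
      ultimately show "timelike_vec G T fut c (y + t *\<^sub>R (z - y)) (z - y)" by metis
    qed
    then show "reach (timelike_vec G T fut) U (coord_inv c y) (coord_inv c z)" by simp
  qed
qed

lemma exists_timelike:
  assumes "c \<in> A" "y \<in> fst c ` snd c"
  obtains w where "timelike_vec G T fut c y w"
proof (cases fut)
  case True
  then show ?thesis using that[of "T c y"] orientation_timelike[OF assms] by (simp add: timelike_vec_def directed_def)
next
  case False
  then show ?thesis using that[of "- T c y"] orientation_timelike[OF assms] metric_bilinear[OF assms]
    by (simp add: timelike_vec_def directed_def bilinear_lneg bilinear_rneg)
qed

text \<open>Timelike futures are robust under perturbation of their end points, so a set
  that is closed under timelike continuation contains an open cone above each point of its closure.\<close>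

lemma closure_cone:
  assumes U: "open U" and X: "\<forall>x\<in>X. \<forall>y. reach (timelike_vec G T fut) U x y \<longrightarrow> y \<in> X"
    and c: "c \<in> A" and y0: "y0 \<in> fst c ` (snd c \<inter> U)" and tl: "timelike_vec G T fut c y0 w0"
  obtains \<rho> where "\<rho> > 0" "ball y0 \<rho> \<subseteq> fst c ` (snd c \<inter> U)"
    "\<And>y z r. y \<in> ball y0 \<rho> \<Longrightarrow> z \<in> ball y0 \<rho> \<Longrightarrow> r > 0 \<Longrightarrow> (1 / r) *\<^sub>R (z - y) \<in> ball w0 \<rho> \<Longrightarrow>
       coord_inv c y \<in> closure X \<Longrightarrow> coord_inv c z \<in> X"
proof -
  obtain \<rho> where \<rho>: "\<rho> > 0" "ball y0 \<rho> \<subseteq> fst c ` (snd c \<inter> U)"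
    "\<And>y z r. y \<in> ball y0 \<rho> \<Longrightarrow> z \<in> ball y0 \<rho> \<Longrightarrow> r > 0 \<Longrightarrow> (1 / r) *\<^sub>R (z - y) \<in> ball w0 \<rho> \<Longrightarrow>
       reach (timelike_vec G T fut) U (coord_inv c y) (coord_inv c z)"
    using local_cone[OF c y0 U tl] by metis
  show ?thesis
  proof (rule that[OF \<rho>(1,2)])
    fix y z :: "real \<times> 'v" and r :: real
    assume y: "y \<in> ball y0 \<rho>" and z: "z \<in> ball y0 \<rho>" and r: "r > 0" and w: "(1 / r) *\<^sub>R (z - y) \<in> ball w0 \<rho>"
      and cl: "coord_inv c y \<in> closure X"
    let ?h = "\<lambda>y'. (1 / r) *\<^sub>R (z - y')"
    \<comment> \<open>The starting points from which \<open>z\<close> still lies in the cone form a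
      neighbourhood of \<open>y\<close>, so it contains a point of \<open>X\<close>.\<close>
    define W where "W = ball y0 \<rho> \<inter> ?h -` ball w0 \<rho>"
    have "open W" unfolding W_def
      by (intro open_Int open_ball open_vimage continuous_intros)
    then have "open {m \<in> snd c. fst c m \<in> W}" by (rule open_coord_preimage[OF c])
    moreover have yi: "y \<in> fst c ` snd c" using y \<rho>(2) by blast
    then have "coord_inv c y \<in> {m \<in> snd c. fst c m \<in> W}"
      using y w by (auto simp: W_def coord_inv_mem)
    ultimately obtain x where x: "x \<in> X" "x \<in> snd c" "fst c x \<in> W"
      using cl unfolding closure_iff_nhds_not_empty by blast
    have "reach (timelike_vec G T fut) U (coord_inv c (fst c x)) (coord_inv c z)"
      using x(3) z r by (intro \<rho>(3)[of _ _ r]) (auto simp: W_def)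
    then show "coord_inv c z \<in> X" using X x c by simp
  qed
qed

text \<open>A short step from \<open>q\<close> against the timelike direction ends at a point of
  \<open>closure X\<close>; the open cone above that point contains a neighbourhood of
  \<open>q\<close> and lies in \<open>X\<close>.\<close>

lemma interior_closure_absorbing:
  assumes U: "open U" and X: "\<forall>x\<in>X. \<forall>y. reach (timelike_vec G T fut) U x y \<longrightarrow> y \<in> X"
  shows "U \<inter> interior (closure X) \<subseteq> interior X"
proof
  fix q assume q: "q \<in> U \<inter> interior (closure X)"
  obtain c where c: "c \<in> A" "q \<in> snd c" by (rule obtain_chart)
  define y0 where "y0 = fst c q"
  have y0: "y0 \<in> fst c ` (snd c \<inter> (U \<inter> interior (closure X)))" using q c by (auto simp: y0_def)
  then obtain w0 where tl: "timelike_vec G T fut c y0 w0" using exists_timelike[OF c(1), of y0] by blast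
  have y0U: "y0 \<in> fst c ` (snd c \<inter> U)" using y0 by blast
  obtain \<rho> where \<rho>: "\<rho> > 0" "ball y0 \<rho> \<subseteq> fst c ` (snd c \<inter> U)"
    "\<And>y z r. y \<in> ball y0 \<rho> \<Longrightarrow> z \<in> ball y0 \<rho> \<Longrightarrow> r > 0 \<Longrightarrow> (1 / r) *\<^sub>R (z - y) \<in> ball w0 \<rho> \<Longrightarrow>
       coord_inv c y \<in> closure X \<Longrightarrow> coord_inv c z \<in> X"
    using closure_cone[OF U X c(1) y0U tl] by metis
  have "open (fst c ` (snd c \<inter> (U \<inter> interior (closure X))))"
    using c(1) U by (intro open_coord_image) auto
  then obtain e where e: "e > 0" "ball y0 e \<subseteq> fst c ` (snd c \<inter> (U \<inter> interior (closure X)))"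
    using y0 open_contains_ball by metis
  \<comment> \<open>Chosen so that the displacement \<open>r *\<^sub>R w0\<close> is shorter than
    both radii; adding 1 to the norm makes the inequality strict.\<close>
  define r where "r = min e \<rho> / (2 * (norm w0 + 1))"
  have r: "r > 0" using e(1) \<rho>(1) by (simp add: r_def add_nonneg_pos)
  define y where "y = y0 - r *\<^sub>R w0"
  have "r * norm w0 < min e \<rho>"
  proof -
    have "r * norm w0 < r * (2 * (norm w0 + 1))" using r by (simp add: add_nonneg_pos)
    also have "\<dots> = min e \<rho>" unfolding r_def by (simp add: add_nonneg_eq_0_iff)
    finally show ?thesis .
  qed
  then have yb: "y \<in> ball y0 e" "y \<in> ball y0 \<rho>" using r by (auto simp: y_def dist_norm)
  have ycl: "coord_inv c y \<in> closure X" using yb(1) e(2) c(1) interior_subset by fastforce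
  let ?h = "\<lambda>z. (1 / r) *\<^sub>R (z - y)"
  define W where "W = ball y0 \<rho> \<inter> ?h -` ball w0 \<rho>"
  have "open W" unfolding W_def
    by (intro open_Int open_ball open_vimage continuous_intros)
  then have "open {m \<in> snd c. fst c m \<in> W}" by (rule open_coord_preimage[OF c(1)])
  moreover have "q \<in> {m \<in> snd c. fst c m \<in> W}"
    using c \<rho>(1) r by (simp add: W_def y_def flip: y0_def)
  moreover have "{m \<in> snd c. fst c m \<in> W} \<subseteq> X"
  proof clarify
    fix m assume m: "m \<in> snd c" "fst c m \<in> W"
    then have "coord_inv c (fst c m) \<in> X"
      using \<rho>(3)[OF yb(2) _ r _ ycl] by (auto simp: W_def)
    then show "m \<in> X" using m c by simp
  qed
  ultimately show "q \<in> interior X" by (rule interiorI)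
qed

text \<open>Difference quotients at \<open>t\<close> converge to the timelike velocity, so the
  chords to later points nearby enter the open cone at \<open>\<gamma> t\<close>. Differentiability
  at the single parameter \<open>t\<close> suffices, and openness of the cone supplies the
  neighbourhood \<open>W\<close>.\<close>

lemma reach_along_timelike_velocity:
  assumes v: "vel (timelike_vec G T fut) \<gamma> t" and cont: "isCont \<gamma> t" and U: "open U" "\<gamma> t \<in> U"
  obtains \<delta> where "\<delta> > 0"
    "\<And>s. t < s \<Longrightarrow> s < t + \<delta> \<Longrightarrow> \<exists>W. open W \<and> \<gamma> s \<in> W \<and> (\<forall>m\<in>W. reach (timelike_vec G T fut) U (\<gamma> t) m)"
proof -
  obtain c w0 where c: "c \<in> A" "\<gamma> t \<in> snd c" and w0: "((fst c \<circ> \<gamma>) has_vector_derivative w0) (at t)"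
    "timelike_vec G T fut c (fst c (\<gamma> t)) w0"
    using v unfolding vel_def by blast
  define y0 where "y0 = fst c (\<gamma> t)"
  have y0: "y0 \<in> fst c ` (snd c \<inter> U)" using c U by (auto simp: y0_def)
  obtain \<rho> where \<rho>: "\<rho> > 0" "ball y0 \<rho> \<subseteq> fst c ` (snd c \<inter> U)"
    "\<And>y z r. y \<in> ball y0 \<rho> \<Longrightarrow> z \<in> ball y0 \<rho> \<Longrightarrow> r > 0 \<Longrightarrow> (1 / r) *\<^sub>R (z - y) \<in> ball w0 \<rho> \<Longrightarrow>
       reach (timelike_vec G T fut) U (coord_inv c y) (coord_inv c z)"
    using local_cone[OF c(1) y0 U(1) w0(2)[folded y0_def]] by metis
  have "\<forall>\<^sub>F s in at t. (1 / (s - t)) *\<^sub>R (fst c (\<gamma> s) - y0) \<in> ball w0 \<rho>"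
  proof -
    have "\<rho> / 2 > 0" using \<rho>(1) by simp
    then obtain e where e: "e > 0" "\<And>s. norm (s - t) < e \<Longrightarrow>
        norm ((fst c \<circ> \<gamma>) s - (fst c \<circ> \<gamma>) t - (s - t) *\<^sub>R w0) \<le> \<rho> / 2 * norm (s - t)"
      using w0(1) unfolding has_vector_derivative_def has_derivative_at_alt by meson
    have "(1 / (s - t)) *\<^sub>R (fst c (\<gamma> s) - y0) \<in> ball w0 \<rho>" if s: "s \<noteq> t" "dist s t < e" for s
    proof -
      have "norm ((1 / (s - t)) *\<^sub>R (fst c (\<gamma> s) - y0) - w0) = norm ((1 / (s - t)) *\<^sub>R (fst c (\<gamma> s) - y0 - (s - t) *\<^sub>R w0))"
        using s(1) by (simp add: scaleR_diff_right)
      also have "\<dots> = norm (fst c (\<gamma> s) - y0 - (s - t) *\<^sub>R w0) / norm (s - t)" by simp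
      also have "\<dots> \<le> \<rho> / 2"
        using e(2)[of s] s by (simp add: dist_norm y0_def divide_le_eq)
      finally show ?thesis using \<rho>(1) by (simp add: dist_norm norm_minus_commute)
    qed
    then show ?thesis using e(1) unfolding eventually_at by blast
  qed
  moreover have "open {m \<in> snd c. fst c m \<in> ball y0 \<rho>}" by (rule open_coord_preimage[OF c(1) open_ball])
  then have "\<forall>\<^sub>F s in at t. \<gamma> s \<in> {m \<in> snd c. fst c m \<in> ball y0 \<rho>}"
    using cont c \<rho>(1) by (intro topological_tendstoD[of \<gamma> "\<gamma> t"]) (auto simp: isCont_def y0_def)
  ultimately have "\<forall>\<^sub>F s in at t. (1 / (s - t)) *\<^sub>R (fst c (\<gamma> s) - y0) \<in> ball w0 \<rho> \<and> \<gamma> s \<in> snd c \<and> fst c (\<gamma> s) \<in> ball y0 \<rho>"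
    by eventually_elim simp
  then obtain \<delta> where \<delta>: "\<delta> > 0" "\<And>s. s \<noteq> t \<Longrightarrow> dist s t < \<delta> \<Longrightarrow>
      (1 / (s - t)) *\<^sub>R (fst c (\<gamma> s) - y0) \<in> ball w0 \<rho> \<and> \<gamma> s \<in> snd c \<and> fst c (\<gamma> s) \<in> ball y0 \<rho>"
    unfolding eventually_at by blast
  show ?thesis
  proof (rule that[OF \<delta>(1)])
    fix s assume s: "t < s" "s < t + \<delta>"
    have sd: "(1 / (s - t)) *\<^sub>R (fst c (\<gamma> s) - y0) \<in> ball w0 \<rho>" "\<gamma> s \<in> snd c" "fst c (\<gamma> s) \<in> ball y0 \<rho>"
      using \<delta>(2)[of s] s by (auto simp: dist_real_def)
    let ?h = "\<lambda>z. (1 / (s - t)) *\<^sub>R (z - y0)"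
    define W where "W = ball y0 \<rho> \<inter> ?h -` ball w0 \<rho>"
    have "open W" unfolding W_def
      by (intro open_Int open_ball open_vimage continuous_intros)
    then have 1: "open {m \<in> snd c. fst c m \<in> W}" by (rule open_coord_preimage[OF c(1)])
    have 2: "\<gamma> s \<in> {m \<in> snd c. fst c m \<in> W}" using sd by (simp add: W_def)
    have 3: "reach (timelike_vec G T fut) U (\<gamma> t) m" if m: "m \<in> {m \<in> snd c. fst c m \<in> W}" for m
    proof -
      have "reach (timelike_vec G T fut) U (coord_inv c y0) (coord_inv c (fst c m))"
        using m s \<rho>(1) by (intro \<rho>(3)[of _ _ "s - t"]) (auto simp: W_def)
      then show ?thesis using m c by (simp add: y0_def)
    qed
    show "\<exists>W. open W \<and> \<gamma> s \<in> W \<and> (\<forall>m\<in>W. reach (timelike_vec G T fut) U (\<gamma> t) m)"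
      using 1 2 3 by (intro exI[of _ "{m \<in> snd c. fst c m \<in> W}"] conjI ballI)
  qed
qed

section \<open>Cylindrical charts of uniform size\<close>

text \<open>Restricting a chart and composing it with an affine isomorphism keeps it compatible with
  every chart of \<open>A\<close>, so maximality puts it into \<open>A\<close>. The transition back
  to \<open>d\<close> has derivative \<open>L\<close>, whence the formula for the metric.\<close>

lemma affine_chart:
  fixes L :: "real \<times> 'v \<Rightarrow> real \<times> 'v" and y0 :: "real \<times> 'v"
  assumes d: "d \<in> A" and U: "open U" "U \<subseteq> snd d" and L: "linear L" "bij L"
  defines "c \<equiv> (\<lambda>m. inv L (fst d m - y0), U)"
  shows "c \<in> A" "\<And>m u w. m \<in> U \<Longrightarrow> G c (fst c m) u w = G d (fst d m) (L u) (L w)"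
proof -
  have injL: "inj L" and surjL: "surj L" using L(2) by (auto simp: bij_def)
  have linM: "linear (inv L)" by (rule inj_linear_imp_inv_linear[OF L(1) injL])
  have blL: "bounded_linear L" and blM: "bounded_linear (inv L)"
    using L(1) linM by (simp_all add: linear_conv_bounded_linear)
  have LM: "L (inv L y) = y" for y using surjL by (simp add: surj_f_inv_f)
  have inv_L: "inv L (L y) = y" for y using injL by simp
  have c: "snd c = U" "fst c m = inv L (fst d m - y0)" for m by (simp_all add: c_def)
  have dm: "y0 + L (fst c m) = fst d m" for m by (simp add: c LM)
  have inj: "inj_on (fst c) U"
  proof (rule inj_onI)
    fix m m' assume m: "m \<in> U" "m' \<in> U" "fst c m = fst c m'"
    then have "fst d m = fst d m'" using dm[of m] dm[of m'] by simp
    then show "m = m'" using m U(2) inj_onD[OF chart_inj[OF d]] by blast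
  qed
  have inv_c: "inv_into U (fst c) (fst c m) = m" if "m \<in> U" for m using inj that by simp
  have img: "fst c ` S = (\<lambda>z. y0 + L z) -` (fst d ` S)" if "S \<subseteq> U" for S
  proof
    show "fst c ` S \<subseteq> (\<lambda>z. y0 + L z) -` (fst d ` S)" using dm by auto
    show "(\<lambda>z. y0 + L z) -` (fst d ` S) \<subseteq> fst c ` S"
    proof
      fix z assume "z \<in> (\<lambda>z. y0 + L z) -` (fst d ` S)"
      then obtain m where m: "m \<in> S" "y0 + L z = fst d m" by auto
      have "fst c m = inv L (L z)" unfolding c m(2)[symmetric] by simp
      then have "z = fst c m" by (simp add: inv_L)
      then show "z \<in> fst c ` S" using m(1) by blast
    qed
  qed
  have contaff: "continuous_on X (\<lambda>z. y0 + L z)" for X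
    by (intro continuous_intros linear_continuous_on blL)
  have opimg: "open (fst c ` S)" if "open S" "S \<subseteq> U" for S
  proof -
    have "fst d ` S = fst d ` (snd d \<inter> S)" using that U by (metis inf.absorb_iff2 order_trans)
    then have "open (fst d ` S)" using open_coord_image[OF d that(1)] by simp
    then show ?thesis unfolding img[OF that(2)] by (intro open_vimage contaff)
  qed
  have chart: "is_chart c"
  proof -
    have op: "open (fst c ` U)" by (rule opimg[OF U(1) order_refl])
    have cinv: "coord_inv d (y0 + L (fst c m)) = m" if "m \<in> U" for m
      using that U d by (simp add: dm subset_iff)
    have "homeomorphism U (fst c ` U) (fst c) (\<lambda>z. coord_inv d (y0 + L z))"
    proof (rule homeomorphismI)
      have "continuous_on U (\<lambda>m. inv L (fst d m - y0))"
        by (intro continuous_on_compose2[OF linear_continuous_on[OF blM, of UNIV]] continuous_intros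
            continuous_on_subset[OF chart_continuous[OF d] U(2)]) auto
      then show "continuous_on U (fst c)" by (simp add: c_def)
      show "continuous_on (fst c ` U) (\<lambda>z. coord_inv d (y0 + L z))"
        by (rule continuous_on_compose2[OF coord_inv_continuous[OF d] contaff]) (use dm U in auto)
      show "(\<lambda>z. coord_inv d (y0 + L z)) ` fst c ` U \<subseteq> U" using cinv by auto
    qed (use cinv in auto)
    then show ?thesis unfolding is_chart_def c(1) using U(1) op by blast
  qed
  have tr1: "transition c e z = transition d e (y0 + L z)" if ze: "z \<in> fst c ` (U \<inter> snd e)" for e z
  proof -
    obtain m where m: "m \<in> U" "z = fst c m" using ze by blast
    have "transition c e z = fst e m" using m by (simp add: transition_def c(1) inv_c)
    also have "\<dots> = transition d e (fst d m)" using m U d by (subst transition_eq) auto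
    finally show ?thesis by (simp add: m dm)
  qed
  have tr2: "transition e c y = inv L (transition e d y) + (- inv L y0)" if e: "e \<in> A" and ye: "y \<in> fst e ` (U \<inter> snd e)" for e y
  proof -
    obtain m where m: "m \<in> U" "m \<in> snd e" "y = fst e m" using ye by blast
    have "transition e c y = inv L (fst d m - y0)" using m e by (simp add: transition_eq c_def)
    also have "\<dots> = inv L (transition e d y) + (- inv L y0)"
      using m e by (simp add: transition_eq linear_diff[OF linM])
    finally show ?thesis .
  qed
  have compat: "smoothly_compatible c e" if e: "e \<in> A" for e
    unfolding smoothly_compatible_def c(1)
  proof
    have o: "open (U \<inter> snd e)" using U(1) chart_open[OF e] by blast
    have "Cinf_on (fst c ` (U \<inter> snd e)) (\<lambda>z. transition d e (y0 + L z))"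
    proof (rule Cinf_on_compose_affine[OF transition_Cinf[OF d e] blL])
      show "open (fst c ` (U \<inter> snd e))" by (rule opimg[OF o]) simp
      show "y0 + L z \<in> fst d ` (snd d \<inter> snd e)" if "z \<in> fst c ` (U \<inter> snd e)" for z
        using that dm U by auto
    qed
    then show "Cinf_on (fst c ` (U \<inter> snd e)) (transition c e)"
      by (rule Cinf_on_cong) (simp add: tr1)
    have "Cinf_on (fst e ` (U \<inter> snd e)) (transition e d)"
    proof (rule Cinf_on_subset[OF transition_Cinf[OF e d]])
      have "U \<inter> snd e = snd e \<inter> U" by blast
      then show "open (fst e ` (U \<inter> snd e))" using open_coord_image[OF e U(1)] by simp
      show "fst e ` (U \<inter> snd e) \<subseteq> fst e ` (snd e \<inter> snd d)" using U by blast
    qed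
    then have "Cinf_on (fst e ` (U \<inter> snd e)) (\<lambda>y. inv L (transition e d y) + (- inv L y0))"
      by (rule Cinf_on_linear_compose[OF _ blM])
    then show "Cinf_on (fst e ` (U \<inter> snd e)) (transition e c)"
      by (rule Cinf_on_cong) (simp add: tr2[OF e])
  qed
  show cA: "c \<in> A" using atlas chart compat unfolding smooth_atlas_def by blast
  fix m u w assume m: "m \<in> U"
  have "m \<in> snd d" using m U by blast
  have "((\<lambda>z. y0 + L z) has_derivative L) (at (fst c m))"
    using bounded_linear_imp_has_derivative[OF blL] by (auto intro!: derivative_eq_intros)
  then have "(transition c d has_derivative L) (at (fst c m))"
  proof (rule has_derivative_transform_within_open)
    show "open (fst c ` U)" by (rule opimg[OF U(1) order_refl])
    show "fst c m \<in> fst c ` U" using m by blast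
    fix z assume "z \<in> fst c ` U"
    then obtain m' where m': "m' \<in> U" "z = fst c m'" by blast
    then show "y0 + L z = transition c d z" using cA by (simp add: dm transition_eq c(1))
  qed
  then have "transition_deriv c d m = L"
    unfolding transition_deriv_def by (rule frechet_derivative_at[symmetric])
  then show "G c (fst c m) u w = G d (fst d m) (L u) (L w)"
    using metric_transform[OF cA d] m \<open>m \<in> snd d\<close> by (simp add: c(1))
qed

text \<open>There are only finitely many coefficients: a tolerance of \<open>e\<close> divided by
  the number of pairs of basis vectors for each of them adds up to \<open>e\<close>, uniformly in
  \<open>u\<close> and \<open>w\<close>.\<close>

lemma metric_equicontinuous:
  assumes d: "d \<in> A" and y0: "y0 \<in> fst d ` snd d" and e: "e > 0"
  shows "\<forall>\<^sub>F y in nhds y0. \<forall>u w. \<bar>G d y u w - G d y0 u w\<bar> \<le> e * norm u * norm w"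
proof -
  let ?B = "Basis :: (real \<times> 'v) set"
  define n where "n = real (card ?B)"
  define \<delta> where "\<delta> = e / (n * n)"
  have cb: "n > 0" by (simp add: n_def card_gt_0_iff)
  have \<delta>: "\<delta> > 0" using e cb by (simp add: \<delta>_def)
  have o: "open (fst d ` snd d)" by (rule chart_image_open[OF d])
  have "\<forall>\<^sub>F y in nhds y0. \<forall>i\<in>?B. \<forall>j\<in>?B. \<bar>G d y i j - G d y0 i j\<bar> < \<delta>"
  proof (intro eventually_ball_finite finite_Basis ballI)
    fix i j assume "i \<in> ?B" "j \<in> ?B"
    have "isCont (\<lambda>y. G d y i j) y0"
      using metric_continuous[OF d, of i j] y0 continuous_on_eq_continuous_at[OF o] by blast
    then have "((\<lambda>y. G d y i j) \<longlongrightarrow> G d y0 i j) (nhds y0)"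
      using tendsto_at_iff_tendsto_nhds[of "\<lambda>y. G d y i j" y0] by (simp add: isCont_def)
    then show "\<forall>\<^sub>F y in nhds y0. \<bar>G d y i j - G d y0 i j\<bar> < \<delta>"
      using \<delta> unfolding tendsto_iff dist_real_def by blast
  qed
  moreover have "\<forall>\<^sub>F y in nhds y0. y \<in> fst d ` snd d" using o y0 by (rule eventually_nhds_in_open)
  ultimately show ?thesis
  proof eventually_elim
    case (elim y)
    show ?case
    proof (intro allI)
      fix u w :: "real \<times> 'v"
      have ex: "G d z u w = (\<Sum>(i,j)\<in>?B \<times> ?B. (u \<bullet> i) * ((w \<bullet> j) * G d z i j))" if "z \<in> fst d ` snd d" for z
      proof -
        have bil: "bilinear (G d z)" using that by (rule metric_bilinear[OF d])
        have "G d z u w = G d z (\<Sum>i\<in>?B. (u \<bullet> i) *\<^sub>R i) (\<Sum>j\<in>?B. (w \<bullet> j) *\<^sub>R j)"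
          by (simp only: euclidean_representation)
        also have "\<dots> = (\<Sum>(i,j)\<in>?B \<times> ?B. G d z ((u \<bullet> i) *\<^sub>R i) ((w \<bullet> j) *\<^sub>R j))"
          by (rule bilinear_sum[OF bil])
        finally show ?thesis by (simp add: bilinear_lmul[OF bil] bilinear_rmul[OF bil] mult.left_commute)
      qed
      have "G d y u w - G d y0 u w = (\<Sum>(i,j)\<in>?B \<times> ?B. (u \<bullet> i) * ((w \<bullet> j) * (G d y i j - G d y0 i j)))"
        unfolding ex[OF elim(2)] ex[OF y0] sum_subtractf[symmetric]
        by (rule sum.cong) (auto simp: algebra_simps)
      then have "\<bar>G d y u w - G d y0 u w\<bar> \<le> (\<Sum>(i,j)\<in>?B \<times> ?B. \<bar>(u \<bullet> i) * ((w \<bullet> j) * (G d y i j - G d y0 i j))\<bar>)"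
        by (simp add: case_prod_unfold sum_abs)
      also have "\<dots> \<le> (\<Sum>(i,j)\<in>?B \<times> ?B. norm u * (norm w * \<delta>))"
      proof (rule sum_mono, clarify)
        fix i j assume ij: "i \<in> ?B" "j \<in> ?B"
        have "\<bar>u \<bullet> i\<bar> * (\<bar>w \<bullet> j\<bar> * \<bar>G d y i j - G d y0 i j\<bar>) \<le> norm u * (norm w * \<delta>)"
          using elim(1) ij \<delta> by (intro mult_mono) (auto simp: Basis_le_norm less_imp_le)
        then show "\<bar>(u \<bullet> i) * ((w \<bullet> j) * (G d y i j - G d y0 i j))\<bar> \<le> norm u * (norm w * \<delta>)"
          by (simp add: abs_mult)
      qed
      also have "\<dots> = (n * n) * (norm u * (norm w * \<delta>))"
        by (simp only: case_prod_unfold sum_constant n_def card_cartesian_product of_nat_mult)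
      also have "\<dots> = e * norm u * norm w"
        using cb by (simp add: \<delta>_def)
      finally show "\<bar>G d y u w - G d y0 u w\<bar> \<le> e * norm u * norm w" .
    qed
  qed
qed

text \<open>The bound on the Lorentz frames is what makes the size uniform: frames at nearby points could
  otherwise be arbitrarily strongly boosted.\<close>

lemma uniform_cylindrical_charts:
  assumes N: "open N" "m0 \<in> N"
  obtains W where "open W" "m0 \<in> W"
    "\<And>m. m \<in> W \<Longrightarrow> \<exists>c. cylindrical_chart A G c m \<and> W \<subseteq> snd c \<and> snd c \<subseteq> N"
proof -
  obtain d where d: "d \<in> A" "m0 \<in> snd d" by (rule obtain_chart)
  define y0 where "y0 = fst d m0"
  have y0: "y0 \<in> fst d ` snd d" "y0 \<in> fst d ` (snd d \<inter> N)" using d N by (auto simp: y0_def)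
  obtain L0 :: "real \<times> 'v \<Rightarrow> real \<times> 'v" where L0: "linear L0" "bij L0" "\<And>u w. G d y0 (L0 u) (L0 w) = eta 1 u w"
    using metric_lorentzian[OF d(1) y0(1)] unfolding lorentzian_form_def by blast
  define M0 where "M0 = inv L0"
  have M0: "linear M0" "\<And>u. M0 (L0 u) = u"
    using L0(1,2) unfolding M0_def by (simp_all add: inj_linear_imp_inv_linear bij_is_inj)
  obtain K where K: "K > 0" "\<And>u. norm (L0 u) \<le> K * norm u" using linear_bounded_pos[OF L0(1)] by blast
  obtain K' where K': "K' > 0" "\<And>u. norm (M0 u) \<le> K' * norm u" using linear_bounded_pos[OF M0(1)] by blast
  \<comment> \<open>In the frame \<open>L0\<close> this gives deviation 1/800 from
    \<open>eta 1\<close>. The later frame \<open>L1\<close> multiplies squared norms by at most 100,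
    so a deviation counted twice becomes 2 * 100 / 800 = 1/4, the tolerance under which the cones of
    \<open>eta (1 / 2)\<close> and \<open>eta 2\<close> enclose that of the metric.\<close>
  define e where "e = 1 / (800 * K\<^sup>2)"
  have e: "e > 0" using K by (simp add: e_def)
  have "\<forall>\<^sub>F y in nhds y0. y \<in> fst d ` (snd d \<inter> N)"
    using open_coord_image[OF d(1) N(1)] y0(2) by (rule eventually_nhds_in_open)
  then have "\<forall>\<^sub>F y in nhds y0. y \<in> fst d ` (snd d \<inter> N) \<and> (\<forall>u w. \<bar>G d y u w - G d y0 u w\<bar> \<le> e * norm u * norm w)"
    using metric_equicontinuous[OF d(1) y0(1) e] by eventually_elim blast
  then obtain \<rho> where \<rho>: "\<rho> > 0" "\<And>y. dist y y0 < \<rho> \<Longrightarrow> y \<in> fst d ` (snd d \<inter> N)"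
    "\<And>y u w. dist y y0 < \<rho> \<Longrightarrow> \<bar>G d y u w - G d y0 u w\<bar> \<le> e * norm u * norm w"
    unfolding eventually_nhds_metric by blast
  have near: "\<bar>G d y (L0 u) (L0 w) - eta 1 u w\<bar> \<le> norm u * norm w / 800" if y: "dist y y0 < \<rho>" for y u w
  proof -
    have "\<bar>G d y (L0 u) (L0 w) - eta 1 u w\<bar> \<le> e * norm (L0 u) * norm (L0 w)"
      using \<rho>(3)[OF y, of "L0 u" "L0 w"] by (simp add: L0(3))
    also have "\<dots> \<le> e * (K * norm u) * (K * norm w)"
      using e K by (intro mult_mono) auto
    also have "\<dots> = norm u * norm w / 800" using K(1) by (simp add: e_def power2_eq_square)
    finally show ?thesis .
  qed
  \<comment> \<open>\<open>s\<close> is the half-width of the coordinate box. Its points have norm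
    below \<open>2 * s\<close>, and frames of norm at most \<open>10 * K\<close> send them within
    \<open>\<rho> / 4\<close> of the centre.\<close>
  define s where "s = \<rho> / (80 * K)"
  \<comment> \<open>Points of \<open>W\<close> are less than \<open>2 * r0\<close> apart in
    \<open>d\<close>. The inverse frame stretches by at most \<open>20 * K'\<close>, so
    \<open>W\<close> fits into the box around each of its points.\<close>
  define r0 where "r0 = min (\<rho> / 4) (s / (80 * K'))"
  have s: "s > 0" using \<rho>(1) K(1) by (simp add: s_def)
  have r0: "r0 > 0" using \<rho>(1) s K'(1) by (simp add: r0_def)
  define W where "W = {m \<in> snd d. fst d m \<in> ball y0 r0}"
  show ?thesis
  proof (rule that)
    show "open W" unfolding W_def by (rule open_coord_preimage[OF d(1) open_ball])
    show "m0 \<in> W" using d r0 by (simp add: W_def y0_def)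
    fix m assume m: "m \<in> W"
    define y where "y = fst d m"
    have yr: "dist y y0 < r0" using m by (simp add: W_def y_def dist_commute)
    then have y\<rho>: "dist y y0 < \<rho> / 4" by (simp add: r0_def)
    have yimg: "y \<in> fst d ` snd d" using m by (auto simp: W_def y_def)
    let ?B = "\<lambda>u w. G d y (L0 u) (L0 w)"
    have "lorentzian_form ?B"
    proof -
      obtain L :: "real \<times> 'v \<Rightarrow> real \<times> 'v" where L: "linear L" "bij L" "\<And>u w. G d y (L u) (L w) = eta 1 u w"
        using metric_lorentzian[OF d(1) yimg] unfolding lorentzian_form_def by blast
      have "linear (M0 \<circ> L)" by (rule linear_compose[OF L(1) M0(1)])
      moreover have "bij (M0 \<circ> L)" unfolding M0_def by (rule bij_comp[OF L(2) bij_imp_bij_inv[OF L0(2)]])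
      moreover have "L0 (M0 u) = u" for u unfolding M0_def using L0(2) by (simp add: bij_is_surj surj_f_inv_f)
      then have "\<forall>u w. ?B ((M0 \<circ> L) u) ((M0 \<circ> L) w) = eta 1 u w" by (simp add: L(3))
      ultimately show ?thesis unfolding lorentzian_form_def by blast
    qed
    moreover have "\<bar>?B u w - eta 1 u w\<bar> \<le> norm u * norm w / 10" for u w
      using near[of y u w] y\<rho> \<rho>(1) mult_nonneg_nonneg[OF norm_ge_zero[of u] norm_ge_zero[of w]] by linarith
    ultimately obtain L1 :: "real \<times> 'v \<Rightarrow> real \<times> 'v" where L1: "linear L1" "bij L1" "\<And>u w. ?B (L1 u) (L1 w) = eta 1 u w"
      "\<And>u. norm (L1 u) \<le> 10 * norm u" "\<And>u. norm u \<le> 20 * norm (L1 u)"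
      using lorentzian_form_near_eta_frame[of ?B] by metis
    define L where "L = L0 \<circ> L1"
    have L: "linear L" "bij L" unfolding L_def
      by (rule linear_compose[OF L1(1) L0(1)], rule bij_comp[OF L1(2) L0(2)])
    have Lup: "norm (L u) \<le> 10 * K * norm u" for u
    proof -
      have "norm (L u) \<le> K * norm (L1 u)" unfolding L_def using K(2) by simp
      also have "\<dots> \<le> K * (10 * norm u)" using K(1) L1(4) by simp
      finally show ?thesis by simp
    qed
    have Ldown: "norm u \<le> 20 * K' * norm (L u)" for u
    proof -
      have "norm (L1 u) = norm (M0 (L u))" by (simp add: L_def M0(2))
      also have "\<dots> \<le> K' * norm (L u)" by (rule K'(2))
      finally show ?thesis using L1(5)[of u] by simp
    qed
    have LM: "L (inv L u) = u" "inv L (L u) = u" for u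
      using L(2) by (simp_all add: bij_is_surj surj_f_inv_f bij_is_inj)
    define box where "box = {- s<..<s} \<times> ball (0::'v) s"
    have box_norm: "norm z < 2 * s" if "z \<in> box" for z
      using that norm_Pair_le[of "fst z" "snd z"] by (auto simp: box_def abs_less_iff)
    have box_dist: "dist (y + L z) y0 < \<rho> / 2" if "z \<in> box" for z
    proof -
      have "norm (L z) \<le> 10 * K * (2 * s)" using Lup[of z] box_norm[OF that] K(1)
        by (smt (verit) mult_left_mono mult_pos_pos)
      also have "\<dots> = \<rho> / 4" using K(1) by (simp add: s_def)
      finally show ?thesis using y\<rho> norm_triangle_ineq[of "y - y0" "L z"] by (simp add: dist_norm algebra_simps)
    qed
    define U where "U = {m \<in> snd d. fst d m \<in> (\<lambda>y'. inv L (y' - y)) -` box}"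
    have "bounded_linear (inv L)"
      using inj_linear_imp_inv_linear[OF L(1) bij_is_inj[OF L(2)]] by (simp add: linear_conv_bounded_linear)
    then have "open ((\<lambda>y'. inv L (y' - y)) -` box)"
      unfolding box_def
      by (intro open_vimage open_Times open_ball continuous_on_compose2[OF linear_continuous_on[of "inv L" UNIV]] continuous_intros) auto
    then have "open U" unfolding U_def by (rule open_coord_preimage[OF d(1)])
    moreover have "U \<subseteq> snd d" unfolding U_def by blast
    ultimately have U: "open U" "U \<subseteq> snd d" by blast+
    define c where "c = (\<lambda>m. inv L (fst d m - y), U)"
    have cA: "c \<in> A" and Gc: "\<And>m u w. m \<in> U \<Longrightarrow> G c (fst c m) u w = G d (fst d m) (L u) (L w)"
      using affine_chart[OF d(1) U L, where ?y0.0 = y] unfolding c_def by auto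
    have dist_U: "dist (fst d m') y0 < \<rho> / 2" if "m' \<in> U" for m'
      using box_dist[of "inv L (fst d m' - y)"] that by (simp add: U_def LM)
    have WU: "W \<subseteq> U"
    proof
      fix m' assume m': "m' \<in> W"
      have "dist (fst d m') y < 2 * r0"
        using m' yr dist_triangle2[of "fst d m'" y y0] by (simp add: W_def dist_commute)
      then have "20 * K' * norm (fst d m' - y) \<le> 20 * K' * (2 * r0)"
        using K'(1) by (intro mult_left_mono) (auto simp: dist_norm)
      then have "norm (inv L (fst d m' - y)) \<le> 20 * K' * (2 * r0)"
        using Ldown[of "inv L (fst d m' - y)"] unfolding LM(1) by (rule order_trans[rotated])
      also have "\<dots> \<le> s / 2" using K'(1) by (simp add: r0_def min_def field_simps)
      finally have n: "norm (inv L (fst d m' - y)) < s" using s by linarith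
      have "inv L (fst d m' - y) \<in> box"
        using n norm_fst_le[of "fst (inv L (fst d m' - y))" "snd (inv L (fst d m' - y))"]
          norm_snd_le[of "snd (inv L (fst d m' - y))" "fst (inv L (fst d m' - y))"]
        by (auto simp: box_def mem_Times_iff)
      then show "m' \<in> U" using m' by (simp add: U_def W_def)
    qed
    have UN: "U \<subseteq> N"
    proof
      fix m' assume m': "m' \<in> U"
      have "fst d m' \<in> fst d ` (snd d \<inter> N)" using dist_U[OF m'] \<rho>(1) by (intro \<rho>(2)) auto
      then obtain n where n: "n \<in> snd d" "n \<in> N" "fst d m' = fst d n" by blast
      then have "m' = n" using m' U(2) inj_onD[OF chart_inj[OF d(1)]] by blast
      then show "m' \<in> N" using n by simp
    qed
    have img: "fst c ` U = box"
    proof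
      show "fst c ` U \<subseteq> box" by (auto simp: c_def U_def)
      show "box \<subseteq> fst c ` U"
      proof
        fix z assume z: "z \<in> box"
        have "y + L z \<in> fst d ` (snd d \<inter> N)" using box_dist[OF z] \<rho>(1) by (intro \<rho>(2)) auto
        then obtain n where n: "n \<in> snd d" "y + L z = fst d n" by blast
        have zn: "inv L (fst d n - y) = z" unfolding n(2)[symmetric] by (simp add: LM)
        then have "n \<in> U" using n z by (simp add: U_def)
        then show "z \<in> fst c ` U" using zn by (force simp: c_def)
      qed
    qed
    have "cylindrical_chart A G c m"
      unfolding cylindrical_chart_def
    proof (intro conjI cA)
      have linM: "linear (inv L)" by (rule inj_linear_imp_inv_linear[OF L(1) bij_is_inj[OF L(2)]])
      show mc: "m \<in> snd c" using m WU by (auto simp: c_def)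
      show c0: "fst c m = 0" by (simp add: c_def y_def linear_0[OF linM])
      \<comment> \<open>In a Hausdorff space this compact set is closed, so it also contains the
        closure of \<open>U\<close>.\<close>
      have "compact (coord_inv d ` cball y0 (\<rho> / 2))"
      proof (rule compact_continuous_image[OF continuous_on_subset[OF coord_inv_continuous[OF d(1)]]])
        show "cball y0 (\<rho> / 2) \<subseteq> fst d ` snd d"
        proof
          fix y' assume "y' \<in> cball y0 (\<rho> / 2)"
          then show "y' \<in> fst d ` snd d" using \<rho>(1) \<rho>(2)[of y'] by (auto simp: dist_commute)
        qed
      qed simp
      moreover have "U \<subseteq> coord_inv d ` cball y0 (\<rho> / 2)"
      proof
        fix m' assume m': "m' \<in> U"
        have "m' = coord_inv d (fst d m')" using m' U d by auto
        then show "m' \<in> coord_inv d ` cball y0 (\<rho> / 2)" using dist_U[OF m'] by (auto simp: dist_commute)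
      qed
      ultimately have "compact (closure U)"
        by (metis closure_minimal compact_imp_closed closed_closure compact_Int_closed inf.absorb2)
      then show "compact (closure (snd c))" by (simp add: c_def)
      show "\<exists>L V. fst c ` snd c = L \<times> V \<and> is_interval L \<and> (0::real) \<in> L \<and> open V \<and> 0 \<in> V"
        using img s by (intro exI[of _ "{- s<..<s}"] exI[of _ "ball 0 s"]) (simp add: c_def box_def is_interval_oo)
      show "G c 0 = eta 1"
      proof (intro ext)
        fix u w
        have "G c 0 u w = G d y (L u) (L w)" using Gc[of m u w] mc c0 by (simp add: c_def y_def)
        then show "G c 0 u w = eta 1 u w" by (simp add: L_def L1(3))
      qed
      have "cone_prec (eta (1 / 2)) (G c z) \<and> cone_prec (G c z) (eta 2)" if z: "z \<in> fst c ` snd c" for z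
      proof -
        obtain m' where m': "m' \<in> U" "z = fst c m'" using z by (auto simp: c_def)
        have "\<bar>G c z u u - eta 1 u u\<bar> \<le> (norm u)\<^sup>2 / 4" for u
        proof -
          have G1: "G c z u u = G d (fst d m') (L0 (L1 u)) (L0 (L1 u))" using Gc[OF m'(1)] m'(2) by (simp add: L_def)
          have 1: "\<bar>G c z u u - eta 1 (L1 u) (L1 u)\<bar> \<le> norm (L1 u) * norm (L1 u) / 800"
            unfolding G1 using dist_U[OF m'(1)] \<rho>(1) by (intro near) auto
          \<comment> \<open>\<open>L1\<close> is an exact frame at the centre, where the form takes
            the value \<open>eta 1 u u\<close>. Both this value and the one at \<open>z\<close> are
            compared with \<open>eta 1 (L1 u) (L1 u)\<close>.\<close>
          have 2: "\<bar>eta 1 u u - eta 1 (L1 u) (L1 u)\<bar> \<le> norm (L1 u) * norm (L1 u) / 800"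
            using near[of y "L1 u" "L1 u"] y\<rho> \<rho>(1) by (simp add: L1(3))
          have "norm (L1 u) * norm (L1 u) \<le> (10 * norm u) * (10 * norm u)"
            by (intro mult_mono L1(4)) auto
          then have 3: "norm (L1 u) * norm (L1 u) \<le> 100 * (norm u)\<^sup>2" by (simp add: power2_eq_square)
          show ?thesis using 1 2 3 by argo
        qed
        then show ?thesis using cone_prec_near_eta[of "G c z"] by blast
      qed
      then show "\<exists>C>1. \<forall>z\<in>fst c ` snd c. cone_prec (eta (1 / C)) (G c z) \<and> cone_prec (G c z) (eta C)"
        by (intro exI[of _ 2]) simp
    qed
    then show "\<exists>c. cylindrical_chart A G c m \<and> W \<subseteq> snd c \<and> snd c \<subseteq> N"
      using WU UN by (intro exI[of _ c]) (simp add: c_def)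
  qed
qed

section \<open>Causal curves in cylindrical charts\<close>

text \<open>Tells whether causal vectors of direction \<open>fut\<close> have increasing or
  decreasing time coordinate. Where the cone bounds hold, \<open>T\<close> has nonzero time
  component and the value is 1 or - 1.\<close>

definition time_sign :: "('m, 'v) chart \<Rightarrow> bool \<Rightarrow> real \<times> 'v \<Rightarrow> real" where
  "time_sign c fut y = (if fut then 1 else - 1) * sgn (fst (T c y))"

definition cone_chart :: "('m, 'v) chart \<Rightarrow> real \<Rightarrow> bool" where
  "cone_chart c C \<longleftrightarrow> c \<in> A \<and> C > 1 \<and> (\<forall>y\<in>fst c ` snd c. cone_prec (eta (1 / C)) (G c y) \<and> cone_prec (G c y) (eta C))"

lemma cylindrical_cone_chart:
  assumes "cylindrical_chart A G c p"
  obtains C where "cone_chart c C"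
  using assms unfolding cylindrical_chart_def cone_chart_def by blast

lemma orientation_fst_nonzero:
  assumes "cone_chart c C" "y \<in> fst c ` snd c"
  shows "fst (T c y) \<noteq> 0"
proof -
  have c: "c \<in> A" "cone_prec (G c y) (eta C)" "C > 1" using assms by (auto simp: cone_chart_def)
  have T: "G c y (T c y) (T c y) < 0" by (rule orientation_timelike[OF c(1) assms(2)])
  then have "T c y \<noteq> 0"
    using bilinear_lzero[OF metric_bilinear[OF c(1) assms(2)], of "T c y"] by force
  then show ?thesis
    using cone_prec_eta_fst_nonzero[OF c(2), of "T c y"] T by (auto simp: not_less)
qed

lemma directed_iff_time_sign:
  assumes c: "cone_chart c C" and y: "y \<in> fst c ` snd c" and v: "v \<noteq> 0" "G c y v v \<le> 0"
  shows "directed G T fut c y v \<longleftrightarrow> 0 < time_sign c fut y * fst v"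
proof -
  have c': "c \<in> A" "cone_prec (G c y) (eta C)" using c y by (auto simp: cone_chart_def)
  note iff = cone_prec_eta_directed_iff[OF metric_lorentzian[OF c'(1) y] c'(2) v orientation_timelike[OF c'(1) y]]
  show ?thesis unfolding directed_def iff time_sign_def
    by (auto simp: sgn_if zero_less_mult_iff mult_less_0_iff)
qed

text \<open>The outer cone bounds the squared slope by \<open>C\<close>; since \<open>C > 1\<close>,
  the slope itself is at most \<open>C\<close>, which avoids square roots.\<close>

lemma causal_vec_bounds:
  assumes c: "cone_chart c C" and y: "y \<in> fst c ` snd c" and v: "causal_vec G T fut c y v"
  shows "0 < time_sign c fut y * fst v" "norm (snd v) \<le> C * (time_sign c fut y * fst v)"
proof -
  have c': "c \<in> A" "cone_prec (G c y) (eta C)" "C > 1" using c y by (auto simp: cone_chart_def)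
  have v': "v \<noteq> 0" "G c y v v \<le> 0" "directed G T fut c y v" using v by (auto simp: causal_vec_def)
  show pos: "0 < time_sign c fut y * fst v"
    using directed_iff_time_sign[OF c y v'(1,2)] v'(3) by blast
  have "\<bar>time_sign c fut y\<bar> = 1"
    using orientation_fst_nonzero[OF c y] by (simp add: time_sign_def abs_mult abs_sgn_eq)
  then have eq: "time_sign c fut y * fst v = \<bar>fst v\<bar>" using pos by (metis abs_mult abs_of_pos mult_1)
  have "(norm (snd v))\<^sup>2 \<le> C * (fst v)\<^sup>2"
    using cone_prec_eta_fst_nonzero[OF c'(2) v'(1,2)] by simp
  also have "\<dots> \<le> C * (C * (fst v)\<^sup>2)"
    using c'(3) by (intro mult_left_mono) (auto simp: mult_le_cancel_right1)
  also have "\<dots> = (C * \<bar>fst v\<bar>)\<^sup>2" by (simp add: power2_eq_square)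
  finally show "norm (snd v) \<le> C * (time_sign c fut y * fst v)"
    unfolding eq using c'(3) by (intro power2_le_imp_le[of "norm (snd v)"]) auto
qed

text \<open>Vertical vectors lie in the inner cone \<open>eta (1 / C)\<close>, so the coordinate
  lines of \<open>t\<close> are timelike throughout the chart.\<close>

lemma time_direction_timelike:
  assumes c: "cone_chart c C" and y: "y \<in> fst c ` snd c" and r: "0 < time_sign c fut y * r"
  shows "timelike_vec G T fut c y (r, 0)"
proof -
  have c': "cone_prec (eta (1 / C)) (G c y)" "C > 1" using c y by (auto simp: cone_chart_def)
  have r0: "(r, 0 :: 'v) \<noteq> 0" using r by (auto simp: zero_prod_def)
  have "eta (1 / C) (r, 0 :: 'v) (r, 0) \<le> 0" using c'(2) by (simp add: eta_def)
  then have neg: "G c y (r, 0) (r, 0) < 0" using c'(1) r0 unfolding cone_prec_def by blast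
  then show ?thesis
    using directed_iff_time_sign[OF c y r0] r by (simp add: timelike_vec_def)
qed

text \<open>The time component of \<open>T\<close> is continuous and never zero. The claim is
  restricted to connected sets because the factor \<open>V\<close> of a cylindrical chart may be
  disconnected.\<close>

lemma time_sign_constant:
  assumes c: "cone_chart c C" and S: "connected S" "S \<subseteq> fst c ` snd c"
    and y: "y \<in> S" "y' \<in> S"
  shows "time_sign c fut y = time_sign c fut y'"
proof -
  let ?h = "\<lambda>y. fst (T c y)"
  have cA: "c \<in> A" using c by (simp add: cone_chart_def)
  have "continuous_on S ?h"
    by (intro continuous_intros continuous_on_subset[OF orientation_continuous[OF cA] S(2)])
  then have con: "connected (?h ` S)" using S(1) by (rule connected_continuous_image)
  have nz: "0 \<notin> ?h ` S"
  proof
    assume "0 \<in> ?h ` S"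
    then obtain z where "z \<in> S" "?h z = 0" by (metis imageE)
    then show False using orientation_fst_nonzero[OF c] S(2) by blast
  qed
  have aux: "\<not> (?h z < 0 \<and> 0 < ?h z')" if "z \<in> S" "z' \<in> S" for z z'
  proof
    assume *: "?h z < 0 \<and> 0 < ?h z'"
    have "{?h z..?h z'} \<subseteq> ?h ` S" using that by (intro connected_contains_Icc[OF con]) auto
    then show False using * nz by (meson atLeastAtMost_iff less_imp_le subsetD)
  qed
  have "?h y \<noteq> 0" "?h y' \<noteq> 0" using nz y by (metis imageI)+
  then have "sgn (?h y) = sgn (?h y')" using aux[OF y] aux[OF y(2,1)] by (auto simp: sgn_if)
  then show ?thesis by (simp add: time_sign_def)
qed

lemma causal_vec_scale:
  assumes "causal_vec G T fut c y v" "c \<in> A" "y \<in> fst c ` snd c" "r > 0"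
  shows "causal_vec G T fut c y (r *\<^sub>R v)"
proof -
  note bil = metric_bilinear[OF assms(2,3)]
  have "r * (r * G c y v v) \<le> 0" using assms(1,4) by (simp add: causal_vec_def mult_nonneg_nonpos)
  moreover have "directed G T fut c y (r *\<^sub>R v)"
    using assms(1,4) by (simp add: causal_vec_def directed_def bilinear_lmul[OF bil] mult_less_0_iff zero_less_mult_iff)
  ultimately show ?thesis
    using assms(1,4) by (simp add: causal_vec_def bilinear_lmul[OF bil] bilinear_rmul[OF bil])
qed

lemma abs_cont_on_bounded_linear:
  assumes "abs_cont_on S f" "bounded_linear h"
  shows "abs_cont_on S (\<lambda>t. h (f t))"
proof -
  interpret h: bounded_linear h by (rule assms(2))
  obtain B where B: "B \<ge> 0" "\<And>x. norm (h x) \<le> norm x * B" using h.nonneg_bounded by blast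
  have "B-lipschitz_on (f ` S) h"
    using B by (intro lipschitz_onI) (simp_all add: dist_norm h.diff[symmetric] mult.commute)
  from lipschitz_compose_abs_cont_on[OF assms(1) this] show ?thesis by (simp add: comp_def)
qed

text \<open>Absolute continuity is available only locally; the statement has the form of the local
  hypothesis in a Bolzano induction over intervals.\<close>

lemma abs_cont_in_chart:
  assumes \<gamma>: "ac_curve A \<gamma> a b" and c: "c \<in> A" and x: "x \<in> {a..b}" "\<gamma> x \<in> snd c"
  shows "\<exists>\<delta>>0. \<forall>u v. a \<le> u \<and> u \<le> x \<and> x \<le> v \<and> v \<le> b \<and> v - u < \<delta> \<longrightarrow> abs_cont_on {u..v} (\<lambda>t. fst c (\<gamma> t))"
proof -
  obtain \<delta> where \<delta>: "\<delta> > 0" "abs_cont_on ({a..b} \<inter> cball x \<delta>) (fst c \<circ> \<gamma>)"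
    by (rule reg_curve_in_chart[OF admissible_abs_cont_on \<gamma>[unfolded ac_curve_iff] x(1) c x(2)])
  show ?thesis
  proof (intro exI[of _ \<delta>] conjI \<delta>(1) allI impI)
    fix u v assume uv: "a \<le> u \<and> u \<le> x \<and> x \<le> v \<and> v \<le> b \<and> v - u < \<delta>"
    have "{u..v} \<subseteq> {a..b} \<inter> cball x \<delta>" using uv by (auto simp: dist_real_def)
    from abs_cont_on_subset[OF \<delta>(2) this] show "abs_cont_on {u..v} (\<lambda>t. fst c (\<gamma> t))"
      by (simp add: comp_def)
  qed
qed

lemma ae_causal_deriv:
  assumes \<gamma>: "ac_curve A \<gamma> a b" "ae_vel (causal_vec G T fut) \<gamma> a b" and c: "c \<in> A"
    and s: "a \<le> s" "s' \<le> b" "\<gamma> ` {s..s'} \<subseteq> snd c"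
  shows "\<exists>N. negligible N \<and> (\<forall>t. s < t \<and> t < s' \<and> t \<notin> N \<longrightarrow>
     (\<exists>v. ((\<lambda>t. fst c (\<gamma> t)) has_vector_derivative v) (at t) \<and> causal_vec G T fut c (fst c (\<gamma> t)) v))"
proof (intro exI[of _ "{t. a < t \<and> t < b \<and> \<not> vel (causal_vec G T fut) \<gamma> t}"] conjI allI impI)
  show "negligible {t. a < t \<and> t < b \<and> \<not> vel (causal_vec G T fut) \<gamma> t}"
    using \<gamma>(2) by (simp add: ae_vel_def)
  fix t assume t: "s < t \<and> t < s' \<and> t \<notin> {t. a < t \<and> t < b \<and> \<not> vel (causal_vec G T fut) \<gamma> t}"
  have v: "vel (causal_vec G T fut) \<gamma> t" using t s by auto
  have "continuous_on {a..b} \<gamma>" using \<gamma>(1) by (simp add: ac_curve_def)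
  then have "isCont \<gamma> t" by (rule continuous_on_interior) (use t s in auto)
  moreover have "\<gamma> t \<in> snd c" using s(3) t by auto
  ultimately obtain w where "((fst c \<circ> \<gamma>) has_vector_derivative w) (at t)" "causal_vec G T fut c (fst c (\<gamma> t)) w"
    by (rule vel_in_chart[OF tensorial_causal v _ c])
  then show "\<exists>v. ((\<lambda>t. fst c (\<gamma> t)) has_vector_derivative v) (at t) \<and> causal_vec G T fut c (fst c (\<gamma> t)) v"
    unfolding comp_def by blast
qed

text \<open>The cone bound on velocities is integrated without integrals: for each spatial vector
  \<open>e\<close> the functional \<open>h\<close> built from it is nonnegative on causal vectors,
  hence increasing along the curve. Taking \<open>e\<close> to be the spatial increment itself gives
  the estimate for the norm.\<close>

lemma causal_curve_increments:
  assumes \<gamma>: "ac_curve A \<gamma> a b" "ae_vel (causal_vec G T fut) \<gamma> a b" and c: "cone_chart c C"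
    and s: "a \<le> s" "s \<le> s'" "s' \<le> b" "\<gamma> ` {s..s'} \<subseteq> snd c"
  shows "\<exists>\<sigma>. (\<sigma> = 1 \<or> \<sigma> = - 1) \<and> (\<forall>u\<in>{s..s'}. time_sign c fut (fst c (\<gamma> u)) = \<sigma>) \<and>
    (\<forall>u v. s \<le> u \<and> u \<le> v \<and> v \<le> s' \<longrightarrow>
       norm (snd (fst c (\<gamma> v)) - snd (fst c (\<gamma> u))) \<le> C * (\<sigma> * (fst (fst c (\<gamma> v)) - fst (fst c (\<gamma> u)))))"
proof -
  have cA: "c \<in> A" and C: "C > 1" using c by (auto simp: cone_chart_def)
  let ?f = "\<lambda>t. fst c (\<gamma> t)"
  have cont: "continuous_on {s..s'} \<gamma>"
  proof (rule continuous_on_subset)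
    show "continuous_on {a..b} \<gamma>" using \<gamma>(1) by (simp add: ac_curve_def)
    show "{s..s'} \<subseteq> {a..b}" using s by auto
  qed
  have contf: "continuous_on {s..s'} ?f"
    by (rule continuous_on_compose2[OF chart_continuous[OF cA] cont s(4)])
  have conn: "connected (?f ` {s..s'})" by (rule connected_continuous_image[OF contf]) simp
  have sub: "?f ` {s..s'} \<subseteq> fst c ` snd c" using s(4) by blast
  define \<sigma> where "\<sigma> = time_sign c fut (?f s)"
  have sign: "time_sign c fut (?f u) = \<sigma>" if "u \<in> {s..s'}" for u
    unfolding \<sigma>_def by (rule time_sign_constant[OF c conn sub]) (use that s in auto)
  have "?f s \<in> fst c ` snd c" by (rule subsetD[OF sub]) (use s in auto)
  then have \<sigma>: "\<sigma> = 1 \<or> \<sigma> = - 1"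
    using orientation_fst_nonzero[OF c] unfolding \<sigma>_def time_sign_def by (auto simp: sgn_if)
  obtain N where N1: "negligible N" and N2: "\<forall>t. s < t \<and> t < s' \<and> t \<notin> N \<longrightarrow>
     (\<exists>v. (?f has_vector_derivative v) (at t) \<and> causal_vec G T fut c (?f t) v)"
    using ae_causal_deriv[OF \<gamma> cA s(1,3,4)] by (elim exE conjE) (rule that)
  note N = N1 N2[rule_format, OF conjI[OF _ conjI]]
  \<comment> \<open>The induction also tests intervals protruding from \<open>{s..s'}\<close>; the
    guard makes the property vacuous there.\<close>
  define P where "P u v \<longleftrightarrow> s \<le> u \<and> v \<le> s' \<longrightarrow> norm (snd (?f v) - snd (?f u)) \<le> C * (\<sigma> * (fst (?f v) - fst (?f u)))" for u v
  have short: "norm (snd (?f v) - snd (?f u)) \<le> C * (\<sigma> * (fst (?f v) - fst (?f u)))"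
    if uv: "s \<le> u" "u \<le> v" "v \<le> s'" and ac: "abs_cont_on {u..v} ?f" for u v
  proof -
    have main: "e \<bullet> (snd (?f v) - snd (?f u)) \<le> norm e * (C * (\<sigma> * (fst (?f v) - fst (?f u))))" for e :: 'v
    proof -
      define h where "h w = norm e * (C * (\<sigma> * fst w)) - e \<bullet> snd w" for w :: "real \<times> 'v"
      have bl: "bounded_linear h" unfolding h_def
        by (intro bounded_linear_sub bounded_linear_const_mult bounded_linear_fst bounded_linear_inner_right_comp bounded_linear_snd)
      interpret h: bounded_linear h by (rule bl)
      have "h (?f u) \<le> h (?f v)"
      proof (rule abs_cont_on_deriv_nonneg_imp_mono[where h = "\<lambda>t. h (?f t)", OF abs_cont_on_bounded_linear[OF ac bl] uv(2) N(1)])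
        fix t assume t: "u < t" "t < v" "t \<notin> N"
        then obtain w where w: "(?f has_vector_derivative w) (at t)" "causal_vec G T fut c (?f t) w"
          using N(2)[of t] uv by auto
        have "((\<lambda>t. h (?f t)) has_vector_derivative h w) (at t)"
          by (rule h.has_vector_derivative[OF w(1)])
        then have "((\<lambda>t. h (?f t)) has_real_derivative h w) (at t)"
          by (simp add: has_real_derivative_iff_has_vector_derivative)
        moreover have "h w \<ge> 0"
        proof -
          have tm: "?f t \<in> fst c ` snd c" using sub t uv by auto
          have "e \<bullet> snd w \<le> norm e * norm (snd w)" by (rule norm_cauchy_schwarz)
          also have "\<dots> \<le> norm e * (C * (\<sigma> * fst w))"
            using causal_vec_bounds(2)[OF c tm w(2)] sign[of t] t uv by (intro mult_left_mono) auto
          finally show ?thesis by (simp add: h_def)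
        qed
        ultimately show "\<exists>d\<ge>0. ((\<lambda>t. h (?f t)) has_real_derivative d) (at t)" by blast
      qed
      then have "0 \<le> h (?f v - ?f u)" by (simp add: h.diff)
      then show ?thesis by (simp add: h_def)
    qed
    define e where "e = snd (?f v) - snd (?f u)"
    obtain i :: 'v where i: "i \<in> Basis" using nonempty_Basis by blast
    show ?thesis
    \<comment> \<open>Without spatial increment one still has to see that time does not run
      backwards; any unit vector in place of \<open>e\<close> shows this.\<close>
    proof (cases "e = 0")
      case True
      then show ?thesis using main[of i] i by (simp add: e_def)
    next
      case False
      have "norm e * norm e \<le> norm e * (C * (\<sigma> * (fst (?f v) - fst (?f u))))"
        using main[of e] by (simp add: e_def[symmetric] dot_square_norm power2_eq_square)
      then show ?thesis using False by (simp add: e_def[symmetric] mult_le_cancel_left)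
    qed
  qed
  have incr: "norm (snd (?f v) - snd (?f u)) \<le> C * (\<sigma> * (fst (?f v) - fst (?f u)))"
    if uv: "s \<le> u" "u \<le> v" "v \<le> s'" for u v
  proof -
    have "P u v" using uv(2)
    proof (induction rule: Bolzano)
      case (trans x y z)
      show ?case unfolding P_def
      proof
        assume xz: "s \<le> x \<and> z \<le> s'"
        have "norm (snd (?f z) - snd (?f x)) \<le> norm (snd (?f z) - snd (?f y)) + norm (snd (?f y) - snd (?f x))"
          using norm_triangle_ineq[of "snd (?f z) - snd (?f y)" "snd (?f y) - snd (?f x)"] by simp
        also have "\<dots> \<le> C * (\<sigma> * (fst (?f z) - fst (?f y))) + C * (\<sigma> * (fst (?f y) - fst (?f x)))"
          using trans xz by (intro add_mono) (auto simp: P_def)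
        finally show "norm (snd (?f z) - snd (?f x)) \<le> C * (\<sigma> * (fst (?f z) - fst (?f x)))"
          by (simp add: algebra_simps)
      qed
    next
      case (local x)
      have x: "x \<in> {a..b}" "\<gamma> x \<in> snd c" using local uv s by auto
      obtain \<delta> where \<delta>: "\<delta> > 0"
        "\<forall>u v. a \<le> u \<and> u \<le> x \<and> x \<le> v \<and> v \<le> b \<and> v - u < \<delta> \<longrightarrow> abs_cont_on {u..v} ?f"
        using abs_cont_in_chart[OF \<gamma>(1) cA x] by (elim exE conjE) (rule that)
      have "P p q" if pq: "p \<le> x" "x \<le> q" "q - p < \<delta>" for p q
        unfolding P_def
      proof
        assume "s \<le> p \<and> q \<le> s'"
        then show "norm (snd (?f q) - snd (?f p)) \<le> C * (\<sigma> * (fst (?f q) - fst (?f p)))"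
          using pq s \<delta>(2)[rule_format, of p q] short[of p q]
          by auto
      qed
      then show ?case using \<delta>(1) by blast
    qed
    then show ?thesis using uv by (simp add: P_def)
  qed
  show ?thesis using \<sigma> sign incr by (intro exI[of _ \<sigma>]) blast
qed

text \<open>An absolutely continuous causal curve in a cylindrical chart becomes Lipschitz when it is
  parametrized by the time coordinate. Lusin's property (N) of the time coordinate guarantees that
  the new parametrization still has a causal velocity almost everywhere.\<close>

lemma causal_curve_reach:
  assumes \<gamma>: "ac_curve A \<gamma> a b" "ae_vel (causal_vec G T fut) \<gamma> a b" and c: "cone_chart c C"
    and s: "a \<le> s" "s < s'" "s' \<le> b" "\<gamma> ` {s..s'} \<subseteq> snd c"
  shows "reach (causal_vec G T fut) (snd c) (\<gamma> s) (\<gamma> s')"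
proof -
  have cA: "c \<in> A" and C: "C > 1" using c by (auto simp: cone_chart_def)
  let ?f = "\<lambda>t. fst c (\<gamma> t)"
  obtain \<sigma> where \<sigma>: "\<sigma> = 1 \<or> \<sigma> = - 1"
    and sign: "\<forall>u\<in>{s..s'}. time_sign c fut (?f u) = \<sigma>"
    and incr: "\<forall>u v. s \<le> u \<and> u \<le> v \<and> v \<le> s' \<longrightarrow>
       norm (snd (?f v) - snd (?f u)) \<le> C * (\<sigma> * (fst (?f v) - fst (?f u)))"
    using causal_curve_increments[OF \<gamma> c s(1) less_imp_le[OF s(2)] s(3,4)] by (elim exE conjE) (rule that)
  obtain N where N1: "negligible N" and N2: "\<forall>t. s < t \<and> t < s' \<and> t \<notin> N \<longrightarrow>
     (\<exists>v. (?f has_vector_derivative v) (at t) \<and> causal_vec G T fut c (?f t) v)"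
    using ae_causal_deriv[OF \<gamma> cA s(1,3,4)] by (elim exE conjE) (rule that)
  note N = N1 N2[rule_format, OF conjI[OF _ conjI]]
  have cont: "continuous_on {s..s'} \<gamma>"
  proof (rule continuous_on_subset)
    show "continuous_on {a..b} \<gamma>" using \<gamma>(1) by (simp add: ac_curve_def)
    show "{s..s'} \<subseteq> {a..b}" using s by auto
  qed
  have contf: "continuous_on {s..s'} ?f"
    by (rule continuous_on_compose2[OF chart_continuous[OF cA] cont s(4)])
  define \<tau> where "\<tau> t = \<sigma> * fst (?f t)" for t
  have cont\<tau>: "continuous_on {s..s'} \<tau>" unfolding \<tau>_def by (intro continuous_intros contf)
  have incr': "norm (snd (?f v) - snd (?f u)) \<le> C * (\<tau> v - \<tau> u)" if "s \<le> u" "u \<le> v" "v \<le> s'" for u v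
    using incr[rule_format, of u v] that by (simp add: \<tau>_def right_diff_distrib)
  have mono: "\<tau> u \<le> \<tau> v" if "s \<le> u" "u \<le> v" "v \<le> s'" for u v
  proof -
    have "0 \<le> C * (\<tau> v - \<tau> u)" using incr'[OF that] norm_ge_zero order_trans by blast
    then show ?thesis using C by (simp add: zero_le_mult_iff)
  qed
  \<comment> \<open>If time stood still on an interval, the increment bound would freeze the space
    coordinates too, and the velocity would vanish at almost every parameter, whereas causal vectors
    are nonzero.\<close>
  have strict: "\<tau> u < \<tau> v" if uv: "s \<le> u" "u < v" "v \<le> s'" for u v
  proof (rule ccontr)
    assume "\<not> \<tau> u < \<tau> v"
    then have eq: "\<tau> w = \<tau> u" if "w \<in> {u..v}" for w
      using mono[of u w] mono[of w v] that uv by auto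
    have const: "?f w = ?f u" if w: "w \<in> {u..v}" for w
    proof -
      have "norm (snd (?f w) - snd (?f u)) \<le> 0" using incr'[of u w] w uv eq[OF w] by auto
      moreover have "fst (?f w) = fst (?f u)" using eq[OF w] \<sigma> by (auto simp: \<tau>_def)
      ultimately show ?thesis by (simp add: prod_eq_iff)
    qed
    have "\<not> {u<..<v} \<subseteq> N"
      using N(1) uv negligible_subset[of N "{u<..<v}"] open_not_negligible[of "{u<..<v}"] by auto
    then obtain t where "t \<in> {u<..<v}" "t \<notin> N" by blast
    then have t: "u < t" "t < v" "t \<notin> N" by auto
    have "s < t" "t < s'" using t uv by auto
    from N(2)[OF this t(3)] obtain w where w: "(?f has_vector_derivative w) (at t)" "causal_vec G T fut c (?f t) w"
      by (elim exE conjE) (rule that)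
    have "((\<lambda>_. ?f u) has_vector_derivative w) (at t)"
    proof (rule has_vector_derivative_transform_within_open[OF w(1)])
      show "open {u<..<v}" "t \<in> {u<..<v}" using t by auto
      show "?f x = ?f u" if "x \<in> {u<..<v}" for x using that by (intro const) simp
    qed
    then have "w = 0" by (rule vector_derivative_unique_at[OF _ has_vector_derivative_const])
    then show False using w(2) by (simp add: causal_vec_def)
  qed
  define a' where "a' = \<tau> s"
  define b' where "b' = \<tau> s'"
  have ab': "a' < b'" using strict[of s s'] s by (simp add: a'_def b'_def)
  have inj: "inj_on \<tau> {s..s'}"
  proof (rule inj_onI)
    fix u v assume uv: "u \<in> {s..s'}" "v \<in> {s..s'}" "\<tau> u = \<tau> v"
    then show "u = v" using strict[of u v] strict[of v u] by (cases u v rule: linorder_cases) auto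
  qed
  define \<iota> where "\<iota> = inv_into {s..s'} \<tau>"
  have \<iota>\<tau>: "\<iota> (\<tau> t) = t" if "t \<in> {s..s'}" for t unfolding \<iota>_def using inj that by (rule inv_into_f_f)
  have img: "\<tau> ` {s..s'} = {a'..b'}"
  proof
    show "\<tau> ` {s..s'} \<subseteq> {a'..b'}" using mono by (auto simp: a'_def b'_def)
    show "{a'..b'} \<subseteq> \<tau> ` {s..s'}"
      unfolding a'_def b'_def
      by (rule connected_contains_Icc[OF connected_continuous_image[OF cont\<tau>]]) (use s in auto)
  qed
  have \<iota>: "\<iota> x \<in> {s..s'}" "\<tau> (\<iota> x) = x" if "x \<in> {a'..b'}" for x
  proof -
    have "x \<in> \<tau> ` {s..s'}" using that img by simp
    then show "\<iota> x \<in> {s..s'}" "\<tau> (\<iota> x) = x" unfolding \<iota>_def by (rule inv_into_into, rule f_inv_into_f)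
  qed
  have \<iota>cont: "continuous_on {a'..b'} \<iota>"
    unfolding img[symmetric] by (rule continuous_on_inv[OF cont\<tau> compact_Icc]) (simp add: \<iota>\<tau>)
  have \<iota>mono: "\<iota> x \<le> \<iota> y" if "x \<in> {a'..b'}" "y \<in> {a'..b'}" "x \<le> y" for x y
  proof (rule ccontr)
    assume "\<not> \<iota> x \<le> \<iota> y"
    then have "\<tau> (\<iota> y) < \<tau> (\<iota> x)" using \<iota>[OF that(1)] \<iota>[OF that(2)] by (intro strict) auto
    then show False using \<iota> that by simp
  qed
  let ?g = "\<lambda>x. ?f (\<iota> x)"
  \<comment> \<open>In the new parametrization the time component has slope 1 or - 1, and the
    increment bound gives slope at most \<open>C\<close> in space.\<close>
  have lip0: "dist (?g x) (?g y) \<le> (1 + C) * dist x y" if xy: "x \<in> {a'..b'}" "y \<in> {a'..b'}" "x \<le> y" for x y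
  proof -
    have "norm (snd (?g y) - snd (?g x)) \<le> C * (\<tau> (\<iota> y) - \<tau> (\<iota> x))"
      using \<iota>[OF xy(1)] \<iota>[OF xy(2)] \<iota>mono[OF xy] by (intro incr') auto
    then have 1: "norm (snd (?g y - ?g x)) \<le> C * (y - x)" using \<iota>[OF xy(1)] \<iota>[OF xy(2)] by simp
    have "\<sigma> * (fst (?g y) - fst (?g x)) = y - x"
      using \<iota>(2)[OF xy(1)] \<iota>(2)[OF xy(2)] unfolding \<tau>_def by (simp add: algebra_simps)
    then have 2: "norm (fst (?g y - ?g x)) \<le> y - x" using \<sigma> xy(3) by auto
    have "norm w \<le> norm (fst w) + norm (snd w)" for w :: "real \<times> 'v"
      using norm_Pair_le[of "fst w" "snd w"] by simp
    then have "norm (?g y - ?g x) \<le> norm (fst (?g y - ?g x)) + norm (snd (?g y - ?g x))" .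
    also have "\<dots> \<le> (1 + C) * (y - x)" using 1 2 by (simp add: algebra_simps)
    finally show ?thesis using xy(3) by (simp add: dist_norm norm_minus_commute)
  qed
  have lip: "(1 + C)-lipschitz_on {a'..b'} ?g"
  proof (rule lipschitz_onI)
    fix x y assume xy: "x \<in> {a'..b'}" "y \<in> {a'..b'}"
    show "dist (?g x) (?g y) \<le> (1 + C) * dist x y"
      using lip0[OF xy] lip0[OF xy(2,1)] by (cases "x \<le> y") (auto simp: dist_commute)
  qed (use C in simp)
  have gimg: "?g ` {a'..b'} \<subseteq> fst c ` snd c" using \<iota>(1) s(4) by blast
  have N': "negligible (\<tau> ` (N \<inter> {s..s'}))"
  proof -
    \<comment> \<open>\<open>\<tau>\<close> is known to be absolutely continuous only on short
      intervals, so the image of the exceptional set is assembled from pieces.\<close>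
    define Q where "Q u v \<longleftrightarrow> s \<le> u \<and> v \<le> s' \<longrightarrow> negligible (\<tau> ` (N \<inter> {u..v}))" for u v
    have "Q s s'" using less_imp_le[OF s(2)]
    proof (induction rule: Bolzano)
      case (trans x y z)
      show ?case unfolding Q_def
      proof
        assume "s \<le> x \<and> z \<le> s'"
        then have "negligible (\<tau> ` (N \<inter> {x..y}) \<union> \<tau> ` (N \<inter> {y..z}))"
          using trans by (auto simp: Q_def)
        moreover have "N \<inter> {x..z} \<subseteq> N \<inter> {x..y} \<union> N \<inter> {y..z}" by auto
        then have "\<tau> ` (N \<inter> {x..z}) \<subseteq> \<tau> ` (N \<inter> {x..y}) \<union> \<tau> ` (N \<inter> {y..z})"
          unfolding image_Un[symmetric] by (rule image_mono)
        ultimately show "negligible (\<tau> ` (N \<inter> {x..z}))" by (rule negligible_subset)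
      qed
    next
      case (local x)
      have x: "x \<in> {a..b}" "\<gamma> x \<in> snd c" using local s by auto
      obtain \<delta> where \<delta>: "\<delta> > 0"
        "\<forall>u v. a \<le> u \<and> u \<le> x \<and> x \<le> v \<and> v \<le> b \<and> v - u < \<delta> \<longrightarrow> abs_cont_on {u..v} ?f"
        using abs_cont_in_chart[OF \<gamma>(1) cA x] by (elim exE conjE) (rule that)
      have "Q p q" if pq: "p \<le> x" "x \<le> q" "q - p < \<delta>" for p q
        unfolding Q_def
      proof
        assume sq: "s \<le> p \<and> q \<le> s'"
        have bl: "bounded_linear (\<lambda>w :: real \<times> 'v. \<sigma> * fst w)"
          by (intro bounded_linear_const_mult bounded_linear_fst)
        have "a \<le> p \<and> p \<le> x \<and> x \<le> q \<and> q \<le> b \<and> q - p < \<delta>" using pq sq s by linarith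
        then have "abs_cont_on {p..q} ?f" by (rule \<delta>(2)[rule_format])
        from abs_cont_on_bounded_linear[OF this bl] have "abs_cont_on {p..q} \<tau>"
          by (simp only: \<tau>_def[abs_def])
        then show "negligible (\<tau> ` (N \<inter> {p..q}))"
        proof (rule negligible_mono_abs_cont_image)
          show "mono_on {p..q} \<tau>" using mono sq by (auto simp: mono_on_def)
          show "negligible (N \<inter> {p..q})" using N(1) by (rule negligible_subset) auto
        qed auto
      qed
      then show ?case using \<delta>(1) by blast
    qed
    then show ?thesis by (simp add: Q_def)
  qed
  have der: "\<exists>v. (?g has_vector_derivative v) (at x) \<and> causal_vec G T fut c (?g x) v"
    if x: "a' < x" "x < b'" "x \<notin> \<tau> ` (N \<inter> {s..s'})" for x
  proof -
    define t where "t = \<iota> x"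
    have xt: "t \<in> {s..s'}" "\<tau> t = x" using \<iota>[of x] x by (auto simp: t_def)
    have "t \<noteq> s" "t \<noteq> s'" using x xt by (auto simp: a'_def b'_def)
    then have tt: "s < t" "t < s'" using xt by auto
    have "t \<notin> N" using x(3) xt by blast
    from N(2)[OF tt this] obtain v where v: "(?f has_vector_derivative v) (at t)" "causal_vec G T fut c (?f t) v"
      by (elim exE conjE) (rule that)
    have tm: "?f t \<in> fst c ` snd c" using subsetD[OF s(4) imageI[OF xt(1)]] by (rule imageI)
    have pos: "0 < \<sigma> * fst v" using causal_vec_bounds(1)[OF c tm v(2)] bspec[OF sign xt(1)] by simp
    have "(\<tau> has_vector_derivative \<sigma> * fst v) (at t)"
      using bounded_linear.has_vector_derivative[OF bounded_linear_const_mult[OF bounded_linear_fst, of \<sigma>] v(1)]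
      by (simp only: \<tau>_def[abs_def])
    then have d\<tau>: "DERIV \<tau> (\<iota> x) :> \<sigma> * fst v"
      by (simp add: has_real_derivative_iff_has_vector_derivative t_def)
    \<comment> \<open>The inverse is differentiable because the time component of a causal vector is
      nonzero; the new velocity is the old one rescaled by a positive factor.\<close>
    have "DERIV \<iota> x :> inverse (\<sigma> * fst v)"
    proof (rule DERIV_inverse_function[where f = \<tau> and a = a' and b = b'])
      show "DERIV \<tau> (\<iota> x) :> \<sigma> * fst v" by (rule d\<tau>)
      show "a' < x" "x < b'" by (rule x(1), rule x(2))
      show "\<sigma> * fst v \<noteq> 0" using pos by (rule less_imp_neq[symmetric])
      show "\<tau> (\<iota> y) = y" if "a' < y" "y < b'" for y using \<iota>(2)[of y] that by simp
      show "isCont \<iota> x" by (rule continuous_on_interior[OF \<iota>cont]) (use x in auto)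
    qed
    then have "(\<iota> has_vector_derivative inverse (\<sigma> * fst v)) (at x)"
      by (simp add: has_real_derivative_iff_has_vector_derivative)
    from vector_diff_chain_at[OF this v(1)[unfolded t_def]]
    have "(?g has_vector_derivative inverse (\<sigma> * fst v) *\<^sub>R v) (at x)" by (simp add: comp_def)
    moreover have "causal_vec G T fut c (?g x) (inverse (\<sigma> * fst v) *\<^sub>R v)"
    proof -
      have "causal_vec G T fut c (?f t) (inverse (\<sigma> * fst v) *\<^sub>R v)"
        by (rule causal_vec_scale[OF v(2) cA tm positive_imp_inverse_positive[OF pos]])
      then show ?thesis by (simp only: t_def)
    qed
    ultimately show ?thesis by blast
  qed
  have curve: "loclip_curve A (\<lambda>x. coord_inv c (?g x)) a' b'" "ae_vel (causal_vec G T fut) (\<lambda>x. coord_inv c (?g x)) a' b'"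
    by (rule coordinate_curve[where f = ?g and P = "causal_vec G T fut", OF cA ab' lip gimg N' der]; assumption)+
  have ends: "coord_inv c (?g a') = \<gamma> s" "coord_inv c (?g b') = \<gamma> s'"
    using s cA by (auto simp: a'_def b'_def \<iota>\<tau> image_subset_iff)
  have "(\<lambda>x. coord_inv c (?g x)) ` {a'..b'} \<subseteq> snd c"
    using gimg by (auto intro!: coord_inv_mem)
  then show ?thesis unfolding reach_def using curve ends
    by (intro exI[of _ "\<lambda>x. coord_inv c (?g x)"] exI[of _ a'] exI[of _ b'] conjI)
qed

end

section \<open>Equivalence of the three properties\<close>

lemma closure_of_top_of_set: "X \<subseteq> U \<Longrightarrow> top_of_set U closure_of X = U \<inter> closure X"
  by (simp add: closure_of_subtopology inf.absorb2)

lemma frontier_of_top_of_set_open: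
  assumes "open U" "X \<subseteq> U"
  shows "top_of_set U frontier_of X = U \<inter> frontier X"
proof -
  have "top_of_set U interior_of X = U \<inter> interior X"
    using interior_of_subtopology_open[of euclidean U X] assms(1) by simp
  then show ?thesis
    unfolding frontier_of_def frontier_def closure_of_top_of_set[OF assms(2)] by auto
qed

context spacetime begin

section \<open>Elementary properties of the relative futures\<close>

lemma rel_I_subset: "rel_I A G T fut p U \<subseteq> U"
  unfolding rel_I_eq using reach_mem by blast

lemma rel_J_subset: "p \<in> U \<Longrightarrow> rel_J A G T fut p U \<subseteq> U"
  unfolding rel_J_eq using reach_mem by blast

lemma rel_I_subset_rel_J: "rel_I A G T fut p U \<subseteq> rel_J A G T fut p U"
  unfolding rel_I_eq rel_J_eq using reach_causal by blast

lemma rel_I_up: "\<forall>x\<in>rel_I A G T fut p U. \<forall>y. reach (timelike_vec G T fut) U x y \<longrightarrow> y \<in> rel_I A G T fut p U"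
  unfolding rel_I_eq using reach_trans by blast

lemma rel_J_up: "\<forall>x\<in>rel_J A G T fut p U. \<forall>y. reach (timelike_vec G T fut) U x y \<longrightarrow> y \<in> rel_J A G T fut p U"
  unfolding rel_J_eq using reach_trans reach_causal by blast

text \<open>Provides timelike prolongations that are as short as desired: the cone at
  \<open>q\<close> is taken inside \<open>U \<inter> N\<close>.\<close>

lemma reach_nearby:
  assumes U: "open U" "q \<in> U" and N: "open N" "q \<in> N"
  obtains q' where "q' \<in> N" "reach (timelike_vec G T fut) U q q'"
proof -
  obtain c where c: "c \<in> A" "q \<in> snd c" by (rule obtain_chart)
  define y0 where "y0 = fst c q"
  have y0: "y0 \<in> fst c ` snd c" "y0 \<in> fst c ` (snd c \<inter> (U \<inter> N))" using c U N by (auto simp: y0_def)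
  obtain w0 where tl: "timelike_vec G T fut c y0 w0" using exists_timelike[OF c(1) y0(1)] by blast
  have oUN: "open (U \<inter> N)" using U N by blast
  obtain \<rho> where \<rho>: "\<rho> > 0"
    "\<And>y z r. y \<in> ball y0 \<rho> \<Longrightarrow> z \<in> ball y0 \<rho> \<Longrightarrow> r > 0 \<Longrightarrow> (1 / r) *\<^sub>R (z - y) \<in> ball w0 \<rho> \<Longrightarrow>
       reach (timelike_vec G T fut) (U \<inter> N) (coord_inv c y) (coord_inv c z)"
    using local_cone[OF c(1) y0(2) oUN tl] by metis
  define r where "r = \<rho> / (2 * (norm w0 + 1))"
  have r: "r > 0" using \<rho>(1) by (simp add: r_def add_nonneg_pos)
  have "r * norm w0 < r * (2 * (norm w0 + 1))" using r by (simp add: add_nonneg_pos)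
  also have "\<dots> = \<rho>" unfolding r_def by (simp add: add_nonneg_eq_0_iff)
  finally have "y0 + r *\<^sub>R w0 \<in> ball y0 \<rho>" using r by (simp add: dist_norm)
  then have "reach (timelike_vec G T fut) (U \<inter> N) (coord_inv c y0) (coord_inv c (y0 + r *\<^sub>R w0))"
    using \<rho>(1) r by (intro \<rho>(2)[of _ _ r]) auto
  moreover have "coord_inv c y0 = q" using c by (simp add: y0_def)
  ultimately have *: "reach (timelike_vec G T fut) (U \<inter> N) q (coord_inv c (y0 + r *\<^sub>R w0))" by simp
  show ?thesis
    by (rule that[of "coord_inv c (y0 + r *\<^sub>R w0)"]) (use reach_mem[OF *] reach_mono[OF *] in auto)
qed

lemma base_in_closure_rel_I:
  assumes "open U" "p \<in> U"
  shows "p \<in> closure (rel_I A G T fut p U)"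
  unfolding closure_iff_nhds_not_empty
proof (intro allI impI)
  fix N W assume "W \<subseteq> N" "open W" "p \<in> W"
  then obtain q where "q \<in> W" "reach (timelike_vec G T fut) U p q" using reach_nearby[OF assms] by blast
  then show "rel_I A G T fut p U \<inter> N \<noteq> {}" using \<open>W \<subseteq> N\<close> unfolding rel_I_eq by blast
qed

lemma bubble_ext_empty_iff:
  assumes "p \<in> U"
  shows "bubble_ext A G T fut p U = {} \<longleftrightarrow> rel_J A G T fut p U \<subseteq> closure (rel_I A G T fut p U)"
  unfolding bubble_ext_def closure_of_top_of_set[OF rel_I_subset] using rel_J_subset[OF assms] by blast

lemma frontier_eq_iff:
  assumes "open U" "p \<in> U"
  shows "top_of_set U frontier_of rel_I A G T fut p U = top_of_set U frontier_of rel_J A G T fut p U \<longleftrightarrow>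
    U \<inter> frontier (rel_I A G T fut p U) = U \<inter> frontier (rel_J A G T fut p U)"
  by (simp add: frontier_of_top_of_set_open assms rel_I_subset rel_J_subset)

section \<open>Empty bubbles give equal boundaries\<close>

lemma bubble_empty_imp_frontier_eq:
  assumes U: "open U" "p \<in> U" and sub: "rel_J A G T fut p U \<subseteq> closure (rel_I A G T fut p U)"
  shows "U \<inter> frontier (rel_I A G T fut p U) = U \<inter> frontier (rel_J A G T fut p U)"
proof -
  let ?I = "rel_I A G T fut p U" and ?J = "rel_J A G T fut p U"
  have cl: "closure ?J = closure ?I"
    by (rule subset_antisym[OF closure_minimal[OF sub closed_closure] closure_mono[OF rel_I_subset_rel_J]])
  have absorb: "U \<inter> interior X = U \<inter> interior (closure X)"
    if up: "\<forall>x\<in>X. \<forall>y. reach (timelike_vec G T fut) U x y \<longrightarrow> y \<in> X" for X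
  proof
    show "U \<inter> interior X \<subseteq> U \<inter> interior (closure X)"
      by (rule Int_mono[OF order_refl interior_mono[OF closure_subset]])
    show "U \<inter> interior (closure X) \<subseteq> U \<inter> interior X"
      by (rule Int_greatest[OF Int_lower1 interior_closure_absorbing[OF U(1) up]])
  qed
  have "U \<inter> interior ?I = U \<inter> interior ?J"
    using absorb[OF rel_I_up[of fut p U]] absorb[OF rel_J_up[of fut p U]] cl by simp
  then show ?thesis unfolding frontier_def cl by blast
qed

section \<open>Push-up gives empty bubbles\<close>

lemma push_up_imp_bubble_empty:
  assumes pu: "push_up_property A G T" and U: "open U" "p \<in> U"
  shows "rel_J A G T fut p U \<subseteq> closure (rel_I A G T fut p U)"
proof
  fix q assume "q \<in> rel_J A G T fut p U"
  then consider "q = p" | "reach (causal_vec G T fut) U p q" unfolding rel_J_eq by blast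
  then show "q \<in> closure (rel_I A G T fut p U)"
  proof cases
    case 1
    then show ?thesis using base_in_closure_rel_I[OF U] by simp
  next
    case 2
    then have qU: "q \<in> U" using reach_mem by blast
    obtain \<gamma>1 a b where 1: "loclip_curve A \<gamma>1 a b" "ae_vel (causal_vec G T fut) \<gamma>1 a b" "\<gamma>1 a = p" "\<gamma>1 b = q" "\<gamma>1 ` {a..b} \<subseteq> U"
      using 2 unfolding reach_def by blast
    show ?thesis unfolding closure_iff_nhds_not_empty
    proof (intro allI impI)
      fix N W assume "W \<subseteq> N" "open W" "q \<in> W"
      then obtain q' where q': "q' \<in> W" "reach (timelike_vec G T fut) U q q'" using reach_nearby[OF U(1) qU] by blast
      obtain \<gamma>2 d where 2: "loclip_curve A \<gamma>2 b d" "ae_vel (timelike_vec G T fut) \<gamma>2 b d" "\<gamma>2 b = q" "\<gamma>2 d = q'" "\<gamma>2 ` {b..d} \<subseteq> U"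
        using reachE_start[OF q'(2)] by blast
      have lt: "a < b" "b < d" using 1 2 by (auto simp: loclip_curve_def)
      let ?\<gamma> = "\<lambda>t. if t \<le> b then \<gamma>1 t else \<gamma>2 t"
      have ll: "loclip_curve A ?\<gamma> a d" using 1 2 by (intro loclip_curve_join) auto
      have "ae_vel (causal_vec G T fut) \<gamma>2 b d" by (rule ae_vel_mono[OF 2(2) vel_timelike_imp_causal])
      then have ca: "ae_vel (causal_vec G T fut) ?\<gamma> a d" using 1 by (intro ae_vel_join)
      have inU: "?\<gamma> ` {a..d} \<subseteq> U" using 1(5) 2(5) by (auto simp: image_subset_iff)
      \<comment> \<open>Otherwise the appended piece, timelike almost everywhere, would make the
        interval between \<open>b\<close> and \<open>d\<close> a null set.\<close>
      have "{t \<in> {a..d}. velocity_sat A (timelike_vec G T fut) ?\<gamma> a d t} \<notin> null_sets lebesgue"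
      proof
        let ?S = "{t \<in> {a..d}. velocity_sat A (timelike_vec G T fut) ?\<gamma> a d t}"
        assume "?S \<in> null_sets lebesgue"
        then have "negligible ?S" unfolding negligible_iff_null_sets .
        then have "negligible (?S \<union> {t. b < t \<and> t < d \<and> \<not> vel (timelike_vec G T fut) \<gamma>2 t})"
          using 2(2)[unfolded ae_vel_def] by (rule negligible_Un)
        moreover have "{b<..<d} \<subseteq> ?S \<union> {t. b < t \<and> t < d \<and> \<not> vel (timelike_vec G T fut) \<gamma>2 t}"
        proof
          fix t assume t: "t \<in> {b<..<d}"
          show "t \<in> ?S \<union> {t. b < t \<and> t < d \<and> \<not> vel (timelike_vec G T fut) \<gamma>2 t}"
          proof (cases "vel (timelike_vec G T fut) \<gamma>2 t")
            case True
            have "vel (timelike_vec G T fut) ?\<gamma> t"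
              by (rule vel_cong[OF open_greaterThan[of b] _ _ True]) (use t in auto)
            then show ?thesis using t lt velocity_sat_interior[of a t d "timelike_vec G T fut" ?\<gamma>] by simp
          qed (use t in auto)
        qed
        ultimately have "negligible {b<..<d}" by (rule negligible_subset)
        then show False using open_not_negligible[of "{b<..<d}"] lt by simp
      qed
      then obtain \<sigma> a' b' where \<sigma>: "loclip_curve A \<sigma> a' b'" "timelike_curve A G T fut \<sigma> a' b'"
          "\<sigma> a' = ?\<gamma> a" "\<sigma> b' = ?\<gamma> d" "\<sigma> ` {a'..b'} \<subseteq> U"
        using pu[unfolded push_up_property_def, rule_format, of ?\<gamma> a d fut U] loclip_imp_ac[OF ll] ca inU U(1)
        unfolding causal_curve_iff by blast
      have "q' \<in> rel_I A G T fut p U"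
        unfolding rel_I_def using \<sigma> 1(3) 2(4) lt by auto
      then show "rel_I A G T fut p U \<inter> N \<noteq> {}" using q'(1) \<open>W \<subseteq> N\<close> by blast
    qed
  qed
qed

section \<open>Equal boundaries give empty bubbles\<close>

lemma cylindrical_chartD:
  assumes "cylindrical_chart A G c p"
  shows "c \<in> A" "p \<in> snd c" "fst c p = 0"
proof -
  note * = assms[unfolded cylindrical_chart_def]
  show "c \<in> A" by (rule *[THEN conjunct1])
  show "p \<in> snd c" by (rule *[THEN conjunct2, THEN conjunct1])
  show "fst c p = 0" by (rule *[THEN conjunct2, THEN conjunct2, THEN conjunct1])
qed

text \<open>The time coordinate vanishes at the centre, and along a causal curve its signed value
  does not decrease. This is the obstruction that forces a descending vertical line out of
  \<open>J\<close>.\<close>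

lemma rel_J_time_sign:
  assumes c: "cone_chart c C" and p: "fst c p = 0" "p \<in> snd c" and m: "m \<in> rel_J A G T fut p (snd c)"
  shows "0 \<le> time_sign c fut (fst c m) * fst (fst c m)"
proof (cases "m = p")
  case False
  then obtain \<gamma> a b where g: "loclip_curve A \<gamma> a b" "ae_vel (causal_vec G T fut) \<gamma> a b" "\<gamma> a = p" "\<gamma> b = m" "\<gamma> ` {a..b} \<subseteq> snd c"
    using m unfolding rel_J_eq reach_def by blast
  have ab: "a < b" using g by (simp add: loclip_curve_def)
  obtain \<sigma> where s: "\<forall>u\<in>{a..b}. time_sign c fut (fst c (\<gamma> u)) = \<sigma>"
    and incr: "\<forall>u v. a \<le> u \<and> u \<le> v \<and> v \<le> b \<longrightarrow>
       norm (snd (fst c (\<gamma> v)) - snd (fst c (\<gamma> u))) \<le> C * (\<sigma> * (fst (fst c (\<gamma> v)) - fst (fst c (\<gamma> u))))"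
    using causal_curve_increments[OF loclip_imp_ac[OF g(1)] g(2) c order_refl less_imp_le[OF ab] order_refl g(5)]
    by (elim exE conjE) (rule that)
  have "0 \<le> C * (\<sigma> * (fst (fst c (\<gamma> b)) - fst (fst c (\<gamma> a))))"
    by (rule order_trans[OF norm_ge_zero incr[rule_format]]) (use ab in simp)
  then have "0 \<le> C * (\<sigma> * (fst (fst c m) - fst (fst c p)))" by (simp only: g(3,4))
  moreover have "C > 0" using c by (simp add: cone_chart_def)
  moreover have "time_sign c fut (fst c m) = \<sigma>" using bspec[OF s, of b] ab g(4) by simp
  ultimately show ?thesis using p(1) by (simp add: zero_le_mult_iff)
qed (simp add: p)

lemma frontier_eq_imp_bubble_empty:
  assumes cyl: "cylindrical_chart A G c p"
    and fr: "snd c \<inter> frontier (rel_I A G T fut p (snd c)) = snd c \<inter> frontier (rel_J A G T fut p (snd c))"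
  shows "rel_J A G T fut p (snd c) \<subseteq> closure (rel_I A G T fut p (snd c))"
proof
  let ?I = "rel_I A G T fut p (snd c)" and ?J = "rel_J A G T fut p (snd c)"
  fix q assume q: "q \<in> ?J"
  obtain C where cone: "cone_chart c C" by (rule cylindrical_cone_chart[OF cyl])
  note c = cylindrical_chartD[OF cyl]
  have U: "open (snd c)" by (rule chart_open[OF c(1)])
  obtain L V where LV: "fst c ` snd c = L \<times> V" "is_interval L" "(0::real) \<in> L" "open V" "0 \<in> V"
    using cyl unfolding cylindrical_chart_def by (elim conjE exE) (rule that)
  have qU: "q \<in> snd c" using q rel_J_subset[OF c(2)] by blast
  define t where "t = fst (fst c q)"
  define x where "x = snd (fst c q)"
  have tx: "fst c q = (t, x)" by (simp add: t_def x_def)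
  have tL: "t \<in> L" "x \<in> V" using qU LV(1) tx by (metis imageI mem_Sigma_iff)+
  define \<sigma> where "\<sigma> = time_sign c fut (t, x)"
  have qimg: "(t, x) \<in> fst c ` snd c" using qU tx by (metis imageI)
  have \<sigma>: "\<sigma> = 1 \<or> \<sigma> = - 1"
    using orientation_fst_nonzero[OF cone qimg] by (auto simp: \<sigma>_def time_sign_def sgn_if)
  have \<sigma>t: "0 \<le> \<sigma> * t" using rel_J_time_sign[OF cone c(3,2) q] by (simp add: tx \<sigma>_def)
  have "open (L \<times> V)" using chart_image_open[OF c(1)] LV(1) by simp
  \<comment> \<open>A priori 0 could be an end point of the interval \<open>L\<close>; openness of
    the chart image excludes this and leaves room on the past side of 0.\<close>
  then have "open L" using open_image_fst[of "L \<times> V"] LV(5) by (metis empty_iff fst_image_times)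
  then obtain e where e: "e > 0" "ball 0 e \<subseteq> L" using LV(3) open_contains_ball by metis
  define t1 where "t1 = - \<sigma> * (e / 2)"
  have t1L: "t1 \<in> L" using e \<sigma> by (intro subsetD[OF e(2)]) (auto simp: t1_def dist_real_def)
  have \<sigma>t1: "\<sigma> * t1 < 0" using e \<sigma> by (auto simp: t1_def)
  \<comment> \<open>The vertical segment from \<open>q\<close> to just beyond time 0. It stays in
    the chart because the image is a product with an interval.\<close>
  define S where "S = closed_segment t1 t \<times> {x}"
  have SLV: "S \<subseteq> fst c ` snd c"
    unfolding S_def LV(1) using closed_segment_subset[OF t1L tL(1)] LV(2) tL(2) by (auto simp: is_interval_convex_1)
  have Sconn: "connected S" unfolding S_def by (intro connected_Times) auto
  have sign: "time_sign c fut y = \<sigma>" if "y \<in> S" for y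
    unfolding \<sigma>_def by (rule time_sign_constant[OF cone Sconn SLV that]) (simp add: S_def)
  have order: "\<sigma> * s \<le> \<sigma> * t" if "s \<in> closed_segment t1 t" for s
    using that \<sigma> \<sigma>t \<sigma>t1 by (auto simp: closed_segment_eq_real_ivl split: if_splits)
  have S'conn: "connected (coord_inv c ` S)"
    by (rule connected_continuous_image[OF continuous_on_subset[OF coord_inv_continuous[OF c(1)] SLV] Sconn])
  show "q \<in> closure ?I"
  proof (rule ccontr)
    assume nq: "q \<notin> closure ?I"
    have "q = coord_inv c (t, x)" using c(1) qU by (simp flip: tx)
    then have "q \<in> coord_inv c ` S \<inter> ?J" using q by (auto simp: S_def)
    moreover have "coord_inv c (t1, x) \<notin> ?J"
    proof
      assume *: "coord_inv c (t1, x) \<in> ?J"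
      have "(t1, x) \<in> S" by (simp add: S_def)
      then have "0 \<le> \<sigma> * t1"
        using rel_J_time_sign[OF cone c(3,2) *] sign SLV by (simp add: subset_iff)
      then show False using \<sigma>t1 by simp
    qed
    then have "coord_inv c ` S - ?J \<noteq> {}" by (auto simp: S_def)
    \<comment> \<open>A connected set meeting both \<open>J\<close> and its complement meets the
      frontier of \<open>J\<close>, which inside the chart is also the frontier of
      \<open>I\<close>.\<close>
    ultimately obtain z where z: "z \<in> coord_inv c ` S" "z \<in> frontier ?J"
      using connected_Int_frontier[OF S'conn, of ?J] by blast
    obtain s where s: "z = coord_inv c (s, x)" "s \<in> closed_segment t1 t" using z(1) by (auto simp: S_def)
    have sS: "(s, x) \<in> S" using s by (simp add: S_def)
    then have simg: "(s, x) \<in> fst c ` snd c" using SLV by blast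
    have "z \<in> snd c" using simg s coord_inv_mem by blast
    then have "z \<in> snd c \<inter> frontier ?I" unfolding fr using z(2) by blast
    then have "z \<in> closure ?I" unfolding frontier_def by blast
    then have zI: "coord_inv c (s, x) \<in> closure ?I" by (simp only: s(1))
    have "s \<noteq> t" using nq zI \<open>q = coord_inv c (t, x)\<close> by auto
    then have lt: "\<sigma> * s < \<sigma> * t" using order[OF s(2)] \<sigma> by auto
    have "timelike_vec G T fut c (s, x) (\<sigma>, 0)"
      by (rule time_direction_timelike[OF cone simg]) (use sign[OF sS] \<sigma> in auto)
    moreover have "(s, x) \<in> fst c ` (snd c \<inter> snd c)" using simg by simp
    ultimately obtain \<rho> where \<rho>: "\<rho> > 0"
      "\<And>y z r. y \<in> ball (s, x) \<rho> \<Longrightarrow> z \<in> ball (s, x) \<rho> \<Longrightarrow> r > 0 \<Longrightarrow> (1 / r) *\<^sub>R (z - y) \<in> ball (\<sigma>, 0) \<rho> \<Longrightarrow>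
       coord_inv c y \<in> closure ?I \<Longrightarrow> coord_inv c z \<in> ?I"
      using closure_cone[OF U rel_I_up c(1)] by metis
    \<comment> \<open>The exit point lies only in the closure of \<open>I\<close>. A first step of
      size \<open>r\<close>, inside the local cone and ending before \<open>t\<close>, enters
      \<open>I\<close>; the rest of the vertical segment is an ordinary timelike curve.\<close>
    define r where "r = min (\<rho> / 2) ((\<sigma> * t - \<sigma> * s) / 2)"
    have r0: "0 < r" using \<rho>(1) lt by (simp add: r_def)
    have "r \<le> \<rho> / 2" "r \<le> (\<sigma> * t - \<sigma> * s) / 2"
      unfolding r_def by (rule min.cobounded1, rule min.cobounded2)
    then have r: "0 < r" "r < \<rho>" "r < \<sigma> * t - \<sigma> * s" using r0 \<rho>(1) lt by argo+
    have m1: "coord_inv c (s + r * \<sigma>, x) \<in> ?I"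
    proof (rule \<rho>(2)[of "(s, x)" _ r])
      show "(s, x) \<in> ball (s, x) \<rho>" using \<rho>(1) by simp
      show "(s + r * \<sigma>, x) \<in> ball (s, x) \<rho>" using r \<sigma> by (auto simp: dist_Pair_Pair dist_real_def)
      show "(1 / r) *\<^sub>R ((s + r * \<sigma>, x) - (s, x)) \<in> ball (\<sigma>, 0) \<rho>" using r \<rho>(1) by simp
    qed (use r zI in auto)
    define h where "h = t - (s + r * \<sigma>)"
    have "\<sigma> * h = \<sigma> * t - \<sigma> * s - r" using \<sigma> by (auto simp: h_def)
    then have h: "0 < \<sigma> * h" using r(3) by simp
    have inS: "(s + r * \<sigma>, x) + u *\<^sub>R (h, 0) \<in> S" if u: "0 \<le> u" "u \<le> 1" for u
    proof -
      have "s + r * \<sigma> \<in> closed_segment s t"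
        using r \<sigma> lt by (auto simp: closed_segment_eq_real_ivl)
      then have "closed_segment (s + r * \<sigma>) t \<subseteq> closed_segment t1 t"
        using subsetD[OF closed_segment_subset[OF s(2) ends_in_segment(2) convex_closed_segment]]
        by (intro closed_segment_subset[OF _ ends_in_segment(2) convex_closed_segment]) blast
      moreover have "s + r * \<sigma> + u * h \<in> closed_segment (s + r * \<sigma>) t"
        unfolding closed_segment_def using u by (auto simp: h_def algebra_simps intro!: exI[of _ u])
      ultimately show ?thesis by (auto simp: S_def)
    qed
    have "reach (timelike_vec G T fut) (snd c) (coord_inv c (s + r * \<sigma>, x)) (coord_inv c ((s + r * \<sigma>, x) + (h, 0)))"
    proof (rule reach_segment[OF c(1)])
      show "(s + r * \<sigma>, x) + u *\<^sub>R (h, 0) \<in> fst c ` (snd c \<inter> snd c)" if "0 \<le> u" "u \<le> 1" for u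
        using inS[OF that] SLV by auto
      show "timelike_vec G T fut c ((s + r * \<sigma>, x) + u *\<^sub>R (h, 0)) (h, 0)" if "0 < u" "u < 1" for u
        using inS[of u] that sign SLV h by (intro time_direction_timelike[OF cone]) auto
    qed
    then have "coord_inv c ((s + r * \<sigma>, x) + (h, 0)) \<in> ?I" using m1 rel_I_up by blast
    moreover have "(s + r * \<sigma>, x) + (h, 0) = (t, x)" by (simp add: h_def)
    ultimately have "q \<in> ?I" using \<open>q = coord_inv c (t, x)\<close> by simp
    then show False using nq closure_subset by blast
  qed
qed

section \<open>Empty bubbles give push-up\<close>

text \<open>\<open>H\<close> gives information about the causal past of a chart's centre, so the
  chart is centred at the new end point \<open>\<gamma> v\<close> and \<open>H\<close> is applied
  with reversed direction. The old timelike curve is cut at \<open>\<tau>\<close> and rerouted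
  through a point \<open>m\<close> near its later point \<open>\<sigma> \<tau>'\<close>.\<close>

lemma reach_step:
  assumes H: "\<And>p c fut. cylindrical_chart A G c p \<Longrightarrow> rel_J A G T fut p (snd c) \<subseteq> closure (rel_I A G T fut p (snd c))"
    and \<gamma>: "ac_curve A \<gamma> a b" "ae_vel (causal_vec G T fut) \<gamma> a b"
    and N: "open N" and W: "open W" "\<And>m. m \<in> W \<Longrightarrow> \<exists>c. cylindrical_chart A G c m \<and> W \<subseteq> snd c \<and> snd c \<subseteq> N"
    and uv: "a \<le> u" "u < v" "v \<le> b" "\<gamma> ` {u..v} \<subseteq> W"
    and p: "reach (timelike_vec G T fut) N p (\<gamma> u)"
  shows "reach (timelike_vec G T fut) N p (\<gamma> v)"
proof -
  let ?tl = "timelike_vec G T fut"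
  have "\<gamma> v \<in> W" using uv by auto
  then obtain c where c: "cylindrical_chart A G c (\<gamma> v)" "W \<subseteq> snd c" "snd c \<subseteq> N" using W(2) by blast
  obtain C where cone: "cone_chart c C" by (rule cylindrical_cone_chart[OF c(1)])
  obtain \<sigma> a' b' where s: "loclip_curve A \<sigma> a' b'" "ae_vel ?tl \<sigma> a' b'" "\<sigma> a' = p" "\<sigma> b' = \<gamma> u" "\<sigma> ` {a'..b'} \<subseteq> N"
    using p unfolding reach_def by blast
  have ab': "a' < b'" and cont: "continuous_on {a'..b'} \<sigma>" using s(1) by (auto simp: loclip_curve_def)
  have "\<sigma> b' \<in> W" using s(4) uv by auto
  moreover have "continuous (at b' within {a'..b'}) \<sigma>"
    using cont ab' by (simp add: continuous_on_eq_continuous_within)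
  ultimately have "\<forall>\<^sub>F x in at b' within {a'..b'}. \<sigma> x \<in> W"
    using topological_tendstoD[of \<sigma> "\<sigma> b'" "at b' within {a'..b'}" W] W(1)
    by (simp add: continuous_within)
  then obtain \<eta> where \<eta>: "\<eta> > 0" "\<forall>x\<in>{a'..b'}. x \<noteq> b' \<and> dist x b' < \<eta> \<longrightarrow> \<sigma> x \<in> W"
    unfolding eventually_at by blast
  have inW: "\<sigma> x \<in> W" if "a' \<le> x" "b' - \<eta> < x" "x \<le> b'" for x
    using \<eta>(2) that \<open>\<sigma> b' \<in> W\<close> by (cases "x = b'") (auto simp: dist_real_def)
  \<comment> \<open>From here on \<open>\<sigma>\<close> stays in \<open>W\<close>, hence in the
    chart around \<open>\<gamma> v\<close>.\<close>
  define lo where "lo = max a' (b' - \<eta>)"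
  have lo: "lo < b'" "a' \<le> lo" using ab' \<eta>(1) by (auto simp: lo_def)
  have "\<not> {lo<..<b'} \<subseteq> {t. a' < t \<and> t < b' \<and> \<not> vel ?tl \<sigma> t}"
    using s(2) lo open_not_negligible[of "{lo<..<b'}"] negligible_subset unfolding ae_vel_def by auto
  then obtain \<tau> where "\<tau> \<in> {lo<..<b'}" "\<tau> \<notin> {t. a' < t \<and> t < b' \<and> \<not> vel ?tl \<sigma> t}" by blast
  then have \<tau>: "lo < \<tau>" "\<tau> < b'" "vel ?tl \<sigma> \<tau>" using lo by auto
  have "isCont \<sigma> \<tau>" by (rule continuous_on_interior[OF cont]) (use \<tau> lo in auto)
  moreover have "\<sigma> \<tau> \<in> N" using s(5) \<tau> lo by auto
  ultimately obtain \<delta> where \<delta>: "\<delta> > 0"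
    "\<And>x. \<tau> < x \<Longrightarrow> x < \<tau> + \<delta> \<Longrightarrow> \<exists>W. open W \<and> \<sigma> x \<in> W \<and> (\<forall>m\<in>W. reach ?tl N (\<sigma> \<tau>) m)"
    using reach_along_timelike_velocity[OF \<tau>(3) _ N] by metis
  \<comment> \<open>Strictly later than \<open>\<tau>\<close>, so that the future of
    \<open>\<sigma> \<tau>\<close> contains a neighbourhood of \<open>\<sigma> \<tau>'\<close>, and
    strictly before \<open>b'\<close>, so that a causal piece up to \<open>\<gamma> u\<close>
    remains.\<close>
  define \<tau>' where "\<tau>' = (\<tau> + min b' (\<tau> + \<delta>)) / 2"
  have \<tau>': "\<tau> < \<tau>'" "\<tau>' < b'" "\<tau>' < \<tau> + \<delta>" using \<tau>(2) \<delta>(1) by (auto simp: \<tau>'_def min_def field_simps)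
  then obtain X where X: "open X" "\<sigma> \<tau>' \<in> X" "\<forall>m\<in>X. reach ?tl N (\<sigma> \<tau>) m" using \<delta>(2) by blast
  have "reach (causal_vec G T fut) (snd c) (\<sigma> \<tau>') (\<sigma> b')"
  proof (rule causal_curve_reach[OF loclip_imp_ac[OF s(1)] ae_vel_mono[OF s(2) vel_timelike_imp_causal] cone])
    have "\<sigma> x \<in> snd c" if "x \<in> {\<tau>'..b'}" for x
      using inW[of x] that c(2) \<tau> \<tau>' by (auto simp: lo_def)
    then show "\<sigma> ` {\<tau>'..b'} \<subseteq> snd c" by blast
  qed (use \<tau> \<tau>' lo in auto)
  moreover have "reach (causal_vec G T fut) (snd c) (\<gamma> u) (\<gamma> v)"
    using uv c(2) by (intro causal_curve_reach[OF \<gamma> cone]) auto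
  ultimately have "reach (causal_vec G T fut) (snd c) (\<sigma> \<tau>') (\<gamma> v)" using s(4) reach_trans by metis
  \<comment> \<open>Approximation by the timelike past of \<open>\<gamma> v\<close> yields a point
    \<open>m\<close> in the open set \<open>X\<close>, which is reachable from
    \<open>\<sigma> \<tau>\<close> and reaches \<open>\<gamma> v\<close>.\<close>
  then have "\<sigma> \<tau>' \<in> rel_J A G T (\<not> fut) (\<gamma> v) (snd c)"
    unfolding rel_J_eq using reach_causal_reverse by blast
  then have "\<sigma> \<tau>' \<in> closure (rel_I A G T (\<not> fut) (\<gamma> v) (snd c))" using H[OF c(1)] by blast
  then obtain m where m: "m \<in> X" "m \<in> rel_I A G T (\<not> fut) (\<gamma> v) (snd c)"
    using X(1,2) unfolding closure_iff_nhds_not_empty by blast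
  have "reach ?tl (snd c) m (\<gamma> v)" using m(2) reach_reverse[of "\<not> fut"] unfolding rel_I_eq by auto
  then have 3: "reach ?tl N m (\<gamma> v)" using c(3) by (rule reach_mono)
  have 2: "reach ?tl N (\<sigma> \<tau>) m" using X(3) m(1) by blast
  have 1: "reach ?tl N p (\<sigma> \<tau>)"
    unfolding reach_def
  proof (intro exI conjI)
    show "loclip_curve A \<sigma> a' \<tau>" by (rule loclip_curve_subinterval[OF s(1)]) (use \<tau> lo in auto)
    show "ae_vel ?tl \<sigma> a' \<tau>" by (rule ae_vel_subinterval[OF s(2)]) (use \<tau> in auto)
    show "\<sigma> ` {a'..\<tau>} \<subseteq> N" using s(5) \<tau> by auto
  qed (use s in auto)
  show ?thesis using reach_trans[OF reach_trans[OF 1 2] 3] .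
qed

lemma reach_from_timelike_velocity:
  assumes H: "\<And>p c fut. cylindrical_chart A G c p \<Longrightarrow> rel_J A G T fut p (snd c) \<subseteq> closure (rel_I A G T fut p (snd c))"
    and \<gamma>: "ac_curve A \<gamma> a b" "ae_vel (causal_vec G T fut) \<gamma> a b"
    and N: "open N" "\<gamma> ` {a..b} \<subseteq> N" and t0: "a < t0" "t0 < b" "vel (timelike_vec G T fut) \<gamma> t0"
  shows "reach (timelike_vec G T fut) N (\<gamma> t0) (\<gamma> b)"
proof -
  let ?tl = "timelike_vec G T fut"
  have cont: "continuous_on {a..b} \<gamma>" using \<gamma>(1) by (simp add: ac_curve_def)
  have "isCont \<gamma> t0" by (rule continuous_on_interior[OF cont]) (use t0 in auto)
  moreover have "\<gamma> t0 \<in> N" using N(2) t0 by auto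
  ultimately obtain \<delta> where \<delta>: "\<delta> > 0"
    "\<And>x. t0 < x \<Longrightarrow> x < t0 + \<delta> \<Longrightarrow> \<exists>W. open W \<and> \<gamma> x \<in> W \<and> (\<forall>m\<in>W. reach ?tl N (\<gamma> t0) m)"
    using reach_along_timelike_velocity[OF t0(3) _ N(1)] by metis
  \<comment> \<open>The timelike velocity at \<open>t0\<close> supplies the first reachable point;
    the induction then only has to carry reachability along from \<open>s0\<close> to
    \<open>b\<close>.\<close>
  define s0 where "s0 = (t0 + min b (t0 + \<delta>)) / 2"
  have s0: "t0 < s0" "s0 < b" "s0 < t0 + \<delta>" using t0(2) \<delta>(1) by (auto simp: s0_def min_def field_simps)
  have start: "reach ?tl N (\<gamma> t0) (\<gamma> s0)" using \<delta>(2)[OF s0(1,3)] by blast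
  \<comment> \<open>Phrased as an implication, the property composes over adjacent intervals as the
    Bolzano induction demands.\<close>
  define P where "P u v \<longleftrightarrow> s0 \<le> u \<and> v \<le> b \<and> reach ?tl N (\<gamma> t0) (\<gamma> u) \<longrightarrow> reach ?tl N (\<gamma> t0) (\<gamma> v)" for u v
  have "P s0 b" using less_imp_le[OF s0(2)]
  proof (induction rule: Bolzano)
    case (trans x y z)
    then show ?case unfolding P_def by (meson order_trans)
  next
    case (local x)
    have x: "x \<in> {a..b}" using local s0 t0 by auto
    then have "\<gamma> x \<in> N" using N(2) by blast
    then obtain W where W: "open W" "\<gamma> x \<in> W"
      "\<And>m. m \<in> W \<Longrightarrow> \<exists>c. cylindrical_chart A G c m \<and> W \<subseteq> snd c \<and> snd c \<subseteq> N"
      using uniform_cylindrical_charts[OF N(1)] by metis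
    have "continuous (at x within {a..b}) \<gamma>"
      using cont x by (simp add: continuous_on_eq_continuous_within)
    then have "\<forall>\<^sub>F y in at x within {a..b}. \<gamma> y \<in> W"
      using topological_tendstoD[of \<gamma> "\<gamma> x" "at x within {a..b}" W] W(1,2)
      by (simp add: continuous_within)
    then obtain \<eta> where \<eta>: "\<eta> > 0" "\<forall>y\<in>{a..b}. y \<noteq> x \<and> dist y x < \<eta> \<longrightarrow> \<gamma> y \<in> W"
      unfolding eventually_at by blast
    have "P u v" if uv: "u \<le> x" "x \<le> v" "v - u < \<eta>" for u v
      unfolding P_def
    proof
      assume A: "s0 \<le> u \<and> v \<le> b \<and> reach ?tl N (\<gamma> t0) (\<gamma> u)"
      show "reach ?tl N (\<gamma> t0) (\<gamma> v)"
      proof (cases "u = v")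
        case False
        have "\<gamma> y \<in> W" if "y \<in> {u..v}" for y
          using \<eta>(2)[rule_format, of y] that uv A s0 t0 W(2) by (cases "y = x") (auto simp: dist_real_def)
        then have "\<gamma> ` {u..v} \<subseteq> W" by blast
        then show ?thesis
          using reach_step[OF H \<gamma> N(1) W(1,3), of u v "\<gamma> t0"] A uv False s0 t0 by auto
      qed (use A in simp)
    qed
    then show ?case using \<eta>(1) by blast
  qed
  then show ?thesis using start by (simp add: P_def)
qed

lemma bubble_empty_imp_push_up:
  assumes H: "\<And>p c fut. cylindrical_chart A G c p \<Longrightarrow> rel_J A G T fut p (snd c) \<subseteq> closure (rel_I A G T fut p (snd c))"
  shows "push_up_property A G T"
  unfolding push_up_property_def
proof (intro allI impI, elim conjE)
  fix fut \<gamma> a b N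
  assume \<gamma>: "ac_curve A \<gamma> a b" "causal_curve A G T fut \<gamma> a b"
    and pos: "{t \<in> {a..b}. velocity_sat A (timelike_vec G T fut) \<gamma> a b t} \<notin> null_sets lebesgue"
    and N: "open N" "\<gamma> ` {a..b} \<subseteq> N"
  let ?S = "{t \<in> {a..b}. velocity_sat A (timelike_vec G T fut) \<gamma> a b t}"
  have ca: "ae_vel (causal_vec G T fut) \<gamma> a b" using \<gamma>(2) by (simp add: causal_curve_iff)
  \<comment> \<open>Two points form a null set, so some timelike velocity occurs in the interior,
    where it is a two-sided derivative.\<close>
  have "\<not> ?S \<subseteq> {a, b}"
    using pos negligible_subset[of "{a, b}" ?S] by (auto simp: negligible_iff_null_sets[symmetric])
  then obtain t0 where "t0 \<in> ?S" "t0 \<notin> {a, b}" by blast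
  then have t0: "a < t0" "t0 < b" "velocity_sat A (timelike_vec G T fut) \<gamma> a b t0" by auto
  then have v0: "vel (timelike_vec G T fut) \<gamma> t0" using velocity_sat_interior by blast
  have up: "reach (timelike_vec G T fut) N (\<gamma> t0) (\<gamma> b)"
    by (rule reach_from_timelike_velocity[OF H \<gamma>(1) ca N t0(1,2) v0])
  \<comment> \<open>The reversed curve is causal in the opposite direction and runs from
    \<open>\<gamma> b\<close> to \<open>\<gamma> a\<close>; the result for its part after
    \<open>- t0\<close> is reversed back.\<close>
  let ?g = "\<lambda>t. \<gamma> (- 1 * t + 0)"
  have g1: "ac_curve A ?g (- b) (- a)" by (rule ac_curve_reverse[OF \<gamma>(1)])
  have g2: "ae_vel (causal_vec G T (\<not> fut)) ?g (- b) (- a)"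
    by (rule ae_vel_affine[where e = "- 1", OF ca], simp, erule (2) causal_uminus, auto)
  have g3: "?g ` {- b..- a} \<subseteq> N" using N(2) by (auto simp: image_subset_iff)
  have g4: "vel (timelike_vec G T (\<not> fut)) ?g (- t0)"
    by (rule vel_affine[where e = "- 1" and P = "timelike_vec G T fut"], simp add: v0, erule (2) timelike_uminus)
  have "reach (timelike_vec G T (\<not> fut)) N (?g (- t0)) (?g (- a))"
    by (rule reach_from_timelike_velocity[OF H g1 g2 N(1) g3 _ _ g4]) (use t0 in auto)
  then have "reach (timelike_vec G T fut) N (\<gamma> a) (\<gamma> t0)" using reach_reverse[of "\<not> fut"] by force
  then have "reach (timelike_vec G T fut) N (\<gamma> a) (\<gamma> b)" using up by (rule reach_trans)
  then show "\<exists>\<sigma> a' b'. loclip_curve A \<sigma> a' b' \<and> timelike_curve A G T fut \<sigma> a' b' \<and>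
      \<sigma> a' = \<gamma> a \<and> \<sigma> b' = \<gamma> b \<and> \<sigma> ` {a'..b'} \<subseteq> N"
    unfolding reach_def timelike_curve_iff .
qed

end

theorem theorem2p12:
  fixes A :: "('m::{t2_space, second_countable_topology}, 'v::euclidean_space) chart set"
    and G :: "('m, 'v) chart \<Rightarrow> real \<times> 'v \<Rightarrow> real \<times> 'v \<Rightarrow> real \<times> 'v \<Rightarrow> real"
    and T :: "('m, 'v) chart \<Rightarrow> real \<times> 'v \<Rightarrow> real \<times> 'v"
  assumes "continuous_spacetime A G T"
  shows "((\<forall>p c. cylindrical_chart A G c p \<longrightarrow>
             bubble_ext A G T True p (snd c) = {} \<and> bubble_ext A G T False p (snd c) = {})
          \<longleftrightarrow>
          (\<forall>p c. cylindrical_chart A G c p \<longrightarrow>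
             top_of_set (snd c) frontier_of rel_I A G T True p (snd c)
               = top_of_set (snd c) frontier_of rel_J A G T True p (snd c) \<and>
             top_of_set (snd c) frontier_of rel_I A G T False p (snd c)
               = top_of_set (snd c) frontier_of rel_J A G T False p (snd c)))
       \<and>
         ((\<forall>p c. cylindrical_chart A G c p \<longrightarrow>
             top_of_set (snd c) frontier_of rel_I A G T True p (snd c)
               = top_of_set (snd c) frontier_of rel_J A G T True p (snd c) \<and>
             top_of_set (snd c) frontier_of rel_I A G T False p (snd c)
               = top_of_set (snd c) frontier_of rel_J A G T False p (snd c))
          \<longleftrightarrow> push_up_property A G T)"
proof -
  interpret spacetime A G T by (rule spacetime.intro[OF assms])
  let ?J = "\<lambda>fut p c. rel_J A G T fut p (snd c)" and ?I = "\<lambda>fut p c. rel_I A G T fut p (snd c)"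
  have c: "open (snd c)" "p \<in> snd c" if "cylindrical_chart A G c p" for c p
    using cylindrical_chartD[OF that] chart_open by blast+
  \<comment> \<open>All three conditions are reduced to the same inclusion of \<open>J\<close> in
    the closure of \<open>I\<close>, over all cylindrical charts and both time directions.\<close>
  have bubble: "bubble_ext A G T fut p (snd c) = {} \<longleftrightarrow> ?J fut p c \<subseteq> closure (?I fut p c)"
    if "cylindrical_chart A G c p" for fut p c
    by (rule bubble_ext_empty_iff[OF c(2)[OF that]])
  have frontier: "top_of_set (snd c) frontier_of ?I fut p c = top_of_set (snd c) frontier_of ?J fut p c \<longleftrightarrow>
      ?J fut p c \<subseteq> closure (?I fut p c)" if cyl: "cylindrical_chart A G c p" for fut p c
    unfolding frontier_eq_iff[OF c[OF cyl]]
    using bubble_empty_imp_frontier_eq[OF c[OF cyl]] frontier_eq_imp_bubble_empty[OF cyl] by blast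
  have push: "push_up_property A G T \<longleftrightarrow>
      (\<forall>p c. cylindrical_chart A G c p \<longrightarrow> (\<forall>fut. ?J fut p c \<subseteq> closure (?I fut p c)))"
    using bubble_empty_imp_push_up push_up_imp_bubble_empty[OF _ c] by blast
  show ?thesis
    unfolding push by (simp add: bubble frontier all_bool_eq)
qed

end
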